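(* Let $p^*=(x^*,\lambda^*,\mu^* )$ be a KKT point of the central NLP such that Assumptions 1, 2.b, 3 and 4 (listed in the context) hold at $p^*$, and let $\beta>0$. Then there exist an upper bound on the step size $\bar\alpha>0$, a lower bound on the penalty parameter $\bar\gamma<\infty$, and a radius $r>0$ such that if $\alpha<\bar\alpha$ (with $\alpha\in(0,1)$), $\gamma>\bar\gamma$ (with $\gamma\ge0$) and $p^0\in\mathcal B_r(p^* )$, the sequence $\{p^q\}$ generated by Algorithm 2 with the local update (defined in the context), $p^{q+1}=T(p^q)$, is bounded and converges to $p^*$. Moreover, for all $q=1,2,\dots$ the algorithm is linearly convergent in one of the following (equivalent) senses: for any symmetric $Q\succ0$ the Lyapunov equation $\nabla T(p^* )^\top\bar P\,\nabla T(p^* )-\bar P=-Q$ has a solution $\bar P\succ0$ such that, with $C=\|\nabla T(p^* )\|_{\bar P}\in(0,1)$, $$\|p^q-p^*\|_{\bar P}\le C\|p^{q-1}-p^*\|_{\bar P},$$ or there exist constants $C_0>0$, $C_1\in(0,1)$ such that $$\|p^q-p^*\|\le C_0C_1^q\|p^0-p^*\|.$$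
   Context: **Central NLP.** $\mathcal G=(\mathcal V,\mathcal E)$ is an undirected connected graph, $\mathcal V=\{1,\dots,M\}$, and $\mathcal N_i=\{j\in\mathcal V: (i,j)\in\mathcal E,\ j\ne i\}$. Each $i\in\mathcal V$ has a variable $x_i\in\mathbb R^{n_i}$; $x_{\mathcal N_i}=[x_j]_{j\in\mathcal N_i}$. The central NLP is $$\min_{x_1,\dots,x_M}\ \sum_{i\in\mathcal V} f_i(x_i,x_{\mathcal N_i})\quad\text{s.t.}\quad g_i(x_i,x_{\mathcal N_i})=0,\quad h_i(x_i,x_{\mathcal N_i})\le 0,\quad i\in\mathcal V,$$ with multipliers $\lambda_i\in\mathbb R^{n_{gi}}$ for $g_i$ and $\mu_i\in\mathbb R^{n_{hi}}$ for $h_i$; $f_i$ is scalar valued, $g_i,h_i$ take values in $\mathbb R^{n_{gi}},\mathbb R^{n_{hi}}$; all functions are at least three times continuously differentiable. Local Lagrangians: $L_i(x_i,\lambda_i,\mu_i,x_{\mathcal N_i})=f_i+\lambda_i^\top g_i+\mu_i^\top h_i$; central Lagrangian: $L(x,\lambda,\mu)=\sum_{i}L_i$. Stacked quantities: $x=[x_i]_i\in\mathbb R^n$, $\lambda=[\lambda_i]_i\in\mathbb R^{n_g}$, $\mu=[\mu_i]_i\in\mathbb R^{n_h}$, $p=(x,\lambda,\mu)\in\mathbb R^{m}$ with $m=n+n_g+n_h$, $p_i=(x_i,\lambda_i,\mu_i)$, $g(x)=[g_i(x_i,x_{\mathcal N_i})]_i$, $h(x)=[h_i(x_i,x_{\mathcal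 N_i})]_i$. For vector functions, $\nabla$ denotes the Jacobian; $\|\cdot\|$ is the Euclidean/spectral norm; $\mathcal B_r(p^* )$ is the open Euclidean ball; $\|v\|_{\bar P}=\sqrt{v^\top\bar Pv}$, with the induced matrix norm. **Decoupled and coupled constraints.** The constraints are partitioned as $g_i(x_i,x_{\mathcal N_i})=(g_{ii}(x_i),\,g_{\mathcal N_i}(x_i,x_{\mathcal N_i}))$ and $h_i(x_i,x_{\mathcal N_i})=(h_{ii}(x_i),\,h_{\mathcal N_i}(x_i,x_{\mathcal N_i}))$, where $g_{ii},h_{ii}$ depend only on the local variable $x_i$ and $g_{\mathcal N_i},h_{\mathcal N_i}$ on local and neighboring variables. Write $\bar g(x)=[g_{ii}(x_i)]_{i}$ and $\bar h(x)=[h_{ii}(x_i)]_i$ for the stacked decoupled constraints. A KKT point is $p=(x,\lambda,\mu)$ with $\nabla_{x}L(x,\lambda,\mu)=0$, $g(x)=0$, $h(x)\le0$, $\mu\ge0$, $\mathrm{diag}(\mu)h(x)=0$. Active set: $\mathcal A(x)=\{k\in\{1,\dots,n_h\}:[h(x)]_k=0\}$; $[\nabla_x\bar h(x^* )]_{\mathcal A(x^* )}$ denotes the rows of $\nabla_x\bar h(x^* )$ belonging to active decoupled inequality constraints. **Local NLPs.** For given $p$ and $\rho_i\ge0$, the local NLP of agent $i$ is $\min_{s_i\in\mathbb R^{n_i}}\bar f_i(s_i)$ s.t. $\bar g_i(s_i)=0$ (multiplier $\nu_i$), $\bar h_i(s_i)\le0$ (multiplier $\kappa_i$), where $$\bar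 f_i(s_i)=f_i(x_i+s_i,x_{\mathcal N_i})+\tfrac{\rho_i}{2}\|s_i\|^2+\sum_{j\in\mathcal N_i}\nabla_{x_i}L_j(x_j,\lambda_j,\mu_j,x_{\mathcal N_j})^\top s_i,$$ $\bar g_i(s_i)=g_i(x_i+s_i,x_{\mathcal N_i})$, $\bar h_i(s_i)=h_i(x_i+s_i,x_{\mathcal N_i})$ (all depending on $p$). Let $y_i=(s_i,\nu_i,\kappa_i)$ and $\bar L_i(y_i)=\bar f_i(s_i)+\nu_i^\top\bar g_i(s_i)+\kappa_i^\top\bar h_i(s_i)$. The local KKT conditions are $\nabla_{s_i}\bar L_i(y_i)=0$, $\bar g_i(s_i)=0$, $\bar h_i(s_i)\le0$, $\kappa_i\ge0$, $\mathrm{diag}(\kappa_i)\bar h_i(s_i)=0$. $\Phi(p)=(s(p),\nu(p),\kappa(p))$ denotes the stacked solution of all local KKT systems for given $p$; near $p^*$ it is the locally unique solution with $\Phi(p^* )=(0,\lambda^*,\mu^* )$, and $y=\Phi(p)$ is what the algorithm computes. **Algorithm 2 with local update.** With $\alpha\in(0,1)$, $\beta>0$, $\gamma\ge0$, in iteration $q$ each agent computes $y_i^q$ from $y^q=\Phi(p^q)$ and sets $$p_i^{q+1}=p_i^q+\alpha\big[P_i^q(y_i^q)(y_i^q-d_i(p_i^q))+P_{ii}^q(y_i^q)\,s_i^q\big],\qquad d_i(p_i)=(0,\lambda_i,\mu_i),$$ $$P_i^q(y_i)=\begin{bmatrix}\nabla^2_{s_is_i}\bar L_i(y_i)&\nabla_{s_i}\bar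 g_i(s_i)^\top&\nabla_{s_i}\bar h_i(s_i)^\top\\-\beta\nabla_{s_i}\bar g_i(s_i)&0&0\\-\beta\,\mathrm{diag}(\kappa_i)\nabla_{s_i}\bar h_i(s_i)&0&-\beta\,\mathrm{diag}(\bar h_i(s_i))\end{bmatrix},\qquad P^q_{ii}(y_i)=\gamma\begin{bmatrix}S^q_{ii}(y_i)\\0\\0\end{bmatrix},$$ $$S_{ii}^q(y_i)=(\nabla_{x_i}g_{ii})^\top\nabla_{x_i}g_{ii}+(\nabla_{x_i}h_{ii})^\top\,\mathrm{diag}(\kappa_{ii})^2\,\nabla_{x_i}h_{ii},$$ where the barred functions are formed at $p=p^q$, the Jacobians of $g_{ii},h_{ii}$ in $S^q_{ii}$ are evaluated at $x_i^q+s_i$, and $\kappa_{ii}$ is the part of $\kappa_i$ belonging to $h_{ii}$. $T$ denotes the stacked map $p^q\mapsto p^{q+1}$ and $\nabla T(p^* )$ its Jacobian at $p^*$. **Assumptions at $p^*$.** 1. Strict complementarity: $[\mu^*]_k>0$ for $k\in\mathcal A(x^* )$; and LICQ: the matrix $[\nabla_xg(x^* )^\top,\ [\nabla_xh(x^* )]_{\mathcal A(x^* )}^\top]$ has full column rank ($[\cdot]_{\mathcal A}$ selects rows). 2.b. Partial SOSC: $z^\top\nabla^2_{xx}L(x^*,\lambda^*,\mu^* )z>0$ for all $z\ne0$ with $\nabla_x\bar g(x^* )z=0$ and $[\nabla_x\bar h(x^* )]_{\mathcal A(x^* )}z=0$. 3. $\rho_i\ge0$ is such that $\nabla^2_{x_ix_i}L_i(x_i^*,\lambda_i^*,\mu_i^*,x^*_{\mathcal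 N_i})+\rho_iI\succ0$ for all $i\in\mathcal V$. 4. Constraint compatible decomposition: for each $i$ the matrix $[\nabla_{x_i}g_i(x_i^*,x^*_{\mathcal N_i})^\top,\ [\nabla_{x_i}h_i(x_i^*,x^*_{\mathcal N_i})]_{\mathcal A_i^*}^\top]$ has full column rank, where $\mathcal A_i^*=\{k:[h_i(x_i^*,x^*_{\mathcal N_i})]_k=0\}$.
   Formalization: The step-size bound and the radius may depend on the penalty parameter γ (bounds uniform in all large γ are impossible); the two senses of linear convergence are not claimed equivalent, as the first, with exact factor C, can fail; it is proved asymptotically for every factor above C. *)

theory Defs
  imports "HOL-Analysis.Analysis"
begin

section \<open>Derivatives and matrices\<close>

definition pd :: "'k::finite \<Rightarrow> (real^'k \<Rightarrow> real) \<Rightarrow> real^'k \<Rightarrow> real" where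
  "pd a F p = frechet_derivative F (at p) (axis a 1)"

definition hessian :: "(real^'k::finite \<Rightarrow> real) \<Rightarrow> real^'k \<Rightarrow> real^'k^'k" where
  "hessian F p = (\<chi> a b. pd b (pd a F) p)"

primrec C_k :: "nat \<Rightarrow> (real^'k::finite \<Rightarrow> real) \<Rightarrow> bool" where
  "C_k 0 F \<longleftrightarrow> continuous_on UNIV F"
| "C_k (Suc m) F \<longleftrightarrow> (\<forall>p. F differentiable (at p)) \<and> (\<forall>a. C_k m (pd a F))"

definition depends_only_on :: "'k::finite set \<Rightarrow> (real^'k \<Rightarrow> real) \<Rightarrow> bool" where
  "depends_only_on I F \<longleftrightarrow> (\<forall>p p'. (\<forall>a\<in>I. p $ a = p' $ a) \<longrightarrow> F p = F p')"

definition supported_on :: "'k::finite set \<Rightarrow> real^'k \<Rightarrow> bool" where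
  "supported_on I z \<longleftrightarrow> (\<forall>a. a \<notin> I \<longrightarrow> z $ a = 0)"

text \<open>Positive definiteness of the principal submatrix with index set \<open>I\<close>, in the sense of its
  quadratic form.\<close>

definition pos_def_block :: "'k::finite set \<Rightarrow> real^'k^'k \<Rightarrow> bool" where
  "pos_def_block I M \<longleftrightarrow> (\<forall>z. supported_on I z \<and> z \<noteq> 0 \<longrightarrow> z \<bullet> (M *v z) > 0)"

definition sym_pos_def :: "real^'k^'k::finite \<Rightarrow> bool" where
  "sym_pos_def M \<longleftrightarrow> transpose M = M \<and> pos_def_block UNIV M"

text \<open>Full column rank of the matrix with row index set \<open>R\<close>, column index set \<open>C\<close> and entries
  \<open>M $ a $ b\<close>. Filling up with zeros to a square matrix does not change the rank.\<close>

definition full_column_rank :: "'k::finite set \<Rightarrow> 'k set \<Rightarrow> real^'k^'k \<Rightarrow> bool" where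
  "full_column_rank R C M \<longleftrightarrow>
     rank ((\<chi> a b. if a \<in> R \<and> b \<in> C then M $ a $ b else 0) :: real^'k^'k) = card C"

definition weighted_norm :: "real^'k^'k \<Rightarrow> real^'k::finite \<Rightarrow> real" where
  "weighted_norm P v = sqrt (v \<bullet> (P *v v))"

definition induced_norm :: "real^'k^'k \<Rightarrow> real^'k^'k::finite \<Rightarrow> real" where
  "induced_norm P A = (SUP v. weighted_norm P (A *v v) / weighted_norm P v)"


section \<open>The central NLP\<close>

text \<open>
  Agents are the elements of a finite type \<open>'v\<close>. The finite type \<open>'k\<close> indexes the components of
  the stacked vector \<open>p = (x, \<lambda>, \<mu>)\<close>, so that \<open>m = CARD('k)\<close>. A component \<open>k\<close> belongs to agent
  \<open>owner N k\<close>, and is a component of \<open>x\<close> (\<open>Primal\<close>), the multiplier of an equality constraint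
  (\<open>EqCon\<close>), or the multiplier of an inequality constraint (\<open>IneqCon\<close>). In the last two cases \<open>k\<close>
  also names the scalar constraint function \<open>con N k\<close>. There may be no components of one of the
  kinds, i.e. \<open>n_g = 0\<close> or \<open>n_h = 0\<close> are allowed, which separate index types would exclude.

  The functions \<open>obj N i\<close> and \<open>con N k\<close> take all of \<open>p\<close> as argument but by \<open>well_formed\<close> depend
  only on the components of \<open>x\<close> of the agent and its neighbours, hence not on the multipliers.
\<close>

datatype component_kind = Primal | EqCon | IneqCon

record ('v, 'k) nlp =
  edges :: "('v \<times> 'v) set"
  owner :: "'k \<Rightarrow> 'v"
  kind :: "'k \<Rightarrow> component_kind"
  decoupled :: "'k \<Rightarrow> bool"
  obj :: "'v \<Rightarrow> real^'k \<Rightarrow> real"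
  con :: "'k \<Rightarrow> real^'k \<Rightarrow> real"

definition nbrs :: "('v::finite, 'k::finite) nlp \<Rightarrow> 'v \<Rightarrow> 'v set" where
  "nbrs N i = {j. (i, j) \<in> edges N \<and> j \<noteq> i}"

definition Xs :: "('v::finite, 'k::finite) nlp \<Rightarrow> 'k set" where
  "Xs N = {k. kind N k = Primal}"

definition Gs :: "('v::finite, 'k::finite) nlp \<Rightarrow> 'k set" where
  "Gs N = {k. kind N k = EqCon}"

definition Hs :: "('v::finite, 'k::finite) nlp \<Rightarrow> 'k set" where
  "Hs N = {k. kind N k = IneqCon}"

definition own :: "('v::finite, 'k::finite) nlp \<Rightarrow> 'v \<Rightarrow> 'k set" where
  "own N i = {k. owner N k = i}"

definition nbhd_vars :: "('v::finite, 'k::finite) nlp \<Rightarrow> 'v \<Rightarrow> 'k set" where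
  "nbhd_vars N i = Xs N \<inter> (\<Union>j \<in> insert i (nbrs N i). own N j)"

definition well_formed :: "('v::finite, 'k::finite) nlp \<Rightarrow> bool" where
  "well_formed N \<longleftrightarrow>
     sym (edges N) \<and> (\<forall>i j. (i, j) \<in> (edges N)\<^sup>*) \<and>
     (\<forall>i. C_k 3 (obj N i) \<and> depends_only_on (nbhd_vars N i) (obj N i)) \<and>
     (\<forall>k \<in> Gs N \<union> Hs N. C_k 3 (con N k) \<and> depends_only_on (nbhd_vars N (owner N k)) (con N k) \<and>
        (decoupled N k \<longrightarrow> depends_only_on (Xs N \<inter> own N (owner N k)) (con N k)))"

definition local_Lagrangian :: "('v::finite, 'k::finite) nlp \<Rightarrow> 'v \<Rightarrow> real^'k \<Rightarrow> real" where
  "local_Lagrangian N i p = obj N i p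
     + (\<Sum>k \<in> Gs N \<inter> own N i. p $ k * con N k p)
     + (\<Sum>k \<in> Hs N \<inter> own N i. p $ k * con N k p)"

definition Lagrangian :: "('v::finite, 'k::finite) nlp \<Rightarrow> real^'k \<Rightarrow> real" where
  "Lagrangian N p = (\<Sum>i\<in>UNIV. local_Lagrangian N i p)"

definition KKT_point :: "('v::finite, 'k::finite) nlp \<Rightarrow> real^'k \<Rightarrow> bool" where
  "KKT_point N p \<longleftrightarrow>
     (\<forall>a \<in> Xs N. pd a (Lagrangian N) p = 0) \<and>
     (\<forall>k \<in> Gs N. con N k p = 0) \<and>
     (\<forall>k \<in> Hs N. con N k p \<le> 0 \<and> p $ k \<ge> 0 \<and> p $ k * con N k p = 0)"

definition active :: "('v::finite, 'k::finite) nlp \<Rightarrow> real^'k \<Rightarrow> 'k set" where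
  "active N p = {k \<in> Hs N. con N k p = 0}"

text \<open>The column with index \<open>k\<close> is the gradient of the constraint \<open>k\<close>.\<close>

definition con_gradients :: "('v::finite, 'k::finite) nlp \<Rightarrow> real^'k \<Rightarrow> real^'k^'k" where
  "con_gradients N p = (\<chi> a k. pd a (con N k) p)"


section \<open>Assumptions at the KKT point\<close>

definition strict_complementarity :: "('v::finite, 'k::finite) nlp \<Rightarrow> real^'k \<Rightarrow> bool" where
  "strict_complementarity N p \<longleftrightarrow> (\<forall>k \<in> active N p. p $ k > 0)"

definition LICQ :: "('v::finite, 'k::finite) nlp \<Rightarrow> real^'k \<Rightarrow> bool" where
  "LICQ N p \<longleftrightarrow> full_column_rank (Xs N) (Gs N \<union> active N p) (con_gradients N p)"

definition partial_SOSC :: "('v::finite, 'k::finite) nlp \<Rightarrow> real^'k \<Rightarrow> bool" where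
  "partial_SOSC N p \<longleftrightarrow>
     (\<forall>z. supported_on (Xs N) z \<and> z \<noteq> 0 \<and>
        (\<forall>k \<in> Gs N \<union> active N p. decoupled N k \<longrightarrow> (\<Sum>a \<in> Xs N. pd a (con N k) p * z $ a) = 0)
        \<longrightarrow> z \<bullet> (hessian (Lagrangian N) p *v z) > 0)"

definition local_convexity ::
    "('v::finite, 'k::finite) nlp \<Rightarrow> ('v \<Rightarrow> real) \<Rightarrow> real^'k \<Rightarrow> bool" where
  "local_convexity N \<rho> p \<longleftrightarrow>
     (\<forall>i. \<rho> i \<ge> 0 \<and>
        pos_def_block (Xs N \<inter> own N i) (hessian (local_Lagrangian N i) p + \<rho> i *\<^sub>R mat 1))"

definition constraint_compatible :: "('v::finite, 'k::finite) nlp \<Rightarrow> real^'k \<Rightarrow> bool" where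
  "constraint_compatible N p \<longleftrightarrow>
     (\<forall>i. full_column_rank (Xs N \<inter> own N i) ((Gs N \<union> active N p) \<inter> own N i) (con_gradients N p))"


section \<open>The local NLPs\<close>

text \<open>
  A vector \<open>y\<close> stacks \<open>y\<^sub>i = (s\<^sub>i, \<nu>\<^sub>i, \<kappa>\<^sub>i)\<close> with the same indexing as \<open>p\<close>: its components of kind
  \<open>Primal\<close>, \<open>EqCon\<close>, \<open>IneqCon\<close> are those of \<open>s\<close>, \<open>\<nu>\<close>, \<open>\<kappa>\<close>. The functions \<open>local_obj N \<rho> p i\<close> and
  \<open>local_con N p k\<close> read only \<open>s\<^sub>i\<close> from their argument \<open>y\<close>, where \<open>i = owner N k\<close> for the latter.
\<close>

definition shift :: "('v::finite, 'k::finite) nlp \<Rightarrow> 'v \<Rightarrow> real^'k \<Rightarrow> real^'k \<Rightarrow> real^'k" where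
  "shift N i p y = (\<chi> a. if a \<in> Xs N \<inter> own N i then p $ a + y $ a else p $ a)"

definition local_obj ::
    "('v::finite, 'k::finite) nlp \<Rightarrow> ('v \<Rightarrow> real) \<Rightarrow> real^'k \<Rightarrow> 'v \<Rightarrow> real^'k \<Rightarrow> real" where
  "local_obj N \<rho> p i y = obj N i (shift N i p y)
     + \<rho> i / 2 * (\<Sum>a \<in> Xs N \<inter> own N i. (y $ a)\<^sup>2)
     + (\<Sum>j \<in> nbrs N i. \<Sum>a \<in> Xs N \<inter> own N i. pd a (local_Lagrangian N j) p * y $ a)"

definition local_con :: "('v::finite, 'k::finite) nlp \<Rightarrow> real^'k \<Rightarrow> 'k \<Rightarrow> real^'k \<Rightarrow> real" where
  "local_con N p k y = con N k (shift N (owner N k) p y)"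

definition local_NLP_Lagrangian ::
    "('v::finite, 'k::finite) nlp \<Rightarrow> ('v \<Rightarrow> real) \<Rightarrow> real^'k \<Rightarrow> 'v \<Rightarrow> real^'k \<Rightarrow> real" where
  "local_NLP_Lagrangian N \<rho> p i y = local_obj N \<rho> p i y
     + (\<Sum>k \<in> Gs N \<inter> own N i. y $ k * local_con N p k y)
     + (\<Sum>k \<in> Hs N \<inter> own N i. y $ k * local_con N p k y)"

definition local_KKT ::
    "('v::finite, 'k::finite) nlp \<Rightarrow> ('v \<Rightarrow> real) \<Rightarrow> real^'k \<Rightarrow> 'v \<Rightarrow> real^'k \<Rightarrow> bool" where
  "local_KKT N \<rho> p i y \<longleftrightarrow>
     (\<forall>a \<in> Xs N \<inter> own N i. pd a (local_NLP_Lagrangian N \<rho> p i) y = 0) \<and>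
     (\<forall>k \<in> Gs N \<inter> own N i. local_con N p k y = 0) \<and>
     (\<forall>k \<in> Hs N \<inter> own N i.
        local_con N p k y \<le> 0 \<and> y $ k \<ge> 0 \<and> y $ k * local_con N p k y = 0)"

text \<open>The stacked vectors \<open>d\<^sub>i(p\<^sub>i) = (0, \<lambda>\<^sub>i, \<mu>\<^sub>i)\<close>.\<close>

definition dvec :: "('v::finite, 'k::finite) nlp \<Rightarrow> real^'k \<Rightarrow> real^'k" where
  "dvec N p = (\<chi> a. if a \<in> Xs N then 0 else p $ a)"

text \<open>\<open>\<Phi>\<close> is the locally unique solution of all local KKT systems near \<open>p\<^sup>*\<close>, with
  \<open>\<Phi>(p\<^sup>*) = (0, \<lambda>\<^sup>*, \<mu>\<^sup>*)\<close>. Away from \<open>p\<^sup>*\<close> nothing is required of \<open>\<Phi>\<close>.\<close>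

definition solution_map ::
    "('v::finite, 'k::finite) nlp \<Rightarrow> ('v \<Rightarrow> real) \<Rightarrow> real^'k \<Rightarrow> (real^'k \<Rightarrow> real^'k) \<Rightarrow> bool" where
  "solution_map N \<rho> pstar \<Phi> \<longleftrightarrow>
     \<Phi> pstar = dvec N pstar \<and>
     (\<exists>\<delta>>0. \<exists>\<epsilon>>0. \<forall>p \<in> ball pstar \<delta>. \<forall>y \<in> ball (dvec N pstar) \<epsilon>.
        \<Phi> p \<in> ball (dvec N pstar) \<epsilon> \<and> ((\<forall>i. local_KKT N \<rho> p i y) \<longleftrightarrow> y = \<Phi> p))"


section \<open>The algorithm\<close>

text \<open>The block diagonal matrices composed of the \<open>P\<^sub>i(y\<^sub>i)\<close> and of the \<open>S\<^sub>i\<^sub>i(y\<^sub>i)\<close>, formed at \<open>p\<close>.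
  The latter is filled up with zero rows and columns, so that it acts on \<open>s\<close> only.\<close>

definition P_mat ::
    "('v::finite, 'k::finite) nlp \<Rightarrow> ('v \<Rightarrow> real) \<Rightarrow> real \<Rightarrow> real^'k \<Rightarrow> real^'k \<Rightarrow> real^'k^'k" where
  "P_mat N \<rho> \<beta> p y = (\<chi> a b. if owner N a \<noteq> owner N b then 0 else
     (case (kind N a, kind N b) of
        (Primal, Primal) \<Rightarrow> hessian (local_NLP_Lagrangian N \<rho> p (owner N a)) y $ a $ b
      | (Primal, EqCon) \<Rightarrow> pd a (local_con N p b) y
      | (Primal, IneqCon) \<Rightarrow> pd a (local_con N p b) y
      | (EqCon, Primal) \<Rightarrow> - \<beta> * pd b (local_con N p a) y
      | (IneqCon, Primal) \<Rightarrow> - \<beta> * (y $ a * pd b (local_con N p a) y)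
      | (IneqCon, IneqCon) \<Rightarrow> (if a = b then - \<beta> * local_con N p a y else 0)
      | _ \<Rightarrow> 0))"

definition S_mat :: "('v::finite, 'k::finite) nlp \<Rightarrow> real^'k \<Rightarrow> real^'k \<Rightarrow> real^'k^'k" where
  "S_mat N p y = (\<chi> a b. if a \<in> Xs N \<and> b \<in> Xs N \<and> owner N a = owner N b then
       (let i = owner N a; u = shift N i p y in
          (\<Sum>k \<in> {k \<in> Gs N \<inter> own N i. decoupled N k}. pd a (con N k) u * pd b (con N k) u)
        + (\<Sum>k \<in> {k \<in> Hs N \<inter> own N i. decoupled N k}.
             pd a (con N k) u * (y $ k)\<^sup>2 * pd b (con N k) u))
     else 0)"

definition alg_map ::
    "('v::finite, 'k::finite) nlp \<Rightarrow> ('v \<Rightarrow> real) \<Rightarrow> (real^'k \<Rightarrow> real^'k) \<Rightarrow>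
     real \<Rightarrow> real \<Rightarrow> real \<Rightarrow> real^'k \<Rightarrow> real^'k" where
  "alg_map N \<rho> \<Phi> \<alpha> \<beta> \<gamma> p = (let y = \<Phi> p in
     p + \<alpha> *\<^sub>R (P_mat N \<rho> \<beta> p y *v (y - dvec N p) + \<gamma> *\<^sub>R (S_mat N p y *v y)))"


section \<open>Linear convergence\<close>

definition lyapunov_solution :: "real^'k^'k \<Rightarrow> real^'k^'k \<Rightarrow> real^'k^'k::finite \<Rightarrow> bool" where
  "lyapunov_solution A Q P \<longleftrightarrow>
     sym_pos_def P \<and> transpose A ** P ** A - P = - Q \<and> 0 < induced_norm P A \<and> induced_norm P A < 1"

text \<open>The contraction factor here is exactly the norm of the Jacobian at the fixed point.\<close>

definition linear_conv_weighted ::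
    "(real^'k \<Rightarrow> real^'k) \<Rightarrow> real^'k::finite \<Rightarrow> real \<Rightarrow> bool" where
  "linear_conv_weighted T pstar r \<longleftrightarrow>
     (let A = jacobian T (at pstar) in
      \<forall>Q. sym_pos_def Q \<longrightarrow> (\<exists>P. lyapunov_solution A Q P \<and>
        (\<forall>p0 \<in> ball pstar r. \<forall>q\<ge>1.
           weighted_norm P ((T ^^ q) p0 - pstar)
             \<le> induced_norm P A * weighted_norm P ((T ^^ (q - 1)) p0 - pstar))))"

text \<open>For nonlinear \<open>T\<close> the estimate above need not hold for any radius. What always follows from
  convergence is the estimate with an arbitrary larger factor from some iteration on.\<close>

definition asymptotic_linear_conv_weighted ::
    "(real^'k \<Rightarrow> real^'k) \<Rightarrow> real^'k::finite \<Rightarrow> real \<Rightarrow> bool" where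
  "asymptotic_linear_conv_weighted T pstar r \<longleftrightarrow>
     (let A = jacobian T (at pstar) in
      \<forall>Q. sym_pos_def Q \<longrightarrow> (\<exists>P. lyapunov_solution A Q P \<and>
        (\<forall>C > induced_norm P A. \<forall>p0 \<in> ball pstar r. \<forall>\<^sub>F q in sequentially.
           weighted_norm P ((T ^^ Suc q) p0 - pstar)
             \<le> C * weighted_norm P ((T ^^ q) p0 - pstar))))"

definition linear_conv_euclidean ::
    "(real^'k \<Rightarrow> real^'k) \<Rightarrow> real^'k::finite \<Rightarrow> real \<Rightarrow> bool" where
  "linear_conv_euclidean T pstar r \<longleftrightarrow>
     (\<exists>C0>0. \<exists>C1. 0 < C1 \<and> C1 < 1 \<and>
        (\<forall>p0 \<in> ball pstar r. \<forall>q\<ge>1.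
           norm ((T ^^ q) p0 - pstar) \<le> C0 * C1 ^ q * norm (p0 - pstar)))"

end

theory Submission
  imports Defs
begin

text \<open>
  One iteration is a damped step \<open>p + \<alpha> F(p)\<close> along the field
  \<open>F(p) = P (\<Phi>(p) - d(p)) + \<gamma> S \<Phi>(p)\<close>. Local linear convergence for all small \<open>\<alpha>\<close> follows once
  the derivative \<open>A\<close> of \<open>F\<close> at \<open>p\<^sup>*\<close> dissipates some positive definite quadratic form \<open>B\<close>, that is
  \<open>B(e, A e) < 0\<close> for \<open>e \<noteq> 0\<close>: the first-order decrease \<open>2 \<alpha> B(e, F)\<close> then dominates both the
  nonlinear remainder and the term of order \<open>\<alpha>\<^sup>2\<close>, so that a step contracts \<open>B\<close> by a factor
  \<open>1 - \<alpha> c\<close> (\<open>damped_step_contraction\<close>). The same contraction for the linear map \<open>M = I + \<alpha> A\<close>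
  makes its powers tend to zero, which makes \<open>X \<mapsto> M\<^sup>T X M - X\<close> injective, hence bijective, on
  matrices. This solves the discrete Lyapunov equation (\<open>discrete_lyapunov\<close>).

  To find \<open>A\<close>, collect the local KKT systems in one residual \<open>K(p, y)\<close> whose components are the
  gradients of the local Lagrangians, the equality constraints and the products \<open>\<kappa>\<^sub>k h\<^sub>k\<close>. By strict
  complementarity, solving the KKT systems near \<open>p\<^sup>*\<close> is the same as solving \<open>K(p, y) = 0\<close>, and
  \<open>\<partial>K/\<partial>y\<close> is invertible there by local convexity and constraint compatibility, so \<open>\<Phi>\<close> is the
  function given by the implicit function theorem. Two observations then eliminate \<open>\<Phi>\<close> from \<open>A\<close>.

  First, \<open>P\<close> is \<open>\<partial>K/\<partial>y\<close> with the multiplier rows scaled by \<open>-\<beta>\<close> (\<open>P_mat_residual\<close>).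
  Differentiating \<open>K(p, \<Phi>(p)) = 0\<close> shows that \<open>P (\<Phi>'e - d e)\<close> is, up to this row scaling, minus
  the derivative of \<open>p \<mapsto> K(p, d(p))\<close>, and the latter map is \<open>(\<nabla>\<^sub>x L, g, diag(\<mu>) h)\<close>, formed with
  the central Lagrangian (\<open>residual_dvec\<close>). Thus \<open>A\<close> is the Jacobian of a primal-dual gradient flow
  for the central problem.

  Secondly, the local steps keep the decoupled constraints of nonzero weight in \<open>S\<close> satisfied, so to
  first order \<open>S s = - S e\<^sub>x\<close> (\<open>S_mat_solution_derivative\<close>). The last term of \<open>F\<close> therefore adds
  \<open>\<gamma> S\<close> to the Hessian of the central Lagrangian. Since \<open>S\<close> vanishes exactly on the tangent space
  of the active decoupled constraints, the sum is positive definite for large \<open>\<gamma>\<close> by the partial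
  second order condition and Finsler's lemma (\<open>penalized_hessian_pos_def\<close>).

  It remains to find a quadratic form dissipated by
  \<open>x' = - H x - \<Sum>\<^sub>k \<nu>\<^sub>k c\<^sub>k\<close>, \<open>\<nu>\<^sub>k' = \<sigma>\<^sub>k c\<^sub>k \<bullet> x\<close> for active and \<open>\<nu>\<^sub>k' = - \<tau>\<^sub>k \<nu>\<^sub>k\<close> for inactive
  constraints, where \<open>H\<close> is positive definite and the active gradients \<open>c\<^sub>k\<close> are independent
  by LICQ. Scaling the coordinates makes the coupling of \<open>x\<close> with the active multipliers
  skew-symmetric, so it drops out and everything but the active multipliers is damped; adding a
  small multiple of \<open>\<Sum>\<^sub>k \<nu>\<^sub>k c\<^sub>k \<bullet> x\<close> damps these as well (\<open>saddle_point_lyapunov_form\<close>).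
\<close>


section \<open>Quadratic forms\<close>

definition homogeneous2 :: "('a::real_vector \<Rightarrow> real) \<Rightarrow> bool" where
  "homogeneous2 f \<longleftrightarrow> (\<forall>c x. f (c *\<^sub>R x) = c\<^sup>2 * f x)"

lemma homogeneous2_positive_from_sphere:
  fixes f :: "'a::real_normed_vector \<Rightarrow> real"
  assumes "homogeneous2 f" and "subspace S"
    and "\<And>x. x \<in> S \<inter> sphere 0 1 \<Longrightarrow> f x > c"
    and "x \<in> S" "x \<noteq> 0"
  shows "f x > c * (norm x)\<^sup>2"
proof -
  have "inverse (norm x) *\<^sub>R x \<in> S \<inter> sphere 0 1"
    using assms(2,4,5) by (simp add: subspace_scale)
  then have "f (inverse (norm x) *\<^sub>R x) > c" by (rule assms(3))
  moreover have "f (inverse (norm x) *\<^sub>R x) = (inverse (norm x))\<^sup>2 * f x"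
    using assms(1) unfolding homogeneous2_def by blast
  ultimately have "(norm x)\<^sup>2 * c < (norm x)\<^sup>2 * ((inverse (norm x))\<^sup>2 * f x)"
    using assms(5) by (metis mult_less_cancel_left_pos zero_less_norm_iff zero_less_power)
  then show ?thesis using assms(5) by (simp add: power_inverse ac_simps)
qed

text \<open>
  Finsler's lemma, with a nonnegative function instead of the square of a linear map. On the compact
  set of unit vectors with \<open>g \<le> 0\<close> the function \<open>f\<close> has a positive minimum, so a large
  multiple of it outweighs the bounded negative values of \<open>g\<close>.
\<close>

lemma finsler:
  fixes f g :: "'a::euclidean_space \<Rightarrow> real"
  assumes S: "subspace S"
    and cont: "continuous_on UNIV f" "continuous_on UNIV g"
    and hom: "homogeneous2 f" "homogeneous2 g"
    and f: "\<And>x. x \<in> S \<Longrightarrow> f x \<ge> 0"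
    and g: "\<And>x. x \<in> S \<Longrightarrow> x \<noteq> 0 \<Longrightarrow> f x = 0 \<Longrightarrow> g x > 0"
  obtains t0 where "t0 \<ge> 0"
    "\<And>t x. t > t0 \<Longrightarrow> x \<in> S \<Longrightarrow> x \<noteq> 0 \<Longrightarrow> t * f x + g x > 0"
proof -
  define K where "K = S \<inter> sphere 0 1"
  define Z where "Z = K \<inter> g -` {..0}"
  have K: "compact K" unfolding K_def
    by (metis closed_subspace S Int_commute compact_Int_closed compact_sphere)
  have cK: "continuous_on K f" "continuous_on K g"
    using cont by (auto intro: continuous_on_subset)
  have Z: "compact Z" unfolding Z_def
    using K cont(2) by (intro compact_Int_closed closed_vimage) auto
  have "\<exists>t0\<ge>0. \<forall>t>t0. \<forall>x\<in>K. t * f x + g x > 0"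
  proof (cases "Z = {}")
    case True
    then have "g x > 0" "f x \<ge> 0" if "x \<in> K" for x
      using that f by (auto simp: Z_def K_def not_le)
    then show ?thesis
      by (intro exI[of _ 0]) (auto intro: add_nonneg_pos)
  next
    case False
    obtain z where z: "z \<in> Z" "\<And>x. x \<in> Z \<Longrightarrow> f z \<le> f x"
      using continuous_attains_inf[OF Z False continuous_on_subset[OF cK(1)]]
      by (auto simp: Z_def)
    obtain w where w: "w \<in> Z" "\<And>x. x \<in> Z \<Longrightarrow> g w \<le> g x"
      using continuous_attains_inf[OF Z False continuous_on_subset[OF cK(2)]]
      by (auto simp: Z_def)
    have "z \<noteq> 0" "z \<in> S" "g z \<le> 0" using z(1) by (auto simp: Z_def K_def)
    then have fz: "f z > 0" using f[of z] g[of z] by force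
    have gw: "g w \<le> 0" using w(1) by (simp add: Z_def)
    show ?thesis
    proof (intro exI[of _ "- g w / f z"] conjI allI impI ballI)
      show "0 \<le> - g w / f z" using fz gw by (simp add: divide_nonpos_pos)
      fix t x assume t: "- g w / f z < t" and x: "x \<in> K"
      have t0: "t > 0" using \<open>0 \<le> - g w / f z\<close> t by linarith
      show "0 < t * f x + g x"
      proof (cases "g x > 0")
        case True
        then show ?thesis using f[of x] x t0 by (auto simp: K_def intro!: add_nonneg_pos)
      next
        case False
        then have xZ: "x \<in> Z" using x by (auto simp: Z_def)
        have "- g w < t * f z" using t fz by (simp add: field_simps)
        also have "\<dots> \<le> t * f x" using z(2)[OF xZ] t0 by simp
        finally show ?thesis using w(2)[OF xZ] by linarith
      qed
    qed
  qed
  then obtain t0 where t0: "t0 \<ge> 0" "\<And>t x. t > t0 \<Longrightarrow> x \<in> K \<Longrightarrow> t * f x + g x > 0"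
    by blast
  have "t * f x + g x > 0" if "t > t0" "x \<in> S" "x \<noteq> 0" for t x
  proof -
    have "homogeneous2 (\<lambda>x. t * f x + g x)"
      using hom by (simp add: homogeneous2_def algebra_simps)
    from homogeneous2_positive_from_sphere[OF this S _ that(2,3), of 0] t0(2)[OF that(1)]
    show ?thesis by (auto simp: K_def)
  qed
  with t0(1) show ?thesis by (rule that)
qed

lemma homogeneous2_coercive:
  fixes f :: "'a::euclidean_space \<Rightarrow> real"
  assumes "continuous_on UNIV f" "homogeneous2 f" "\<And>x. x \<noteq> 0 \<Longrightarrow> f x > 0"
  obtains c where "c > 0" "\<And>x. f x \<ge> c * (norm x)\<^sup>2"
proof -
  obtain t0 where t0: "t0 \<ge> 0"
    "\<And>t x. t > t0 \<Longrightarrow> x \<in> UNIV \<Longrightarrow> x \<noteq> 0 \<Longrightarrow> t * f x + (- ((norm x)\<^sup>2)) > 0"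
  proof (rule finsler[where f=f and g="\<lambda>x. - ((norm x)\<^sup>2)" and S=UNIV])
    show "0 \<le> f x" for x
      using assms(3)[of x] assms(2)[unfolded homogeneous2_def, rule_format, of 0 x]
      by (cases "x = 0") auto
    show "homogeneous2 (\<lambda>x::'a. - ((norm x)\<^sup>2))"
      by (simp add: homogeneous2_def power_mult_distrib)
    show "0 < - ((norm x)\<^sup>2)" if "x \<noteq> 0" "f x = 0" for x
      using assms(3)[of x] that by simp
    show "continuous_on UNIV (\<lambda>x::'a. - ((norm x)\<^sup>2))"
      by (intro continuous_intros)
  qed (use assms in auto)
  show ?thesis
  proof (rule that[of "1 / (t0 + 1)"])
    show "f x \<ge> 1 / (t0 + 1) * (norm x)\<^sup>2" for x
    proof (cases "x = 0")
      case True
      then show ?thesis using assms(2)[unfolded homogeneous2_def, rule_format, of 0 x] by simp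
    next
      case False
      then show ?thesis using t0(2)[of "t0 + 1" x] t0(1) by (simp add: field_simps)
    qed
  qed (use t0 in simp)
qed

lemma bilinear_form_bounded:
  fixes B :: "'a::euclidean_space \<Rightarrow> 'a"
  assumes "linear B"
  obtains K where "K > 0" "\<And>x y. \<bar>x \<bullet> B y\<bar> \<le> K * norm x * norm y"
proof -
  obtain K where K: "K > 0" "\<And>y. norm (B y) \<le> norm y * K"
    using bounded_linear.pos_bounded[OF linear_conv_bounded_linear[THEN iffD1, OF assms]] by auto
  have "\<bar>x \<bullet> B y\<bar> \<le> K * norm x * norm y" for x y
    using Cauchy_Schwarz_ineq2[of x "B y"] mult_left_mono[OF K(2)[of y], of "norm x"]
    by (simp add: ac_simps)
  with K(1) show ?thesis by (rule that)
qed

section \<open>Damped steps along a vector field\<close>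

text \<open>
  A quadratic form is represented by its self-adjoint operator, i.e. \<open>B\<close> stands for
  \<open>x \<mapsto> x \<bullet> B x\<close>.
\<close>

definition symmetric_form :: "('a::real_inner \<Rightarrow> 'a) \<Rightarrow> bool" where
  "symmetric_form B \<longleftrightarrow> linear B \<and> (\<forall>x y. x \<bullet> B y = y \<bullet> B x)"

lemma symmetric_form_add:
  assumes "symmetric_form B"
  shows "(x + y) \<bullet> B (x + y) = x \<bullet> B x + 2 * (x \<bullet> B y) + y \<bullet> B y"
proof -
  have "linear B" "y \<bullet> B x = x \<bullet> B y" using assms by (auto simp: symmetric_form_def)
  then show ?thesis by (simp add: linear_add inner_add_left inner_add_right)
qed

lemma homogeneous2_form:
  assumes "linear B" "linear C" shows "homogeneous2 (\<lambda>x. C x \<bullet> B x)"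
  using assms by (simp add: homogeneous2_def linear_scale power2_eq_square)

lemma form_coercive:
  fixes B :: "'a::euclidean_space \<Rightarrow> 'a"
  assumes "linear B" "linear C" "\<And>x. x \<noteq> 0 \<Longrightarrow> C x \<bullet> B x > 0"
  obtains c where "c > 0" "\<And>x. C x \<bullet> B x \<ge> c * (norm x)\<^sup>2"
proof (rule homogeneous2_coercive[of "\<lambda>x. C x \<bullet> B x"])
  show "continuous_on UNIV (\<lambda>x. C x \<bullet> B x)"
    using assms(1,2) by (intro continuous_intros linear_continuous_on)
      (simp_all add: linear_conv_bounded_linear)
qed (use assms homogeneous2_form[OF assms(1,2)] in auto)

text \<open>
  Neither the radius nor \<open>c\<close> depends on \<open>\<alpha>\<close>: with \<open>d\<close> the coercivity constant of
  \<open>x \<mapsto> - A x \<bullet> B x\<close>, the linearization error costs at most half of the decrease \<open>2 \<alpha> d \<parallel>e\<parallel>\<^sup>2\<close> in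
  the ball of radius \<open>r\<close>, and the quadratic term at most a further quarter when \<open>\<alpha> < \<alpha>bar\<close>.
\<close>

lemma damped_step_contraction:
  fixes B A F :: "'a::euclidean_space \<Rightarrow> 'a"
  assumes B: "symmetric_form B" "\<And>x. x \<noteq> 0 \<Longrightarrow> x \<bullet> B x > 0"
    and F: "(F has_derivative A) (at a)" "F a = 0"
    and decay: "\<And>x. x \<noteq> 0 \<Longrightarrow> A x \<bullet> B x < 0"
  obtains r \<alpha>bar c where "r > 0" "\<alpha>bar > 0" "c > 0" "\<alpha>bar * c < 1"
    "\<And>\<alpha> e. 0 < \<alpha> \<Longrightarrow> \<alpha> < \<alpha>bar \<Longrightarrow> norm e < r \<Longrightarrow>
       (e + \<alpha> *\<^sub>R F (a + e)) \<bullet> B (e + \<alpha> *\<^sub>R F (a + e)) \<le> (1 - \<alpha> * c) * (e \<bullet> B e)"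
proof -
  have linB: "linear B" using B(1) by (simp add: symmetric_form_def)
  have linA: "linear A" using F(1) by (simp add: has_derivative_linear)
  obtain K where K: "K > 0" "\<And>x y. \<bar>x \<bullet> B y\<bar> \<le> K * norm x * norm y"
    by (rule bilinear_form_bounded[OF linB]) auto
  obtain d where d: "d > 0" "\<And>x. (- A x) \<bullet> B x \<ge> d * (norm x)\<^sup>2"
    by (rule form_coercive[OF linB, of "\<lambda>x. - A x"]) (use linA decay in \<open>auto simp: linear_compose_neg\<close>)
  obtain LA where LA: "LA > 0" "\<And>y. norm (A y) \<le> norm y * LA"
    using bounded_linear.pos_bounded[OF linear_conv_bounded_linear[THEN iffD1, OF linA]] by auto
  \<comment> \<open>With this tolerance the cross term \<open>R \<bullet> B e\<close> below is at most \<open>(d / 2) \<parallel>e\<parallel>\<^sup>2\<close>.\<close>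
  define eps where "eps = d / (2 * K)"
  have eps: "eps > 0" using d(1) K(1) by (simp add: eps_def)
  obtain r where r: "r > 0" "\<And>y. norm (y - a) < r \<Longrightarrow> norm (F y - F a - A (y - a)) \<le> eps * norm (y - a)"
    using F(1) eps unfolding has_derivative_at_alt by meson
  define L where "L = LA + eps"
  have L: "L > 0" using LA(1) eps by (simp add: L_def)
  define c where "c = d / (2 * K)"
  have c: "c > 0" using d(1) K(1) by (simp add: c_def)
  define \<alpha>bar where "\<alpha>bar = min (d / (2 * K * L\<^sup>2)) (1 / (2 * c))"
  show ?thesis
  proof (rule that[of r \<alpha>bar c])
    show "\<alpha>bar > 0" using d(1) K(1) L c by (simp add: \<alpha>bar_def)
    have "\<alpha>bar * c \<le> 1 / (2 * c) * c" using c by (intro mult_right_mono) (auto simp: \<alpha>bar_def)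
    then show "\<alpha>bar * c < 1" using c by simp
    fix \<alpha> :: real and e :: 'a assume \<alpha>: "0 < \<alpha>" "\<alpha> < \<alpha>bar" and e: "norm e < r"
    define R where "R = F (a + e) - A e"
    have R: "norm R \<le> eps * norm e" using r(2)[of "a + e"] e F(2) by (simp add: R_def)
    have FR: "F (a + e) = A e + R" by (simp add: R_def)
    have nF: "norm (F (a + e)) \<le> L * norm e"
      using norm_triangle_ineq[of "A e" R] R LA(2)[of e] by (simp add: FR L_def algebra_simps)
    have "F (a + e) \<bullet> B e = A e \<bullet> B e + R \<bullet> B e" by (simp add: FR inner_add_left)
    also have "\<dots> \<le> - d * (norm e)\<^sup>2 + K * (eps * norm e) * norm e"
    proof (rule add_mono)
      show "A e \<bullet> B e \<le> - d * (norm e)\<^sup>2" using d(2)[of e] by simp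
      have "R \<bullet> B e \<le> K * norm R * norm e" using K(2)[of R e] by simp
      also have "\<dots> \<le> K * (eps * norm e) * norm e"
        using R K(1) by (intro mult_right_mono mult_left_mono) auto
      finally show "R \<bullet> B e \<le> K * (eps * norm e) * norm e" .
    qed
    also have "\<dots> = - (d / 2) * (norm e)\<^sup>2" using K(1) by (simp add: eps_def power2_eq_square)
    finally have 1: "F (a + e) \<bullet> B e \<le> - (d / 2) * (norm e)\<^sup>2" .
    have "F (a + e) \<bullet> B (F (a + e)) \<le> K * norm (F (a + e)) * norm (F (a + e))"
      using K(2)[of "F (a + e)" "F (a + e)"] by simp
    also have "\<dots> \<le> K * (L * norm e) * (L * norm e)"
      using nF K(1) L by (intro mult_mono) auto
    finally have 2: "F (a + e) \<bullet> B (F (a + e)) \<le> K * L\<^sup>2 * (norm e)\<^sup>2"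
      by (simp add: power2_eq_square ac_simps)
    have 3: "e \<bullet> B e \<le> K * (norm e)\<^sup>2" using K(2)[of e e] by (simp add: power2_eq_square ac_simps)
    have sym: "e \<bullet> B (F (a + e)) = F (a + e) \<bullet> B e" using B(1) by (simp add: symmetric_form_def)
    have "(e + \<alpha> *\<^sub>R F (a + e)) \<bullet> B (e + \<alpha> *\<^sub>R F (a + e))
        = e \<bullet> B e + 2 * \<alpha> * (F (a + e) \<bullet> B e) + \<alpha>\<^sup>2 * (F (a + e) \<bullet> B (F (a + e)))"
      by (subst symmetric_form_add[OF B(1)])
        (simp add: linear_scale[OF linB] sym power2_eq_square)
    also have "\<dots> \<le> e \<bullet> B e + 2 * \<alpha> * (- (d / 2) * (norm e)\<^sup>2) + \<alpha>\<^sup>2 * (K * L\<^sup>2 * (norm e)\<^sup>2)"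
      using 1 2 \<alpha> by (intro add_mono mult_left_mono) auto
    also have "\<dots> = e \<bullet> B e - \<alpha> * (norm e)\<^sup>2 * (d - \<alpha> * (K * L\<^sup>2))"
      by (simp add: algebra_simps power2_eq_square)
    also have "\<dots> \<le> e \<bullet> B e - \<alpha> * (norm e)\<^sup>2 * (d / 2)"
    proof -
      have "\<alpha> \<le> d / (2 * K * L\<^sup>2)" using \<alpha>(2) by (simp add: \<alpha>bar_def)
      then have "\<alpha> * (K * L\<^sup>2) \<le> d / 2" using K(1) L by (simp add: field_simps)
      then have "\<alpha> * (norm e)\<^sup>2 * (d / 2) \<le> \<alpha> * (norm e)\<^sup>2 * (d - \<alpha> * (K * L\<^sup>2))"
        using \<alpha>(1) by (intro mult_left_mono) auto
      then show ?thesis by simp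
    qed
    also have "\<dots> \<le> e \<bullet> B e - \<alpha> * c * (e \<bullet> B e)"
    proof -
      have "c * (e \<bullet> B e) \<le> c * (K * (norm e)\<^sup>2)" using 3 c by simp
      also have "\<dots> = (norm e)\<^sup>2 * (d / 2)" using K(1) by (simp add: c_def)
      finally have "\<alpha> * (c * (e \<bullet> B e)) \<le> \<alpha> * ((norm e)\<^sup>2 * (d / 2))" using \<alpha>(1) by simp
      then show ?thesis by (simp add: ac_simps)
    qed
    finally show "(e + \<alpha> *\<^sub>R F (a + e)) \<bullet> B (e + \<alpha> *\<^sub>R F (a + e)) \<le> (1 - \<alpha> * c) * (e \<bullet> B e)"
      by (simp add: algebra_simps)
  qed (use r c in auto)
qed

text \<open>
  Sublevel sets of the form are invariant, but balls need not be. The form distorts the norm by a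
  factor of at most \<open>C0\<close>, so iterates that start in a ball smaller by this factor stay where
  the contraction estimate is valid.
\<close>

lemma damped_iteration_converges:
  fixes B A F :: "'a::euclidean_space \<Rightarrow> 'a"
  assumes B: "symmetric_form B" "\<And>x. x \<noteq> 0 \<Longrightarrow> x \<bullet> B x > 0"
    and F: "(F has_derivative A) (at a)" "F a = 0"
    and decay: "\<And>x. x \<noteq> 0 \<Longrightarrow> A x \<bullet> B x < 0"
  obtains \<alpha>bar r where "\<alpha>bar > 0" "r > 0"
    "\<And>\<alpha>. 0 < \<alpha> \<Longrightarrow> \<alpha> < \<alpha>bar \<Longrightarrow> \<exists>C0>0. \<exists>C1. 0 < C1 \<and> C1 < 1 \<and>
       (\<forall>p\<in>ball a r. \<forall>q. norm (((\<lambda>p. p + \<alpha> *\<^sub>R F p) ^^ q) p - a) \<le> C0 * C1 ^ q * norm (p - a))"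
proof -
  have linB: "linear B" using B(1) by (simp add: symmetric_form_def)
  obtain r \<alpha>bar c where rc: "r > 0" "\<alpha>bar > 0" "c > 0" "\<alpha>bar * c < 1"
    and step: "\<And>\<alpha> e. 0 < \<alpha> \<Longrightarrow> \<alpha> < \<alpha>bar \<Longrightarrow> norm e < r \<Longrightarrow>
       (e + \<alpha> *\<^sub>R F (a + e)) \<bullet> B (e + \<alpha> *\<^sub>R F (a + e)) \<le> (1 - \<alpha> * c) * (e \<bullet> B e)"
    by (rule damped_step_contraction[OF B F decay]) auto
  obtain K where K: "K > 0" "\<And>x y. \<bar>x \<bullet> B y\<bar> \<le> K * norm x * norm y"
    by (rule bilinear_form_bounded[OF linB]) auto
  obtain m where m: "m > 0" "\<And>x. x \<bullet> B x \<ge> m * (norm x)\<^sup>2"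
    by (rule form_coercive[OF linB, of "\<lambda>x. x"]) (use B(2) in \<open>auto simp: linear_id[unfolded id_def]\<close>)
  define C0 where "C0 = sqrt (K / m)"
  have C0: "C0 > 0" using K(1) m(1) by (simp add: C0_def)
  define r' where "r' = r / C0"
  have r': "r' > 0" using rc(1) C0 by (simp add: r'_def)
  have "\<exists>C0>0. \<exists>C1. 0 < C1 \<and> C1 < 1 \<and>
       (\<forall>p\<in>ball a r'. \<forall>q. norm (((\<lambda>p. p + \<alpha> *\<^sub>R F p) ^^ q) p - a) \<le> C0 * C1 ^ q * norm (p - a))"
    if \<alpha>: "0 < \<alpha>" "\<alpha> < \<alpha>bar" for \<alpha>
  proof -
    define T where "T = (\<lambda>p. p + \<alpha> *\<^sub>R F p)"
    have "\<alpha> * c < 1" using \<alpha> rc by (metis mult_strict_right_mono order_less_trans)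
    define C1 where "C1 = sqrt (1 - \<alpha> * c)"
    have C1: "0 < C1" "C1 < 1" "C1\<^sup>2 = 1 - \<alpha> * c"
      using \<open>\<alpha> * c < 1\<close> \<alpha>(1) rc(3) by (auto simp: C1_def real_sqrt_lt_1_iff)
    have bound: "norm (x - a) \<le> C0 * C1 ^ q * norm (p - a)"
      if "(x - a) \<bullet> B (x - a) \<le> (1 - \<alpha> * c) ^ q * ((p - a) \<bullet> B (p - a))" for x p q
    proof -
      have "m * (norm (x - a))\<^sup>2 \<le> (x - a) \<bullet> B (x - a)" by (rule m(2))
      also have "\<dots> \<le> (C1\<^sup>2) ^ q * ((p - a) \<bullet> B (p - a))" using that C1(3) by simp
      also have "\<dots> \<le> (C1\<^sup>2) ^ q * (K * (norm (p - a))\<^sup>2)"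
        using K(2)[of "p - a" "p - a"] by (intro mult_left_mono) (simp_all add: power2_eq_square mult.assoc)
      finally have "m * (norm (x - a))\<^sup>2 \<le> (C1\<^sup>2) ^ q * (K * (norm (p - a))\<^sup>2)" .
      then have "(norm (x - a))\<^sup>2 \<le> (K / m) * (C1\<^sup>2) ^ q * (norm (p - a))\<^sup>2"
        using m(1) by (simp add: pos_le_divide_eq mult.commute mult.left_commute)
      also have "\<dots> = (C0 * C1 ^ q * norm (p - a))\<^sup>2"
      proof -
        have "C0\<^sup>2 = K / m" using K(1) m(1) by (simp add: C0_def)
        moreover have "(C1 ^ q)\<^sup>2 = (C1\<^sup>2) ^ q" by (simp add: power_mult[symmetric] mult.commute)
        ultimately show ?thesis by (simp add: power_mult_distrib)
      qed
      finally show ?thesis by (rule power2_le_imp_le) (use C0 C1 in simp)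
    qed
    have "(((T ^^ q) p - a) \<bullet> B ((T ^^ q) p - a) \<le> (1 - \<alpha> * c) ^ q * ((p - a) \<bullet> B (p - a)))"
      if p: "p \<in> ball a r'" for p q
    proof (induction q)
      case 0
      then show ?case by simp
    next
      case (Suc q)
      let ?e = "(T ^^ q) p - a"
      have "norm ?e \<le> C0 * C1 ^ q * norm (p - a)" using bound[OF Suc] .
      also have "\<dots> \<le> C0 * 1 * norm (p - a)"
        using C0 C1 by (intro mult_right_mono mult_left_mono) (auto simp: power_le_one)
      also have "\<dots> < r" using p C0 by (simp add: r'_def field_simps dist_norm norm_minus_commute)
      finally have e: "norm ?e < r" .
      have next_e: "(T ^^ Suc q) p - a = ?e + \<alpha> *\<^sub>R F (a + ?e)" by (simp add: T_def)
      have "((T ^^ Suc q) p - a) \<bullet> B ((T ^^ Suc q) p - a) \<le> (1 - \<alpha> * c) * (?e \<bullet> B ?e)"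
        unfolding next_e by (rule step[OF \<alpha> e])
      also have "\<dots> \<le> (1 - \<alpha> * c) * ((1 - \<alpha> * c) ^ q * ((p - a) \<bullet> B (p - a)))"
        using Suc \<open>\<alpha> * c < 1\<close> by (intro mult_left_mono) auto
      finally show ?case by (simp add: mult.assoc)
    qed
    then show ?thesis using C0 C1 bound unfolding T_def by blast
  qed
  with rc(2) r' show ?thesis by (rule that)
qed



section \<open>The discrete Lyapunov equation\<close>

lemma congruence_form:
  fixes M X :: "real^'k^'k::finite"
  shows "x \<bullet> ((transpose M ** X ** M) *v y) = (M *v x) \<bullet> (X *v (M *v y))"
proof -
  have "x \<bullet> ((transpose M ** X ** M) *v y) = x \<bullet> (transpose M *v (X *v (M *v y)))"
    by (simp add: matrix_vector_mul_assoc matrix_mul_assoc)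
  also have "\<dots> = (M *v x) \<bullet> (X *v (M *v y))"
    by (metis dot_lmul_matrix transpose_matrix_vector transpose_transpose)
  finally show ?thesis .
qed

lemma form_limit_along_stable_iterates:
  fixes M X :: "real^'k^'k::finite"
  assumes "\<And>v. (\<lambda>n. (((*v) M) ^^ n) v) \<longlonglongrightarrow> 0"
  shows "(\<lambda>n. (((*v) M) ^^ n) x \<bullet> (X *v ((((*v) M) ^^ n) y))) \<longlonglongrightarrow> 0"
proof -
  have "(\<lambda>n. X *v ((((*v) M) ^^ n) y)) \<longlonglongrightarrow> X *v 0"
    by (rule bounded_linear.tendsto[OF matrix_vector_mul_bounded_linear assms])
  from tendsto_inner[OF assms[of x] this] show ?thesis by simp
qed

text \<open>
  A solution \<open>X\<close> of the homogeneous equation satisfies \<open>x \<bullet> X y = M\<^sup>n x \<bullet> X M\<^sup>n y\<close> for all \<open>n\<close>, and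
  the right-hand side tends to \<open>0\<close>. So the equation has exactly one solution for each right-hand side,
  by counting dimensions instead of summing the series \<open>\<Sum>\<^sub>n (M\<^sup>n)\<^sup>T Q M\<^sup>n\<close>.
\<close>

lemma discrete_lyapunov:
  fixes M Q :: "real^'k^'k::finite"
  assumes stable: "\<And>v. (\<lambda>n. (((*v) M) ^^ n) v) \<longlonglongrightarrow> 0"
    and Q: "sym_pos_def Q"
  obtains P where "sym_pos_def P" "transpose M ** P ** M - P = - Q"
proof -
  define L where "L = (\<lambda>X. transpose M ** X ** M - X)"
  have addL: "transpose M ** (X + Y) ** M = transpose M ** X ** M + transpose M ** Y ** M" for X Y
    by (simp add: matrix_add_ldistrib matrix_matrix_mult_def vec_eq_iff algebra_simps sum.distrib)
  have scaleL: "transpose M ** (c *\<^sub>R X) ** M = c *\<^sub>R (transpose M ** X ** M)" for c X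
    by (simp add: matrix_scalar_ac scalar_matrix_assoc)
  have lin: "linear L"
    by (rule linearI) (simp_all add: L_def addL scaleL algebra_simps)
  have L0: "X = 0" if "L X = 0" for X
  proof -
    have inv: "(M *v x) \<bullet> (X *v (M *v y)) = x \<bullet> (X *v y)" for x y
      using that congruence_form[of x M X y] by (simp add: L_def)
    have it: "(((*v) M) ^^ n) x \<bullet> (X *v ((((*v) M) ^^ n) y)) = x \<bullet> (X *v y)" for n x y
      by (induction n) (simp_all add: inv)
    have "x \<bullet> (X *v y) = 0" for x y
      using form_limit_along_stable_iterates[OF stable, of x X y] unfolding it
      by (simp add: LIMSEQ_const_iff)
    then have "X *v y = 0" for y by (metis inner_eq_zero_iff)
    then show ?thesis by (simp add: matrix_eq)
  qed
  have injL: "inj L" using linear_injective_0[OF lin] L0 by blast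
  obtain P where P: "L P = - Q"
    using linear_injective_imp_surjective[OF lin injL] by (metis surjD)
  have trQ: "transpose Q = Q" using Q by (simp add: sym_pos_def_def)
  have "L (transpose P) = transpose (transpose M ** P ** M) - transpose P"
    by (simp add: L_def matrix_transpose_mul matrix_mul_assoc)
  also have "\<dots> = transpose (L P)" by (simp add: L_def transpose_def vec_eq_iff)
  also have "\<dots> = - Q" using P trQ by (simp add: transpose_def vec_eq_iff)
  \<comment> \<open>The transpose solves the same equation.\<close>
  finally have trP: "transpose P = P" using P injL by (metis injD)
  have step: "x \<bullet> (P *v x) = (M *v x) \<bullet> (P *v (M *v x)) + x \<bullet> (Q *v x)" for x
  proof -
    have "P = transpose M ** P ** M + Q" using P by (simp add: L_def algebra_simps)
    then have "x \<bullet> (P *v x) = x \<bullet> ((transpose M ** P ** M + Q) *v x)" by simp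
    then show ?thesis by (simp add: matrix_vector_mult_add_rdistrib inner_add_right congruence_form)
  qed
  have Qnn: "x \<bullet> (Q *v x) \<ge> 0" for x
    using Q by (cases "x = 0") (auto simp: sym_pos_def_def pos_def_block_def supported_on_def less_imp_le)
  have mono: "x \<bullet> (P *v x) \<ge> (((*v) M) ^^ n) x \<bullet> (P *v ((((*v) M) ^^ n) x))" for n x
  proof (induction n)
    case (Suc n)
    then show ?case using step[of "(((*v) M) ^^ n) x"] Qnn[of "(((*v) M) ^^ n) x"] by simp
  qed simp
  have nn: "x \<bullet> (P *v x) \<ge> 0" for x
    by (rule LIMSEQ_le_const2[OF form_limit_along_stable_iterates[OF stable, of x P x]])
      (use mono in auto)
  have "x \<bullet> (P *v x) > 0" if "x \<noteq> 0" for x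
    using step[of x] nn[of "M *v x"] that Q
    by (simp add: sym_pos_def_def pos_def_block_def supported_on_def add_nonneg_pos)
  then have "sym_pos_def P" using trP by (simp add: sym_pos_def_def pos_def_block_def)
  then show ?thesis using P by (intro that) (simp_all add: L_def)
qed

lemma sym_pos_def_symmetric_form:
  assumes "sym_pos_def P" shows "symmetric_form ((*v) P)"
  using assms unfolding symmetric_form_def sym_pos_def_def
  by (metis dot_lmul_matrix inner_commute matrix_vector_mul_linear transpose_matrix_vector)

lemma sym_pos_def_pos: "sym_pos_def P \<Longrightarrow> x \<noteq> 0 \<Longrightarrow> x \<bullet> (P *v x) > 0"
  by (simp add: sym_pos_def_def pos_def_block_def supported_on_def)

lemma sym_pos_def_nonneg: "sym_pos_def P \<Longrightarrow> x \<bullet> (P *v x) \<ge> 0"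
  using sym_pos_def_pos[of P x] by (cases "x = 0") auto

lemma weighted_norm_pos: "sym_pos_def P \<Longrightarrow> x \<noteq> 0 \<Longrightarrow> weighted_norm P x > 0"
  by (simp add: weighted_norm_def sym_pos_def_pos)

lemma weighted_norm_zero [simp]: "weighted_norm P 0 = 0"
  by (simp add: weighted_norm_def)

lemma weighted_norm_sq: "sym_pos_def P \<Longrightarrow> (weighted_norm P x)\<^sup>2 = x \<bullet> (P *v x)"
  by (simp add: weighted_norm_def sym_pos_def_nonneg)

lemma weighted_norm_nonneg: "sym_pos_def P \<Longrightarrow> weighted_norm P x \<ge> 0"
  by (simp add: weighted_norm_def sym_pos_def_nonneg)

text \<open>
  The equation says that \<open>M\<close> decreases the square of the weighted norm by \<open>v \<bullet> Q v\<close>, which is at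
  least a fixed fraction \<open>c\<close> of it.
\<close>

lemma lyapunov_contraction:
  fixes M P Q :: "real^'k^'k::finite"
  assumes P: "sym_pos_def P" and Q: "sym_pos_def Q"
    and eq: "transpose M ** P ** M - P = - Q"
  obtains C where "0 \<le> C" "C < 1" "\<And>v. weighted_norm P (M *v v) \<le> C * weighted_norm P v"
proof -
  obtain q where q: "q > 0" "\<And>x. x \<bullet> (Q *v x) \<ge> q * (norm x)\<^sup>2"
    by (rule form_coercive[of "(*v) Q" "\<lambda>x. x"])
      (use Q in \<open>auto simp: sym_pos_def_pos linear_id[unfolded id_def] matrix_vector_mul_linear\<close>)
  obtain K where K: "K > 0" "\<And>x y. \<bar>x \<bullet> (P *v y)\<bar> \<le> K * norm x * norm y"
    by (rule bilinear_form_bounded[OF matrix_vector_mul_linear[of P]]) auto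
  define c where "c = q / (q + K)"
  have c: "0 < c" "c < 1" using q(1) K(1) by (auto simp: c_def)
  have cK: "c * K \<le> q" using q(1) K(1) by (simp add: c_def field_simps)
  have step: "(M *v x) \<bullet> (P *v (M *v x)) = x \<bullet> (P *v x) - x \<bullet> (Q *v x)" for x
  proof -
    have "transpose M ** P ** M = P - Q" using eq by (simp add: algebra_simps)
    then show ?thesis
      by (simp flip: congruence_form add: matrix_vector_mult_diff_rdistrib inner_diff_right)
  qed
  have "weighted_norm P (M *v v) \<le> sqrt (1 - c) * weighted_norm P v" for v
  proof -
    have "c * (v \<bullet> (P *v v)) \<le> c * (K * (norm v)\<^sup>2)"
      using K(2)[of v v] c by (simp add: power2_eq_square mult.assoc)
    also have "\<dots> \<le> q * (norm v)\<^sup>2" using cK by (simp add: mult_right_mono flip: mult.assoc)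
    also have "\<dots> \<le> v \<bullet> (Q *v v)" by (rule q(2))
    finally have "(M *v v) \<bullet> (P *v (M *v v)) \<le> (1 - c) * (v \<bullet> (P *v v))"
      by (simp add: step algebra_simps)
    then show ?thesis unfolding weighted_norm_def by (simp flip: real_sqrt_mult)
  qed
  then show ?thesis using c by (intro that[of "sqrt (1 - c)"]) auto
qed

lemma induced_norm_bounds:
  fixes M P Q :: "real^'k^'k::finite"
  assumes P: "sym_pos_def P" and Q: "sym_pos_def Q"
    and eq: "transpose M ** P ** M - P = - Q" and M: "M \<noteq> 0"
  shows "0 < induced_norm P M" "induced_norm P M < 1"
    and "\<And>v. weighted_norm P (M *v v) \<le> induced_norm P M * weighted_norm P v"
proof -
  obtain C where C: "0 \<le> C" "C < 1" "\<And>v. weighted_norm P (M *v v) \<le> C * weighted_norm P v"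
    by (rule lyapunov_contraction[OF P Q eq]) auto
  let ?f = "\<lambda>v. weighted_norm P (M *v v) / weighted_norm P v"
  have le: "?f v \<le> C" for v
    using C weighted_norm_pos[OF P, of v] by (cases "v = 0") (auto simp: pos_divide_le_eq)
  then have bdd: "bdd_above (range ?f)" by (intro bdd_aboveI[of _ C]) auto
  have "induced_norm P M \<le> C" unfolding induced_norm_def by (rule cSUP_least) (use le in auto)
  then show "induced_norm P M < 1" using C by simp
  have up: "?f v \<le> induced_norm P M" for v
    unfolding induced_norm_def by (rule cSUP_upper[OF _ bdd]) simp
  show "weighted_norm P (M *v v) \<le> induced_norm P M * weighted_norm P v" for v
    using up[of v] weighted_norm_pos[OF P, of v] by (cases "v = 0") (auto simp: pos_divide_le_eq)
  obtain v where v: "M *v v \<noteq> 0" using M by (metis matrix_eq matrix_vector_mult_0)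
  then have "v \<noteq> 0" by auto
  then have "0 < ?f v" using weighted_norm_pos[OF P] v by simp
  then show "0 < induced_norm P M" using up[of v] by linarith
qed

text \<open>
  Near the fixed point the remainder of the linearization is at most \<open>eps\<close> times the error, and \<open>eps\<close>
  is chosen so that its contribution to the squared norm fits into the gap between \<open>L\<^sup>2\<close> and \<open>C\<^sup>2\<close>.
\<close>

lemma asymptotic_weighted_contraction:
  fixes T :: "real^'k::finite \<Rightarrow> real^'k"
  assumes P: "sym_pos_def P"
    and T: "(T has_derivative (*v) M) (at a)" "T a = a"
    and L: "0 < L" "\<And>v. weighted_norm P (M *v v) \<le> L * weighted_norm P v"
    and C: "C > L" and x: "x \<longlonglongrightarrow> a"
  shows "\<forall>\<^sub>F q in sequentially. weighted_norm P (T (x q) - a) \<le> C * weighted_norm P (x q - a)"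
proof -
  have sf: "symmetric_form ((*v) P)" by (rule sym_pos_def_symmetric_form[OF P])
  obtain K where K: "K > 0" "\<And>x y. \<bar>x \<bullet> (P *v y)\<bar> \<le> K * norm x * norm y"
    by (rule bilinear_form_bounded[OF matrix_vector_mul_linear[of P]]) auto
  obtain m where m: "m > 0" "\<And>x. x \<bullet> (P *v x) \<ge> m * (norm x)\<^sup>2"
    by (rule form_coercive[of "(*v) P" "\<lambda>x. x"])
      (use P in \<open>auto simp: sym_pos_def_pos linear_id[unfolded id_def] matrix_vector_mul_linear\<close>)
  obtain LM where LM: "LM > 0" "\<And>y. norm (M *v y) \<le> norm y * LM"
    using bounded_linear.pos_bounded[OF matrix_vector_mul_bounded_linear[of M]] by auto
  define D where "D = 2 * K * LM + K"
  have D: "D > 0" using K LM by (simp add: D_def add_pos_pos)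
  have C2: "C\<^sup>2 > L\<^sup>2" using C L(1) by (simp add: power_strict_mono)
  define eps where "eps = min 1 ((C\<^sup>2 - L\<^sup>2) * m / D)"
  have eps: "0 < eps" "eps \<le> 1" using C2 m(1) D by (auto simp: eps_def)
  have epsD: "eps * D \<le> (C\<^sup>2 - L\<^sup>2) * m"
    using D by (simp add: eps_def min_def pos_le_divide_eq[symmetric])
  obtain d where d: "d > 0"
    "\<And>y. norm (y - a) < d \<Longrightarrow> norm (T y - T a - M *v (y - a)) \<le> eps * norm (y - a)"
    using T(1) eps(1) unfolding has_derivative_at_alt by meson
  have "weighted_norm P (T y - a) \<le> C * weighted_norm P (y - a)" if y: "norm (y - a) < d" for y
  proof -
    define e where "e = y - a"
    define R where "R = T y - a - M *v e"
    have R: "norm R \<le> eps * norm e" using d(2)[OF y] T(2) by (simp add: R_def e_def)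
    have Ty: "T y - a = M *v e + R" by (simp add: R_def)
    have "(M *v e) \<bullet> (P *v R) \<le> K * norm (M *v e) * norm R" using K(2)[of "M *v e" R] by simp
    also have "\<dots> \<le> K * (norm e * LM) * (eps * norm e)"
      using K(1) LM R by (intro mult_mono) auto
    finally have 1: "2 * ((M *v e) \<bullet> (P *v R)) \<le> eps * (2 * K * LM) * (norm e)\<^sup>2"
      by (simp add: power2_eq_square ac_simps)
    have "R \<bullet> (P *v R) \<le> K * norm R * norm R" using K(2)[of R R] by simp
    also have "\<dots> \<le> K * (1 * norm e) * (eps * norm e)"
      using K(1) R eps by (intro mult_mono order_trans[OF R] mult_right_mono) auto
    finally have 2: "R \<bullet> (P *v R) \<le> eps * K * (norm e)\<^sup>2"
      by (simp add: power2_eq_square ac_simps)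
    have 3: "(M *v e) \<bullet> (P *v (M *v e)) \<le> L\<^sup>2 * (e \<bullet> (P *v e))"
      using power_mono[OF L(2)[of e] weighted_norm_nonneg[OF P], of 2]
      by (simp add: power_mult_distrib weighted_norm_sq[OF P])
    have "(weighted_norm P (T y - a))\<^sup>2
        = (M *v e) \<bullet> (P *v (M *v e)) + 2 * ((M *v e) \<bullet> (P *v R)) + R \<bullet> (P *v R)"
      unfolding weighted_norm_sq[OF P] Ty by (rule symmetric_form_add[OF sf])
    also have "\<dots> \<le> L\<^sup>2 * (e \<bullet> (P *v e)) + eps * (2 * K * LM) * (norm e)\<^sup>2 + eps * K * (norm e)\<^sup>2"
      using 1 2 3 by linarith
    also have "\<dots> = L\<^sup>2 * (e \<bullet> (P *v e)) + eps * D * (norm e)\<^sup>2"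
      by (simp add: D_def algebra_simps)
    also have "\<dots> \<le> L\<^sup>2 * (e \<bullet> (P *v e)) + (C\<^sup>2 - L\<^sup>2) * (m * (norm e)\<^sup>2)"
      using mult_right_mono[OF epsD, of "(norm e)\<^sup>2"] by (simp add: mult.assoc)
    also have "\<dots> \<le> L\<^sup>2 * (e \<bullet> (P *v e)) + (C\<^sup>2 - L\<^sup>2) * (e \<bullet> (P *v e))"
      using m(2)[of e] C2 by (intro add_left_mono mult_left_mono) auto
    also have "\<dots> = (C * weighted_norm P e)\<^sup>2"
      by (simp add: power_mult_distrib weighted_norm_sq[OF P] algebra_simps)
    finally have "(weighted_norm P (T y - a))\<^sup>2 \<le> (C * weighted_norm P e)\<^sup>2" .
    then show ?thesis unfolding e_def
      by (rule power2_le_imp_le) (use C L weighted_norm_nonneg[OF P] in auto)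
  qed
  moreover have "\<forall>\<^sub>F q in sequentially. norm (x q - a) < d"
    using tendstoD[OF x d(1)] by (simp add: dist_norm)
  ultimately show ?thesis by (auto elim: eventually_mono)
qed

text \<open>
  The convergence result is used twice, for \<open>F\<close> and for its linearization \<open>A\<close> at \<open>0\<close>. The
  latter gives the stability of the Jacobian \<open>I + \<alpha> A\<close> that the Lyapunov equation needs.
\<close>

lemma damped_iteration_linear_convergence:
  fixes B :: "real^'k::finite \<Rightarrow> real^'k" and F :: "real^'k \<Rightarrow> real^'k"
  assumes B: "symmetric_form B" "\<And>x. x \<noteq> 0 \<Longrightarrow> x \<bullet> B x > 0"
    and F: "(F has_derivative A) (at a)" "F a = 0"
    and decay: "\<And>x. x \<noteq> 0 \<Longrightarrow> A x \<bullet> B x < 0"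
  shows "\<exists>\<alpha>bar>0. \<exists>r>0. \<forall>\<alpha>. 0 < \<alpha> \<and> \<alpha> < 1 \<and> \<alpha> < \<alpha>bar \<longrightarrow>
    (let T = (\<lambda>p. p + \<alpha> *\<^sub>R F p) in
       T differentiable (at a) \<and>
       (\<forall>p0 \<in> ball a r. bounded (range (\<lambda>q. (T ^^ q) p0)) \<and> (\<lambda>q. (T ^^ q) p0) \<longlonglongrightarrow> a) \<and>
       asymptotic_linear_conv_weighted T a r \<and> linear_conv_euclidean T a r)"
proof -
  have linA: "linear A" using F(1) by (simp add: has_derivative_linear)
  obtain \<alpha>1 r1 where ar1: "\<alpha>1 > 0" "r1 > 0"
    and it1: "\<And>\<alpha>. 0 < \<alpha> \<Longrightarrow> \<alpha> < \<alpha>1 \<Longrightarrow> \<exists>C0>0. \<exists>C1. 0 < C1 \<and> C1 < 1 \<and>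
       (\<forall>p\<in>ball a r1. \<forall>q. norm (((\<lambda>p. p + \<alpha> *\<^sub>R F p) ^^ q) p - a) \<le> C0 * C1 ^ q * norm (p - a))"
    by (rule damped_iteration_converges[OF B F decay]) auto
  have A0: "(A has_derivative A) (at 0)" "A 0 = 0"
    using linA by (auto simp: linear_0 linear_conv_bounded_linear bounded_linear_imp_has_derivative)
  obtain \<alpha>2 r2 where ar2: "\<alpha>2 > 0" "r2 > 0"
    and it2: "\<And>\<alpha>. 0 < \<alpha> \<Longrightarrow> \<alpha> < \<alpha>2 \<Longrightarrow> \<exists>C0>0. \<exists>C1. 0 < C1 \<and> C1 < 1 \<and>
       (\<forall>p\<in>ball 0 r2. \<forall>q. norm (((\<lambda>p. p + \<alpha> *\<^sub>R A p) ^^ q) p - 0) \<le> C0 * C1 ^ q * norm (p - 0))"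
    by (rule damped_iteration_converges[OF B A0 decay]) auto
  obtain LA where LA: "LA > 0" "\<And>y. norm (A y) \<le> norm y * LA"
    using bounded_linear.pos_bounded[OF linear_conv_bounded_linear[THEN iffD1, OF linA]] by auto
  \<comment> \<open>The bound \<open>1 / LA\<close> keeps the Jacobian \<open>I + \<alpha> A\<close> from vanishing, and so its norm positive.\<close>
  define \<alpha>bar where "\<alpha>bar = Min {\<alpha>1, \<alpha>2, 1 / LA}"
  have "\<alpha>bar > 0" using ar1 ar2 LA by (simp add: \<alpha>bar_def)
  moreover have "let T = (\<lambda>p. p + \<alpha> *\<^sub>R F p) in
       T differentiable (at a) \<and>
       (\<forall>p0 \<in> ball a r1. bounded (range (\<lambda>q. (T ^^ q) p0)) \<and> (\<lambda>q. (T ^^ q) p0) \<longlonglongrightarrow> a) \<and>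
       asymptotic_linear_conv_weighted T a r1 \<and> linear_conv_euclidean T a r1"
    if \<alpha>: "0 < \<alpha>" "\<alpha> < \<alpha>bar" for \<alpha>
  proof -
    define T where "T = (\<lambda>p. p + \<alpha> *\<^sub>R F p)"
    define T' where "T' = (\<lambda>p. p + \<alpha> *\<^sub>R A p)"
    have \<alpha>': "\<alpha> < \<alpha>1" "\<alpha> < \<alpha>2" "\<alpha> < 1 / LA" using \<alpha>(2) by (auto simp: \<alpha>bar_def)
    obtain C0 C1 where C: "C0 > 0" "0 < C1" "C1 < 1"
      "\<And>p q. p \<in> ball a r1 \<Longrightarrow> norm ((T ^^ q) p - a) \<le> C0 * C1 ^ q * norm (p - a)"
      using it1[OF \<alpha>(1) \<alpha>'(1)] unfolding T_def by blast
    have "(\<lambda>q. C0 * C1 ^ q * s) \<longlonglongrightarrow> C0 * 0 * s" for s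
      using C by (intro tendsto_intros LIMSEQ_realpow_zero) auto
    then have lim0: "(\<lambda>q. C0 * C1 ^ q * s) \<longlonglongrightarrow> 0" for s by simp
    have lim: "(\<lambda>q. (T ^^ q) p) \<longlonglongrightarrow> a" if "p \<in> ball a r1" for p
    proof -
      have "(\<lambda>q. (T ^^ q) p - a) \<longlonglongrightarrow> 0"
        by (rule Lim_null_comparison[OF _ lim0[of "norm (p - a)"]]) (use C(4)[OF that] in auto)
      then show ?thesis by (simp add: LIM_zero_iff)
    qed
    have derT: "(T has_derivative T') (at a)"
      unfolding T_def T'_def
      by (intro has_derivative_add has_derivative_ident has_derivative_scaleR_right F(1))
    define M where "M = jacobian T (at a)"
    have linT': "linear T'" using derT by (rule has_derivative_linear)
    have "T' = frechet_derivative T (at a)" by (rule frechet_derivative_at[OF derT])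
    then have M: "(*v) M = T'"
      unfolding M_def jacobian_def using matrix_vector_mul(2)[OF linT'] by simp
    have stable: "(\<lambda>n. (((*v) M) ^^ n) v) \<longlonglongrightarrow> 0" for v
    proof -
      obtain D0 D1 where D: "D0 > 0" "0 < D1" "D1 < 1"
        "\<And>p q. p \<in> ball 0 r2 \<Longrightarrow> norm ((T' ^^ q) p - 0) \<le> D0 * D1 ^ q * norm (p - 0)"
        using it2[OF \<alpha>(1) \<alpha>'(2)] unfolding T'_def by blast
      \<comment> \<open>The estimate holds in a ball; scaling by \<open>s\<close> extends it to all vectors by linearity.\<close>
      define s where "s = r2 / (2 * (norm v + 1))"
      have s: "s > 0" using ar2 by (simp add: s_def add_nonneg_pos)
      have "norm (s *\<^sub>R v) = r2 * (norm v / (2 * (norm v + 1)))" using ar2 by (simp add: s_def)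
      also have "\<dots> < r2 * 1" using ar2
        by (intro mult_strict_left_mono) (auto simp: pos_divide_less_eq add_nonneg_pos)
      finally have sv: "s *\<^sub>R v \<in> ball 0 r2" by simp
      have lim0: "(\<lambda>q. D0 * D1 ^ q * norm (s *\<^sub>R v)) \<longlonglongrightarrow> D0 * 0 * norm (s *\<^sub>R v)"
        using D by (intro tendsto_intros LIMSEQ_realpow_zero) auto
      then have lim0: "(\<lambda>q. D0 * D1 ^ q * norm (s *\<^sub>R v)) \<longlonglongrightarrow> 0" by simp
      have "(\<lambda>q. (T' ^^ q) (s *\<^sub>R v)) \<longlonglongrightarrow> 0"
        by (rule Lim_null_comparison[OF _ lim0]) (use D(4)[OF sv] in auto)
      moreover have "(T' ^^ q) (s *\<^sub>R v) = s *\<^sub>R (T' ^^ q) v" for q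
        by (induction q) (simp_all add: linear_scale[OF linT'])
      ultimately have "(\<lambda>q. inverse s *\<^sub>R (s *\<^sub>R (T' ^^ q) v)) \<longlonglongrightarrow> inverse s *\<^sub>R 0"
        by (intro tendsto_intros) simp
      then show ?thesis using s M by simp
    qed
    have M0: "M \<noteq> 0"
    proof
      assume "M = 0"
      then have "T' v = 0" for v using M by (metis matrix_vector_mult_0)
      then have T'1: "v = - (\<alpha> *\<^sub>R A v)" for v by (simp add: T'_def eq_neg_iff_add_eq_0)
      obtain v :: "real^'k" where v: "v \<noteq> 0" using nonempty_Basis nonzero_Basis by blast
      have "norm v = \<alpha> * norm (A v)" using T'1[of v] \<alpha>(1) by (metis norm_minus_cancel norm_scaleR abs_of_pos)
      also have "\<dots> \<le> \<alpha> * (norm v * LA)" using LA(2)[of v] \<alpha>(1) by simp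
      also have "\<dots> < norm v"
      proof -
        have "\<alpha> * LA < 1" using \<alpha>'(3) LA(1) by (simp add: field_simps)
        then have "norm v * (\<alpha> * LA) < norm v * 1" using v by (intro mult_strict_left_mono) auto
        then show ?thesis by (simp add: ac_simps)
      qed
      finally show False by simp
    qed
    have Ta: "T a = a" using F(2) by (simp add: T_def)
    have derM: "(T has_derivative (*v) M) (at a)" using derT M by simp
    have asym: "asymptotic_linear_conv_weighted T a r1"
      unfolding asymptotic_linear_conv_weighted_def Let_def M_def[symmetric]
    proof (intro allI impI)
      fix Q :: "real^'k^'k" assume Q: "sym_pos_def Q"
      obtain P where P: "sym_pos_def P" "transpose M ** P ** M - P = - Q"
        by (rule discrete_lyapunov[OF stable Q])
      note ind = induced_norm_bounds[OF P(1) Q P(2) M0]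
      show "\<exists>P. lyapunov_solution M Q P \<and>
        (\<forall>C > induced_norm P M. \<forall>p0 \<in> ball a r1. \<forall>\<^sub>F q in sequentially.
           weighted_norm P ((T ^^ Suc q) p0 - a) \<le> C * weighted_norm P ((T ^^ q) p0 - a))"
      proof (intro exI[of _ P] conjI allI impI ballI)
        show "lyapunov_solution M Q P" using P ind by (simp add: lyapunov_solution_def)
        fix C p0 assume "C > induced_norm P M" "p0 \<in> ball a r1"
        from asymptotic_weighted_contraction[OF P(1) derM Ta ind(1,3) this(1) lim[OF this(2)]]
        show "\<forall>\<^sub>F q in sequentially.
           weighted_norm P ((T ^^ Suc q) p0 - a) \<le> C * weighted_norm P ((T ^^ q) p0 - a)"
          by simp
      qed
    qed
    have "T differentiable (at a)" using derT by (auto simp: differentiable_def)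
    moreover have "bounded (range (\<lambda>q. (T ^^ q) p0))" if "p0 \<in> ball a r1" for p0
      using lim[OF that] by (auto intro: convergent_imp_bounded)
    moreover have "linear_conv_euclidean T a r1"
      unfolding linear_conv_euclidean_def using C by blast
    ultimately show ?thesis using asym lim unfolding T_def[symmetric] Let_def by blast
  qed
  ultimately show ?thesis using ar1(2) by blast
qed



section \<open>A Lyapunov form for saddle point dynamics\<close>

definition proj :: "'k::finite set \<Rightarrow> real^'k \<Rightarrow> real^'k" where
  "proj I e = (\<chi> a. if a \<in> I then e $ a else 0)"

lemma proj_nth [simp]: "proj I e $ a = (if a \<in> I then e $ a else 0)"
  by (simp add: proj_def)

lemma linear_proj: "linear (proj I)"
  by (rule linearI) (simp_all add: vec_eq_iff)

lemma supported_on_proj: "supported_on I (proj I e)"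
  by (simp add: supported_on_def)

lemma subspace_supported_on: "subspace {z. supported_on I z}"
  by (auto simp: subspace_def supported_on_def)

lemma continuous_on_linear_UNIV:
  fixes f :: "'a::euclidean_space \<Rightarrow> 'b::real_normed_vector"
  shows "linear f \<Longrightarrow> continuous_on S f"
  by (simp add: linear_continuous_on linear_conv_bounded_linear)

lemma inner_vec_split3:
  fixes u v :: "real^'k::finite"
  assumes "X \<union> E \<union> I = UNIV" "X \<inter> E = {}" "X \<inter> I = {}" "E \<inter> I = {}"
  shows "u \<bullet> v = (\<Sum>a\<in>X. u $ a * v $ a) + (\<Sum>a\<in>E. u $ a * v $ a) + (\<Sum>a\<in>I. u $ a * v $ a)"
proof -
  have "u \<bullet> v = (\<Sum>a\<in>X \<union> E \<union> I. u $ a * v $ a)" by (simp add: assms(1) inner_vec_def)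
  also have "\<dots> = (\<Sum>a\<in>X. u $ a * v $ a) + (\<Sum>a\<in>E. u $ a * v $ a) + (\<Sum>a\<in>I. u $ a * v $ a)"
    using assms by (subst sum.union_disjoint; auto)+
  finally show ?thesis .
qed

text \<open>
  The indices are split into the variables \<open>X\<close>, the multipliers \<open>E\<close> of equality and active
  constraints, and the multipliers \<open>I\<close> of inactive ones; \<open>c k\<close> is the gradient of constraint \<open>k\<close>.
  The form is \<open>t D + U\<close>. In the diagonal part \<open>D\<close> the weights \<open>1 / \<sigma>\<close> on \<open>E\<close> cancel the coupling
  between \<open>X\<close> and \<open>E\<close>, and a large weight \<open>w\<close> on \<open>I\<close> absorbs the coupling from \<open>I\<close> to \<open>X\<close>. Its
  dissipation \<open>q\<close> is degenerate, vanishing exactly when the components in \<open>X\<close> and \<open>I\<close> do. There the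
  mixed part \<open>U\<close> dissipates the square of \<open>\<Sum>\<^sub>k e\<^sub>k c\<^sub>k\<close>, which is positive by the independence of the
  gradients. Each of the weights \<open>w\<close> and \<open>t\<close> comes from Finsler's lemma.
\<close>

lemma saddle_point_lyapunov_form:
  fixes A :: "real^'k::finite \<Rightarrow> real^'k" and M :: "real^'k^'k" and c :: "'k \<Rightarrow> real^'k"
  assumes part: "X \<union> E \<union> I = UNIV" "X \<inter> E = {}" "X \<inter> I = {}" "E \<inter> I = {}"
    and linA: "linear A"
    and AX: "\<And>e a. a \<in> X \<Longrightarrow> A e $ a = - (M *v proj X e) $ a - (\<Sum>k\<in>E \<union> I. e $ k * c k $ a)"
    and AE: "\<And>e k. k \<in> E \<Longrightarrow> A e $ k = \<sigma> k * (c k \<bullet> e)"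
    and AI: "\<And>e k. k \<in> I \<Longrightarrow> A e $ k = - \<tau> k * e $ k"
    and \<sigma>: "\<And>k. k \<in> E \<Longrightarrow> \<sigma> k > 0" and \<tau>: "\<And>k. k \<in> I \<Longrightarrow> \<tau> k > 0"
    and c: "\<And>k. k \<in> E \<union> I \<Longrightarrow> supported_on X (c k)"
    and M: "pos_def_block X M"
    and indep: "\<And>e. supported_on E e \<Longrightarrow> (\<Sum>k\<in>E. e $ k *\<^sub>R c k) = 0 \<Longrightarrow> e = 0"
  obtains B where "symmetric_form B" "\<And>e. e \<noteq> 0 \<Longrightarrow> e \<bullet> B e > 0" "\<And>e. e \<noteq> 0 \<Longrightarrow> A e \<bullet> B e < 0"
proof -
  have split: "u \<bullet> v = (\<Sum>a\<in>X. u $ a * v $ a) + (\<Sum>a\<in>E. u $ a * v $ a) + (\<Sum>a\<in>I. u $ a * v $ a)"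
    for u v :: "real^'k" by (rule inner_vec_split3[OF part])
  have cX: "c k \<bullet> e = (\<Sum>a\<in>X. c k $ a * e $ a)" if "k \<in> E \<union> I" for k e
    unfolding inner_vec_def
    by (rule sum.mono_neutral_cong_right) (use c[OF that] in \<open>auto simp: supported_on_def\<close>)
  have MX: "proj X e \<bullet> (M *v proj X e) = (\<Sum>a\<in>X. e $ a * (M *v proj X e) $ a)" for e
    unfolding inner_vec_def
    by (rule sum.mono_neutral_cong_right) auto
  have coupling: "(\<Sum>a\<in>X. e $ a * (\<Sum>k\<in>K. e $ k * c k $ a)) = (\<Sum>k\<in>K. e $ k * (c k \<bullet> e))"
    if "K \<subseteq> E \<union> I" for e K
  proof -
    have "(\<Sum>a\<in>X. e $ a * (\<Sum>k\<in>K. e $ k * c k $ a)) = (\<Sum>a\<in>X. \<Sum>k\<in>K. e $ k * (c k $ a * e $ a))"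
      by (simp add: sum_distrib_left ac_simps)
    also have "\<dots> = (\<Sum>k\<in>K. \<Sum>a\<in>X. e $ k * (c k $ a * e $ a))" by (rule sum.swap)
    also have "\<dots> = (\<Sum>k\<in>K. e $ k * (c k \<bullet> e))"
      by (rule sum.cong) (use that cX in \<open>auto simp: sum_distrib_left\<close>)
    finally show ?thesis .
  qed
  define f1 where "f1 e = (\<Sum>k\<in>I. \<tau> k * (e $ k)\<^sup>2)" for e :: "real^'k"
  define g1 where "g1 e = proj X e \<bullet> (M *v proj X e) + (\<Sum>k\<in>I. e $ k * (c k \<bullet> e))" for e
  have cont: "continuous_on UNIV f1" "continuous_on UNIV g1"
    unfolding f1_def g1_def
    by (intro continuous_intros continuous_on_linear_UNIV linear_proj
        linear_compose[OF linear_proj matrix_vector_mul_linear, unfolded o_def])+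
  have hom: "homogeneous2 f1" "homogeneous2 g1"
    unfolding homogeneous2_def f1_def g1_def
    by (auto simp: linear_scale[OF linear_proj] matrix_vector_mult_scaleR sum_distrib_left
        power_mult_distrib power2_eq_square distrib_left ac_simps)
  define S where "S = {e::real^'k. supported_on (X \<union> I) e}"
  have f1: "f1 e \<ge> 0" for e
    unfolding f1_def by (intro sum_nonneg mult_nonneg_nonneg) (use \<tau> in \<open>simp_all add: less_imp_le\<close>)
  have f1_0: "e $ k = 0" if "f1 e = 0" "k \<in> I" for e k
  proof -
    have "\<forall>k\<in>I. \<tau> k * (e $ k)\<^sup>2 = 0"
      using that(1) unfolding f1_def
      by (subst (asm) sum_nonneg_eq_0_iff) (use \<tau> in \<open>simp_all add: less_imp_le\<close>)
    then show ?thesis using \<tau>[OF that(2)] that(2) by auto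
  qed
  obtain w0 where w0: "w0 \<ge> 0"
    "\<And>w e. w > w0 \<Longrightarrow> e \<in> S \<Longrightarrow> e \<noteq> 0 \<Longrightarrow> w * f1 e + g1 e > 0"
  proof (rule finsler[OF _ cont hom])
    show "subspace S" unfolding S_def by (rule subspace_supported_on)
    fix e assume e: "e \<in> S" "e \<noteq> 0" "f1 e = 0"
    have I0: "e $ k = 0" if "k \<in> I" for k using f1_0[OF e(3) that] .
    have "e = proj X e" using e(1) I0 part by (auto simp: S_def supported_on_def vec_eq_iff)
    then have "proj X e \<noteq> 0" using e(2) by metis
    then have "proj X e \<bullet> (M *v proj X e) > 0"
      using M supported_on_proj unfolding pos_def_block_def by blast
    then show "g1 e > 0" by (simp add: g1_def I0)
  qed (use f1 in auto)
  define w where "w = w0 + 1"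
  have w: "w > 0" "w > w0" using w0(1) by (auto simp: w_def)
  define q where "q e = w * f1 e + g1 e" for e
  define D where "D e = (\<chi> a. (if a \<in> X then 1 else if a \<in> E then 1 / \<sigma> a else w) * e $ a)" for e :: "real^'k"
  define U where "U e = (\<chi> a. if a \<in> X then (\<Sum>k\<in>E. e $ k * c k $ a) else if a \<in> E then c a \<bullet> e else 0)"
    for e :: "real^'k"
  have linD: "linear D" by (rule linearI) (simp_all add: D_def vec_eq_iff algebra_simps)
  have linU: "linear U"
    by (rule linearI)
      (simp_all add: U_def vec_eq_iff algebra_simps inner_add_right sum.distrib sum_distrib_left)
  have q: "A e \<bullet> D e = - q e" for e
  proof -
    have "A e \<bullet> D e = (\<Sum>a\<in>X. A e $ a * D e $ a) + (\<Sum>a\<in>E. A e $ a * D e $ a) + (\<Sum>a\<in>I. A e $ a * D e $ a)"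
      by (rule split)
    also have "(\<Sum>a\<in>X. A e $ a * D e $ a)
        = (\<Sum>a\<in>X. - (e $ a * (M *v proj X e) $ a) - e $ a * (\<Sum>k\<in>E \<union> I. e $ k * c k $ a))"
      by (rule sum.cong) (auto simp: AX D_def algebra_simps)
    also have "\<dots> = - (proj X e \<bullet> (M *v proj X e)) - (\<Sum>k\<in>E \<union> I. e $ k * (c k \<bullet> e))"
      by (simp add: sum_subtractf sum_negf MX coupling)
    also have "(\<Sum>k\<in>E \<union> I. e $ k * (c k \<bullet> e)) = (\<Sum>k\<in>E. e $ k * (c k \<bullet> e)) + (\<Sum>k\<in>I. e $ k * (c k \<bullet> e))"
      using part by (intro sum.union_disjoint) auto
    also have "(\<Sum>a\<in>E. A e $ a * D e $ a) = (\<Sum>k\<in>E. e $ k * (c k \<bullet> e))"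
    proof (rule sum.cong)
      fix k assume "k \<in> E"
      moreover have "k \<notin> X" using \<open>k \<in> E\<close> part by auto
      ultimately show "A e $ k * D e $ k = e $ k * (c k \<bullet> e)"
        using \<sigma>[of k] by (simp add: AE D_def)
    qed simp
    also have "(\<Sum>a\<in>I. A e $ a * D e $ a) = - w * f1 e"
      unfolding f1_def sum_distrib_left
    proof (rule sum.cong)
      fix k assume "k \<in> I"
      moreover have "k \<notin> X" "k \<notin> E" using \<open>k \<in> I\<close> part by auto
      ultimately show "A e $ k * D e $ k = - w * (\<tau> k * (e $ k)\<^sup>2)"
        by (simp add: AI D_def power2_eq_square)
    qed simp
    finally show ?thesis by (simp add: q_def g1_def)
  qed
  have q_proj: "q e = q (proj (X \<union> I) e)" for e
  proof -
    have "proj X (proj (X \<union> I) e) = proj X e" by (simp add: vec_eq_iff)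
    moreover have "c k \<bullet> proj (X \<union> I) e = c k \<bullet> e" if "k \<in> I" for k
      using that by (simp add: cX)
    ultimately show ?thesis by (simp add: q_def f1_def g1_def)
  qed
  have q_pos: "q e > 0" if "proj (X \<union> I) e \<noteq> 0" for e
    using w0(2)[OF w(2) _ that] q_proj[of e] supported_on_proj[of "X \<union> I" e]
    by (simp add: S_def q_def)
  have q_0: "q e = 0" if "proj (X \<union> I) e = 0" for e
    unfolding q_proj[of e] that by (simp add: q_def f1_def g1_def linear_0[OF linear_proj])
  have q_nonneg: "q e \<ge> 0" for e using q_pos[of e] q_0[of e] by force
  have contq: "continuous_on UNIV q" unfolding q_def
    by (intro continuous_intros cont)
  have homq: "homogeneous2 q" using hom by (simp add: homogeneous2_def q_def algebra_simps)
  have cont_form: "continuous_on UNIV (\<lambda>e. F e \<bullet> G e)" if "linear F" "linear G"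
    for F G :: "real^'k \<Rightarrow> real^'k"
    using that by (intro continuous_intros continuous_on_linear_UNIV)
  obtain t1 where t1: "t1 \<ge> 0"
    "\<And>t e. t > t1 \<Longrightarrow> e \<in> UNIV \<Longrightarrow> e \<noteq> 0 \<Longrightarrow> t * q e + (- A e) \<bullet> U e > 0"
  proof (rule finsler[OF subspace_UNIV contq])
    show "continuous_on UNIV (\<lambda>e. (- A e) \<bullet> U e)"
      by (intro cont_form linear_compose_neg linA linU)
    show "homogeneous2 (\<lambda>e. (- A e) \<bullet> U e)"
      by (intro homogeneous2_form linear_compose_neg linA linU)
    fix e :: "real^'k" assume e: "e \<noteq> 0" "q e = 0"
    have 0: "proj (X \<union> I) e = 0" using q_pos[of e] e(2) by auto
    then have e0: "e $ k = 0" if "k \<in> X \<union> I" for k using that by (metis proj_nth zero_index)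
    have supp: "supported_on E e" using e0 part by (auto simp: supported_on_def)
    have pX: "proj X e = 0" using e0 by (simp add: vec_eq_iff)
    have sumEI: "(\<Sum>k\<in>E \<union> I. e $ k * c k $ a) = (\<Sum>k\<in>E. e $ k * c k $ a)" for a
      by (rule sum.mono_neutral_right) (use e0 in auto)
    have "(- A e) \<bullet> U e = (\<Sum>a\<in>X. (\<Sum>k\<in>E. e $ k * c k $ a)\<^sup>2)"
    proof -
      have "(\<Sum>a\<in>X. (- A e) $ a * U e $ a) = (\<Sum>a\<in>X. (\<Sum>k\<in>E. e $ k * c k $ a)\<^sup>2)"
        by (rule sum.cong) (simp_all add: AX U_def pX sumEI power2_eq_square)
      moreover have "(\<Sum>a\<in>E. (- A e) $ a * U e $ a) = 0"
        by (rule sum.neutral) (auto simp: AE cX e0)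
      moreover have "(\<Sum>a\<in>I. (- A e) $ a * U e $ a) = 0"
        by (rule sum.neutral) (auto simp: AI e0)
      ultimately show ?thesis by (subst split) simp
    qed
    moreover have "(\<Sum>a\<in>X. (\<Sum>k\<in>E. e $ k * c k $ a)\<^sup>2) \<noteq> 0"
    proof
      assume "(\<Sum>a\<in>X. (\<Sum>k\<in>E. e $ k * c k $ a)\<^sup>2) = 0"
      then have "(\<Sum>k\<in>E. e $ k * c k $ a) = 0" if "a \<in> X" for a
        using that by (subst (asm) sum_nonneg_eq_0_iff) auto
      moreover have "(\<Sum>k\<in>E. e $ k * c k $ a) = 0" if "a \<notin> X" for a
        by (rule sum.neutral) (use c that in \<open>auto simp: supported_on_def\<close>)
      ultimately have "(\<Sum>k\<in>E. e $ k *\<^sub>R c k) = 0" by (auto simp: vec_eq_iff)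
      then show False using indep[OF supp] e(1) by blast
    qed
    moreover have "(\<Sum>a\<in>X. (\<Sum>k\<in>E. e $ k * c k $ a)\<^sup>2) \<ge> 0" by (simp add: sum_nonneg)
    ultimately show "(- A e) \<bullet> U e > 0" by linarith
  qed (use homq q_nonneg in auto)
  have D_pos: "e \<bullet> D e > 0" if e: "e \<noteq> 0" for e
  proof -
    have "e \<bullet> D e = (\<Sum>a\<in>UNIV. (if a \<in> X then 1 else if a \<in> E then 1 / \<sigma> a else w) * (e $ a)\<^sup>2)"
      by (simp add: D_def inner_vec_def power2_eq_square ac_simps)
    moreover obtain a where "e $ a \<noteq> 0" using e by (auto simp: vec_eq_iff)
    ultimately show ?thesis
      using \<sigma> w by (auto intro!: sum_pos2[where i=a] mult_pos_pos mult_nonneg_nonneg simp: less_imp_le)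
  qed
  obtain t2 where t2: "t2 \<ge> 0"
    "\<And>t e. t > t2 \<Longrightarrow> e \<in> UNIV \<Longrightarrow> e \<noteq> 0 \<Longrightarrow> t * (e \<bullet> D e) + e \<bullet> U e > 0"
  proof (rule finsler[OF subspace_UNIV])
    show "continuous_on UNIV (\<lambda>e. e \<bullet> D e)" "continuous_on UNIV (\<lambda>e. e \<bullet> U e)"
      using cont_form[OF linear_id[unfolded id_def]] linD linU by blast+
    show "homogeneous2 (\<lambda>e. e \<bullet> D e)" "homogeneous2 (\<lambda>e. e \<bullet> U e)"
      using homogeneous2_form[OF _ linear_id[unfolded id_def]] linD linU by blast+
    show "0 \<le> e \<bullet> D e" for e using D_pos[of e] by (cases "e = 0") auto
    show "0 < e \<bullet> U e" if "e \<noteq> 0" "e \<bullet> D e = 0" for e using D_pos[OF that(1)] that(2) by simp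
  qed auto
  define t where "t = t1 + t2 + 1"
  have t: "t > t1" "t > t2" using t1(1) t2(1) by (auto simp: t_def)
  define B where "B e = t *\<^sub>R D e + U e" for e
  have symD: "x \<bullet> D y = y \<bullet> D x" for x y
    by (simp add: D_def inner_vec_def ac_simps)
  have symU: "x \<bullet> U y = y \<bullet> U x" for x y
  proof -
    have U: "x \<bullet> U y = (\<Sum>k\<in>E. y $ k * (c k \<bullet> x)) + (\<Sum>k\<in>E. x $ k * (c k \<bullet> y))" for x y
    proof -
      have "(\<Sum>a\<in>X. x $ a * U y $ a) = (\<Sum>a\<in>X. \<Sum>k\<in>E. y $ k * (c k $ a * x $ a))"
        by (rule sum.cong) (auto simp: U_def sum_distrib_left ac_simps)
      also have "\<dots> = (\<Sum>k\<in>E. \<Sum>a\<in>X. y $ k * (c k $ a * x $ a))" by (rule sum.swap)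
      also have "\<dots> = (\<Sum>k\<in>E. y $ k * (c k \<bullet> x))"
        by (rule sum.cong) (auto simp: cX sum_distrib_left)
      finally have "(\<Sum>a\<in>X. x $ a * U y $ a) = (\<Sum>k\<in>E. y $ k * (c k \<bullet> x))" .
      moreover have "(\<Sum>a\<in>E. x $ a * U y $ a) = (\<Sum>k\<in>E. x $ k * (c k \<bullet> y))"
        by (rule sum.cong) (use part in \<open>auto simp: U_def\<close>)
      moreover have "(\<Sum>a\<in>I. x $ a * U y $ a) = 0"
        by (rule sum.neutral) (use part in \<open>auto simp: U_def\<close>)
      ultimately show ?thesis by (subst split) simp
    qed
    show ?thesis unfolding U by simp
  qed
  have linB: "linear B" unfolding B_def
    by (intro linear_compose_add linear_compose_scale_right linD linU)
  show ?thesis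
  proof (rule that)
    show "symmetric_form B" using linB symD symU
      by (simp add: symmetric_form_def B_def inner_add_right)
    show "e \<bullet> B e > 0" if "e \<noteq> 0" for e
      using t2(2)[OF t(2) UNIV_I that] by (simp add: B_def inner_add_right)
    show "A e \<bullet> B e < 0" if "e \<noteq> 0" for e
      using t1(2)[OF t(1) UNIV_I that] q[of e] by (simp add: B_def inner_add_right)
  qed
qed

text \<open>
  A nontrivial relation \<open>e\<close> with \<open>e\<^sub>k \<noteq> 0\<close> allows column \<open>k\<close> to be expressed by the others, so that
  fewer than \<open>card C\<close> columns would span the range.
\<close>

lemma full_column_rank_independent:
  fixes M :: "real^'k^'k::finite"
  assumes "full_column_rank R C M" and "supported_on C e"
    and "\<And>a. a \<in> R \<Longrightarrow> (\<Sum>k\<in>C. M $ a $ k * e $ k) = 0"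
  shows "e = 0"
proof -
  define M' where "M' = ((\<chi> a b. if a \<in> R \<and> b \<in> C then M $ a $ b else 0) :: real^'k^'k)"
  have col0: "column j M' = 0" if "j \<notin> C" for j
    using that by (simp add: column_def M'_def vec_eq_iff)
  have comb: "M' *v z = (\<Sum>j\<in>C. z $ j *\<^sub>R column j M')" for z
  proof -
    have "M' *v z = (\<Sum>j\<in>UNIV. z $ j *\<^sub>R column j M')"
      by (simp add: matrix_mult_sum scalar_mult_eq_scaleR)
    also have "\<dots> = (\<Sum>j\<in>C. z $ j *\<^sub>R column j M')"
      by (rule sum.mono_neutral_right) (auto simp: col0)
    finally show ?thesis .
  qed
  have "(M' *v e) $ a = (if a \<in> R then \<Sum>k\<in>C. M $ a $ k * e $ k else 0)" for a
    unfolding M'_def matrix_vector_mult_def by (auto intro!: sum.mono_neutral_cong_right)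
  then have e0: "M' *v e = 0" using assms(3) by (simp add: vec_eq_iff)
  have "e $ k = 0" for k
  proof (rule ccontr)
    assume k: "e $ k \<noteq> 0"
    then have kC: "k \<in> C" using assms(2) by (auto simp: supported_on_def)
    let ?W = "(\<lambda>j. column j M') ` (C - {k})"
    have "M' *v x \<in> span ?W" for x
    proof -
      define z where "z = x - (x $ k / e $ k) *\<^sub>R e"
      have "M' *v x = M' *v z"
        by (simp add: z_def matrix_vector_mult_diff_distrib matrix_vector_mult_scaleR e0)
      also have "\<dots> = (\<Sum>j\<in>C - {k}. z $ j *\<^sub>R column j M')"
        unfolding comb
        by (rule sum.mono_neutral_right) (use k in \<open>auto simp: z_def\<close>)
      also have "\<dots> \<in> span ?W" by (intro span_sum span_scale span_base) auto
      finally show ?thesis .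
    qed
    then have "dim (range ((*v) M')) \<le> card ?W" by (intro dim_le_card) auto
    also have "\<dots> \<le> card (C - {k})" by (rule card_image_le) simp
    also have "\<dots> < card C" using kC by (intro psubset_card_mono) auto
    also have "\<dots> = dim (range ((*v) M'))"
      using assms(1) by (simp add: full_column_rank_def M'_def rank_dim_range)
    finally show False by simp
  qed
  then show "e = 0" by (simp add: vec_eq_iff)
qed

section \<open>Continuously differentiable functions and implicit functions\<close>

text \<open>
  Continuity of the derivative is asked for in each direction separately. In finite dimension this
  is continuity in the operator norm, and it is easier to check.
\<close>

definition C1 :: "('a::euclidean_space \<Rightarrow> 'b::euclidean_space) \<Rightarrow> bool" where
  "C1 f \<longleftrightarrow> (\<exists>f'. (\<forall>x. (f has_derivative f' x) (at x)) \<and> (\<forall>v. continuous_on UNIV (\<lambda>x. f' x v)))"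

lemma C1I:
  assumes "\<And>x. (f has_derivative f' x) (at x)" "\<And>v. continuous_on UNIV (\<lambda>x. f' x v)"
  shows "C1 f"
  using assms unfolding C1_def by blast

lemma C1_continuous: "C1 f \<Longrightarrow> continuous_on UNIV f"
  unfolding C1_def using has_derivative_continuous by (metis continuous_at_imp_continuous_on)

lemma C1_has_derivative:
  "C1 f \<Longrightarrow> (f has_derivative frechet_derivative f (at x)) (at x)"
  unfolding C1_def frechet_derivative_works[symmetric] differentiable_def by blast

lemma C1_const: "C1 (\<lambda>x. c)"
  by (rule C1I[where f'="\<lambda>x v. 0"]) auto

lemma C1_linear: "linear f \<Longrightarrow> C1 f"
  by (rule C1I[where f'="\<lambda>x. f"])
    (auto simp: linear_conv_bounded_linear bounded_linear_imp_has_derivative)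

lemma C1_add: assumes "C1 f" "C1 g" shows "C1 (\<lambda>x. f x + g x)"
proof -
  obtain f' g' where "\<And>x. (f has_derivative f' x) (at x)" "\<And>v. continuous_on UNIV (\<lambda>x. f' x v)"
    "\<And>x. (g has_derivative g' x) (at x)" "\<And>v. continuous_on UNIV (\<lambda>x. g' x v)"
    using assms unfolding C1_def by blast
  then show ?thesis
    by (intro C1I[where f'="\<lambda>x v. f' x v + g' x v"] has_derivative_add continuous_on_add)
qed

lemma C1_sum: "(\<And>i. i \<in> I \<Longrightarrow> C1 (f i)) \<Longrightarrow> C1 (\<lambda>x. \<Sum>i\<in>I. f i x)"
  by (induction I rule: infinite_finite_induct) (auto intro: C1_const C1_add)

lemma C1_mult:
  fixes f g :: "'a::euclidean_space \<Rightarrow> real"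
  assumes "C1 f" "C1 g" shows "C1 (\<lambda>x. f x * g x)"
proof -
  obtain f' g' where d: "\<And>x. (f has_derivative f' x) (at x)" "\<And>v. continuous_on UNIV (\<lambda>x. f' x v)"
    "\<And>x. (g has_derivative g' x) (at x)" "\<And>v. continuous_on UNIV (\<lambda>x. g' x v)"
    using assms unfolding C1_def by blast
  show ?thesis
    by (rule C1I[where f'="\<lambda>x v. f x * g' x v + f' x v * g x"])
      (intro has_derivative_mult d continuous_intros C1_continuous assms)+
qed

lemma C1_compose:
  assumes "C1 f" "C1 g" shows "C1 (\<lambda>x. f (g x))"
proof -
  obtain f' g' where d: "\<And>x. (f has_derivative f' x) (at x)" "\<And>v. continuous_on UNIV (\<lambda>x. f' x v)"
    "\<And>x. (g has_derivative g' x) (at x)" "\<And>v. continuous_on UNIV (\<lambda>x. g' x v)"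
    using assms unfolding C1_def by blast
  have expand: "f' x w = (\<Sum>b\<in>Basis. (w \<bullet> b) *\<^sub>R f' x b)" for x w
  proof -
    have "linear (f' x)" using d(1) by (rule has_derivative_linear)
    then have "f' x (\<Sum>b\<in>Basis. (w \<bullet> b) *\<^sub>R b) = (\<Sum>b\<in>Basis. (w \<bullet> b) *\<^sub>R f' x b)"
      by (simp add: linear_sum linear_scale)
    then show ?thesis by (simp add: euclidean_representation)
  qed
  show ?thesis
  proof (rule C1I[where f'="\<lambda>x v. f' (g x) (g' x v)"])
    show "((\<lambda>x. f (g x)) has_derivative (\<lambda>v. f' (g x) (g' x v))) (at x)" for x
      by (rule has_derivative_compose[OF d(3) d(1)])
    have "continuous_on UNIV (\<lambda>x. f' (g x) b)" for b
      by (rule continuous_on_compose2[OF d(2) C1_continuous[OF assms(2)]]) auto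
    then show "continuous_on UNIV (\<lambda>x. f' (g x) (g' x v))" for v
      by (subst expand) (intro continuous_intros d)
  qed
qed

lemma C1_vec:
  fixes f :: "'a::euclidean_space \<Rightarrow> real^'k::finite"
  assumes "\<And>i. C1 (\<lambda>x. f x $ i)" shows "C1 f"
proof -
  have "\<forall>i. \<exists>f'. (\<forall>x. ((\<lambda>x. f x $ i) has_derivative f' x) (at x)) \<and> (\<forall>v. continuous_on UNIV (\<lambda>x. f' x v))"
    using assms unfolding C1_def by blast
  then obtain f' where d: "\<And>i x. ((\<lambda>x. f x $ i) has_derivative f' i x) (at x)"
    "\<And>i v. continuous_on UNIV (\<lambda>x. f' i x v)" by metis
  show ?thesis
  proof (rule C1I[where f'="\<lambda>x v. \<chi> i. f' i x v"])
    show "(f has_derivative (\<lambda>v. \<chi> i. f' i x v)) (at x)" for x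
      by (subst has_derivative_componentwise_within)
        (use d(1) in \<open>auto simp: Basis_vec_def inner_axis\<close>)
    show "continuous_on UNIV (\<lambda>x. \<chi> i. f' i x v)" for v
      by (intro continuous_on_vec_lambda d)
  qed
qed

text \<open>
  The inverse function theorem is applied to \<open>(p, y) \<mapsto> (p, K (p, y))\<close>. The bound \<open>e0\<close> on the
  radii lets the solution be compared with other local descriptions of the same equation.
\<close>

lemma implicit_function:
  fixes K :: "'a::euclidean_space \<times> 'b::euclidean_space \<Rightarrow> 'b"
  assumes K: "C1 K" "K (a, b) = 0" and der: "(K has_derivative D) (at (a, b))"
    and inj: "\<And>w. D (0, w) = 0 \<Longrightarrow> w = 0" and e0: "e0 > 0"
  obtains \<phi> \<phi>' \<delta> \<epsilon> where "0 < \<delta>" "\<delta> \<le> \<epsilon>" "\<epsilon> \<le> e0" "\<phi> a = b" "(\<phi> has_derivative \<phi>') (at a)"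
    "\<And>p. p \<in> ball a \<delta> \<Longrightarrow> \<phi> p \<in> ball b \<epsilon>"
    "\<And>p y. p \<in> ball a \<delta> \<Longrightarrow> y \<in> ball b \<epsilon> \<Longrightarrow> K (p, y) = 0 \<longleftrightarrow> y = \<phi> p"
proof -
  obtain K' where K': "\<And>x. (K has_derivative K' x) (at x)" "\<And>v. continuous_on UNIV (\<lambda>x. K' x v)"
    using K(1) unfolding C1_def by blast
  have KD: "K' (a, b) = D" using has_derivative_unique[OF K'(1) der] .
  define \<Psi> where "\<Psi> z = (fst z, K z)" for z
  define \<Psi>' where "\<Psi>' z = (\<lambda>v. (fst v, K' z v))" for z
  have der\<Psi>: "(\<Psi> has_derivative \<Psi>' z) (at z)" for z
    unfolding \<Psi>_def \<Psi>'_def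
    by (intro has_derivative_Pair has_derivative_fst has_derivative_ident K'(1))
  have bl: "bounded_linear (\<Psi>' z)" for z using der\<Psi> by (rule has_derivative_bounded_linear)
  have Bl: "blinfun_apply (Blinfun (\<Psi>' z)) = \<Psi>' z" for z by (rule bounded_linear_Blinfun_apply[OF bl])
  have lin: "linear (\<Psi>' (a, b))" using bl by (simp add: linear_conv_bounded_linear)
  have "v = 0" if "\<Psi>' (a, b) v = 0" for v
    using that inj[of "snd v"] by (cases v) (auto simp: \<Psi>'_def KD zero_prod_def)
  then have "inj (\<Psi>' (a, b))" using linear_injective_0[OF lin] by blast
  then obtain G where G: "linear G" "\<And>x. G (\<Psi>' (a, b) x) = x"
    using linear_injective_left_inverse[OF lin] by (metis comp_apply id_apply)
  have inv: "Blinfun G o\<^sub>L Blinfun (\<Psi>' (a, b)) = id_blinfun"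
    using G by (intro blinfun_eqI)
      (simp add: Bl bounded_linear_Blinfun_apply linear_conv_bounded_linear)
  have cont: "continuous_on UNIV (\<lambda>z. Blinfun (\<Psi>' z))"
  proof (rule continuous_on_blinfun_componentwise)
    show "continuous_on UNIV (\<lambda>z. blinfun_apply (Blinfun (\<Psi>' z)) i)" for i
      unfolding Bl unfolding \<Psi>'_def by (intro continuous_intros K'(2))
  qed
  obtain U' V g g' where g: "open U'" "(a, b) \<in> U'" "open V" "\<Psi> (a, b) \<in> V"
      "homeomorphism U' V \<Psi> g"
    and derg: "\<And>y. y \<in> V \<Longrightarrow> (g has_derivative (g' y)) (at y)"
  proof (rule inverse_function_theorem[OF open_UNIV _ cont UNIV_I inv])
    show "(\<Psi> has_derivative blinfun_apply (Blinfun (\<Psi>' x))) (at x)" for x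
      unfolding Bl by (rule der\<Psi>)
  qed (rule that; assumption)
  have aV: "(a, 0) \<in> V" using g(4) K(2) by (simp add: \<Psi>_def)
  have g\<Psi>: "g (\<Psi> z) = z" if "z \<in> U'" for z using g(5) that by (simp add: homeomorphism_apply1)
  have \<Psi>g: "\<Psi> (g w) = w" if "w \<in> V" for w using g(5) that by (simp add: homeomorphism_apply2)
  define \<phi> where "\<phi> p = snd (g (p, 0))" for p
  have \<phi>a: "\<phi> a = b" using g\<Psi>[OF g(2)] K(2) by (simp add: \<phi>_def \<Psi>_def)
  have "((\<lambda>p. (p, 0::'b)) has_derivative (\<lambda>v. (v, 0))) (at a)"
    by (intro has_derivative_Pair has_derivative_ident has_derivative_const)
  from has_derivative_snd[OF has_derivative_compose[OF this derg[OF aV]]]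
  have der\<phi>: "(\<phi> has_derivative (\<lambda>v. snd (g' (a, 0) (v, 0)))) (at a)"
    by (simp add: \<phi>_def[abs_def])
  obtain A1 B1 where AB: "open A1" "open B1" "a \<in> A1" "b \<in> B1" "A1 \<times> B1 \<subseteq> U'"
    using open_prod_elim[OF g(1,2)] by (metis mem_Sigma_iff)
  obtain e1 e2 where e12: "e1 > 0" "ball a e1 \<subseteq> A1" "e2 > 0" "ball b e2 \<subseteq> B1"
    using AB by (meson open_contains_ball)
  define \<epsilon> where "\<epsilon> = Min {e0, e1, e2}"
  have \<epsilon>: "\<epsilon> > 0" "\<epsilon> \<le> e0" "\<epsilon> \<le> e1" "\<epsilon> \<le> e2" using e12 e0 by (auto simp: \<epsilon>_def)
  have inU: "(p, y) \<in> U'" if "p \<in> ball a \<epsilon>" "y \<in> ball b \<epsilon>" for p y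
  proof -
    have "p \<in> ball a e1" "y \<in> ball b e2" using that \<epsilon> by auto
    then have "p \<in> A1" "y \<in> B1" using e12 by auto
    then show ?thesis using AB(5) by blast
  qed
  obtain A2 B2 where AB2: "open A2" "open B2" "a \<in> A2" "(0::'b) \<in> B2" "A2 \<times> B2 \<subseteq> V"
    using open_prod_elim[OF g(3) aV] by (metis mem_Sigma_iff)
  obtain e3 where e3: "e3 > 0" "ball a e3 \<subseteq> A2" using AB2 by (meson open_contains_ball)
  have inV: "(p, 0) \<in> V" if "p \<in> ball a e3" for p using that e3 AB2 by auto
  have "isCont \<phi> a" using der\<phi> by (rule has_derivative_continuous)
  then obtain e4 where e4: "e4 > 0" "\<And>p. dist p a < e4 \<Longrightarrow> dist (\<phi> p) b < \<epsilon>"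
    using \<epsilon>(1) unfolding continuous_at_eps_delta \<phi>a dist_norm by blast
  define \<delta> where "\<delta> = Min {\<epsilon>, e3, e4}"
  have \<delta>: "\<delta> > 0" "\<delta> \<le> \<epsilon>" "\<delta> \<le> e3" "\<delta> \<le> e4" using \<epsilon> e3 e4 by (auto simp: \<delta>_def)
  show ?thesis
  proof (rule that[OF \<delta>(1,2) \<epsilon>(2) \<phi>a der\<phi>])
    fix p assume p: "p \<in> ball a \<delta>"
    then show "\<phi> p \<in> ball b \<epsilon>" using e4(2)[of p] \<delta> by (auto simp: dist_commute)
    have gp: "\<Psi> (g (p, 0)) = (p, 0)" using p \<delta> by (intro \<Psi>g inV) auto
    then have "g (p, 0) = (p, \<phi> p)" by (cases "g (p, 0)") (auto simp: \<Psi>_def \<phi>_def)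
    then have K\<phi>: "K (p, \<phi> p) = 0" using gp by (simp add: \<Psi>_def)
    fix y assume y: "y \<in> ball b \<epsilon>"
    have "p \<in> ball a \<epsilon>" using p \<delta>(2) by auto
    then have "g (\<Psi> (p, y)) = (p, y)" using y by (intro g\<Psi> inU)
    then show "K (p, y) = 0 \<longleftrightarrow> y = \<phi> p" using K\<phi> by (auto simp: \<Psi>_def \<phi>_def)
  qed
qed

text \<open>
  Where one factor vanishes, mere continuity of the other one suffices for the product rule. This
  matters because the coefficient matrices of the algorithm contain second derivatives along \<open>\<Phi>\<close>.
\<close>

lemma has_derivative_mult_vanishing:
  fixes c w :: "'a::euclidean_space \<Rightarrow> real"
  assumes c: "isCont c a" and w: "(w has_derivative w') (at a)" "w a = 0"
  shows "((\<lambda>x. c x * w x) has_derivative (\<lambda>v. c a * w' v)) (at a)"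
proof -
  obtain L where L: "L > 0" "\<And>v. norm (w' v) \<le> norm v * L"
    using bounded_linear.pos_bounded[OF has_derivative_bounded_linear[OF w(1)]] by auto
  have small: "((\<lambda>x. (c x - c a) * w x) has_derivative (\<lambda>v. 0)) (at a)"
    unfolding has_derivative_at_alt
  proof (intro conjI allI impI)
    fix e :: real assume e: "e > 0"
    obtain d1 where d1: "d1 > 0" "\<And>x. norm (x - a) < d1 \<Longrightarrow> norm (w x - w a - w' (x - a)) \<le> 1 * norm (x - a)"
      using w(1) unfolding has_derivative_at_alt using zero_less_one by blast
    have "e / (L + 1) > 0" using e L by simp
    then obtain d2 where d2: "d2 > 0" "\<And>x. dist x a < d2 \<Longrightarrow> dist (c x) (c a) < e / (L + 1)"
      using c unfolding continuous_at_eps_delta dist_norm by blast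
    have "norm ((c x - c a) * w x - (c a - c a) * w a - 0) \<le> e * norm (x - a)"
      if "norm (x - a) < min d1 d2" for x
    proof -
      have "norm (w x - w' (x - a)) \<le> norm (x - a)" using d1(2)[of x] that w(2) by simp
      then have "\<bar>w x\<bar> \<le> (L + 1) * norm (x - a)"
        using L(2)[of "x - a"] norm_triangle_ineq[of "w x - w' (x - a)" "w' (x - a)"]
        by (simp add: algebra_simps)
      moreover have "\<bar>c x - c a\<bar> \<le> e / (L + 1)" using d2(2)[of x] that by (simp add: dist_norm)
      ultimately have "\<bar>c x - c a\<bar> * \<bar>w x\<bar> \<le> e / (L + 1) * ((L + 1) * norm (x - a))"
        using L e by (intro mult_mono) auto
      then show ?thesis using L by (simp add: abs_mult)
    qed
    then show "\<exists>d>0. \<forall>x. norm (x - a) < d \<longrightarrow> norm ((c x - c a) * w x - (c a - c a) * w a - 0) \<le> e * norm (x - a)"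
      using d1(1) d2(1) by (intro exI[of _ "min d1 d2"]) auto
  qed simp
  have "((\<lambda>x. c a * w x + (c x - c a) * w x) has_derivative (\<lambda>v. c a * w' v + 0)) (at a)"
    by (intro has_derivative_add has_derivative_mult_right w(1) small)
  then show ?thesis by (simp add: algebra_simps)
qed

lemma has_derivative_matrix_vector_vanishing:
  fixes M :: "'a::euclidean_space \<Rightarrow> real^'k::finite^'k" and w :: "'a \<Rightarrow> real^'k"
  assumes "\<And>i j. isCont (\<lambda>x. M x $ i $ j) a" "(w has_derivative w') (at a)" "w a = 0"
  shows "((\<lambda>x. M x *v w x) has_derivative (\<lambda>v. M a *v w' v)) (at a)"
proof -
  have w: "((\<lambda>x. w x $ j) has_derivative (\<lambda>v. w' v $ j)) (at a)" for j
    by (rule bounded_linear.has_derivative[OF bounded_linear_vec_nth assms(2)])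
  have "((\<lambda>x. (M x *v w x) $ i) has_derivative (\<lambda>v. (M a *v w' v) $ i)) (at a)" for i
    unfolding matrix_vector_mult_def vec_lambda_beta
    by (intro has_derivative_sum has_derivative_mult_vanishing assms(1) w) (simp add: assms(3))
  then show ?thesis
    by (subst has_derivative_componentwise_within) (auto simp: Basis_vec_def inner_axis)
qed

section \<open>Partial derivatives\<close>

lemma pd_eq: "(F has_derivative F') (at p) \<Longrightarrow> pd a F p = F' (axis a 1)"
  unfolding pd_def by (metis frechet_derivative_at)

lemma linear_axis_expansion:
  fixes f :: "real^'k::finite \<Rightarrow> real"
  assumes "linear f" shows "f v = (\<Sum>a\<in>UNIV. f (axis a 1) * v $ a)"
proof -
  have "f v = f (\<Sum>a\<in>UNIV. v $ a *\<^sub>R axis a 1)"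
    using basis_expansion[of v] by (simp add: scalar_mult_eq_scaleR)
  also have "\<dots> = (\<Sum>a\<in>UNIV. f (axis a 1) * v $ a)"
    by (simp add: linear_sum[OF assms] linear_scale[OF assms] mult.commute)
  finally show ?thesis .
qed

lemma has_derivative_pd:
  fixes F :: "real^'k::finite \<Rightarrow> real"
  assumes "F differentiable (at p)"
  shows "(F has_derivative (\<lambda>v. \<Sum>a\<in>UNIV. pd a F p * v $ a)) (at p)"
proof -
  have d: "(F has_derivative frechet_derivative F (at p)) (at p)"
    using assms frechet_derivative_works by blast
  have "frechet_derivative F (at p) = (\<lambda>v. \<Sum>a\<in>UNIV. pd a F p * v $ a)"
    unfolding pd_def by (rule ext) (rule linear_axis_expansion[OF has_derivative_linear[OF d]])
  then show ?thesis using d by simp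
qed

lemma C_k_mono: "C_k (Suc m) F \<Longrightarrow> C_k m F"
proof (induction m arbitrary: F)
  case 0
  then show ?case
    by (auto intro!: continuous_at_imp_continuous_on differentiable_imp_continuous_within)
next
  case (Suc m)
  then show ?case by (metis C_k.simps(2))
qed

lemma C_k_continuous: "C_k m F \<Longrightarrow> continuous_on UNIV F"
  by (induction m) (auto dest: C_k_mono simp del: C_k.simps(2))

lemma C_k_C1:
  assumes "C_k (Suc m) F" shows "C1 F"
proof (rule C1I[where f'="\<lambda>p v. \<Sum>a\<in>UNIV. pd a F p * v $ a"])
  show "(F has_derivative (\<lambda>v. \<Sum>a\<in>UNIV. pd a F p * v $ a)) (at p)" for p
    using assms by (intro has_derivative_pd) simp
  have "continuous_on UNIV (pd a F)" for a using assms by (auto intro: C_k_continuous)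
  then show "continuous_on UNIV (\<lambda>p. \<Sum>a\<in>UNIV. pd a F p * v $ a)" for v
    by (intro continuous_intros)
qed

lemma pd_along_line:
  assumes "F differentiable (at p)"
  shows "pd a F p = frechet_derivative (\<lambda>t. F (p + t *\<^sub>R axis a 1)) (at (0::real)) 1"
proof -
  have d: "(F has_derivative frechet_derivative F (at p)) (at (p + (0::real) *\<^sub>R axis a 1))"
    using assms frechet_derivative_works by auto
  have "((\<lambda>t::real. p + t *\<^sub>R axis a 1) has_derivative (\<lambda>t. t *\<^sub>R axis a 1)) (at 0)"
    by (auto intro!: derivative_eq_intros)
  from frechet_derivative_at[OF has_derivative_compose[OF this d]]
  show ?thesis by (metis pd_def scaleR_one)
qed

lemma pd_outside_support:
  assumes "depends_only_on I F" "F differentiable (at p)" "a \<notin> I"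
  shows "pd a F p = 0"
proof -
  have "F (p + t *\<^sub>R axis a 1) = F p" for t :: real
    by (rule assms(1)[unfolded depends_only_on_def, rule_format])
      (use assms(3) in \<open>auto simp: axis_def\<close>)
  then have "(\<lambda>t::real. F (p + t *\<^sub>R axis a 1)) = (\<lambda>t. F p)" by simp
  then show ?thesis unfolding pd_along_line[OF assms(2)] by (simp add: frechet_derivative_const)
qed

lemma depends_only_on_pd:
  assumes "depends_only_on I F" "\<And>p. F differentiable (at p)"
  shows "depends_only_on I (pd a F)"
  unfolding depends_only_on_def
proof (intro allI impI)
  fix p p' :: "real^'a" assume eq: "\<forall>a\<in>I. p $ a = p' $ a"
  have "F (p + t *\<^sub>R axis a 1) = F (p' + t *\<^sub>R axis a 1)" for t :: real
    by (rule assms(1)[unfolded depends_only_on_def, rule_format]) (use eq in auto)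
  then show "pd a F p = pd a F p'" by (simp add: pd_along_line[OF assms(2)])
qed

lemma C_k_3:
  assumes "C_k 3 F"
  shows "F differentiable (at p)" "pd a F differentiable (at p)" "C1 F" "C1 (pd a F)"
    "continuous_on UNIV (pd b (pd a F))"
  using assms C_k_C1[of 2 F] C_k_C1[of 1 "pd a F"] C_k_continuous[of 1 "pd b (pd a F)"]
  by (simp_all add: numeral_3_eq_3 numeral_2_eq_2 del: C_k.simps(1))



section \<open>Gradients and Hessians of Lagrangians\<close>

abbreviation vars :: "('v::finite, 'k::finite) nlp \<Rightarrow> 'v \<Rightarrow> 'k set" where
  "vars N i \<equiv> Xs N \<inter> own N i"

abbreviation cons :: "('v::finite, 'k::finite) nlp \<Rightarrow> 'k set" where
  "cons N \<equiv> Gs N \<union> Hs N"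

lemma kind_partition:
  "Xs N \<inter> Gs N = {}" "Xs N \<inter> Hs N = {}" "Gs N \<inter> Hs N = {}" "Xs N \<union> Gs N \<union> Hs N = UNIV"
  by (auto simp: Xs_def Gs_def Hs_def) (metis component_kind.exhaust)

lemma sum_axis: "(\<Sum>b\<in>B. f b * axis a (1::real) $ b) = (if (a::'k::finite) \<in> B then f a else 0)"
  by (simp add: axis_def if_distrib[of "\<lambda>x. _ * x"] sum.delta cong: if_cong)

lemma differentiable_sum_pd:
  fixes f :: "'i \<Rightarrow> real^'k::finite \<Rightarrow> real"
  assumes "\<And>i. i \<in> I \<Longrightarrow> f i differentiable (at p)"
  shows "(\<lambda>p. \<Sum>i\<in>I. f i p) differentiable (at p)"
    and "pd a (\<lambda>p. \<Sum>i\<in>I. f i p) p = (\<Sum>i\<in>I. pd a (f i) p)"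
proof -
  have d: "((\<lambda>p. \<Sum>i\<in>I. f i p) has_derivative (\<lambda>v. \<Sum>i\<in>I. \<Sum>b\<in>UNIV. pd b (f i) p * v $ b)) (at p)"
    by (intro has_derivative_sum has_derivative_pd assms)
  then show "(\<lambda>p. \<Sum>i\<in>I. f i p) differentiable (at p)" by (auto simp: differentiable_def)
  show "pd a (\<lambda>p. \<Sum>i\<in>I. f i p) p = (\<Sum>i\<in>I. pd a (f i) p)"
    by (subst pd_eq[OF d]) (simp add: sum_axis)
qed

text \<open>
  With all constraints in \<open>K\<close> this is the central Lagrangian, with those of one agent a local one.
  The components of \<open>p\<close> in \<open>K\<close> are the multipliers, so derivatives in these directions are included.
\<close>

definition Lagrange_sum ::
    "('k \<Rightarrow> real^'k::finite \<Rightarrow> real) \<Rightarrow> (real^'k \<Rightarrow> real) \<Rightarrow> 'k set \<Rightarrow> real^'k \<Rightarrow> real" where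
  "Lagrange_sum c f K p = f p + (\<Sum>k\<in>K. p $ k * c k p)"

lemma Lagrange_sum_pd:
  assumes "f differentiable (at p)" "\<And>k. k \<in> K \<Longrightarrow> c k differentiable (at p)"
  shows "pd a (Lagrange_sum c f K) p
      = pd a f p + (\<Sum>k\<in>K. p $ k * pd a (c k) p) + (if a \<in> K then c a p else 0)"
    and "Lagrange_sum c f K differentiable (at p)"
proof -
  have d: "(Lagrange_sum c f K has_derivative (\<lambda>v. (\<Sum>b\<in>UNIV. pd b f p * v $ b)
      + (\<Sum>k\<in>K. p $ k * (\<Sum>b\<in>UNIV. pd b (c k) p * v $ b) + v $ k * c k p))) (at p)"
    unfolding Lagrange_sum_def[abs_def]
    by (intro has_derivative_add has_derivative_sum has_derivative_mult has_derivative_pd assms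
        bounded_linear_imp_has_derivative bounded_linear_vec_nth)
  then show "Lagrange_sum c f K differentiable (at p)" by (auto simp: differentiable_def)
  show "pd a (Lagrange_sum c f K) p
      = pd a f p + (\<Sum>k\<in>K. p $ k * pd a (c k) p) + (if a \<in> K then c a p else 0)"
    using sum_axis[of "\<lambda>k. c k p" a K]
    by (subst pd_eq[OF d]) (simp add: sum_axis sum.distrib mult.commute)
qed

lemma Lagrange_sum_hessian:
  assumes f: "\<And>p. f differentiable (at p)" "\<And>p. pd a f differentiable (at p)"
    and c: "\<And>p k. k \<in> K \<Longrightarrow> c k differentiable (at p)"
      "\<And>p k. k \<in> K \<Longrightarrow> pd a (c k) differentiable (at p)"
    and a: "a \<notin> K"
  shows "pd b (pd a (Lagrange_sum c f K)) p
      = pd b (pd a f) p + (\<Sum>k\<in>K. p $ k * pd b (pd a (c k)) p) + (if b \<in> K then pd a (c b) p else 0)"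
proof -
  have "pd a (Lagrange_sum c f K) = Lagrange_sum (\<lambda>k. pd a (c k)) (pd a f) K"
    using Lagrange_sum_pd(1)[OF f(1) c(1)] a by (auto simp: Lagrange_sum_def)
  then show ?thesis using Lagrange_sum_pd(1)[OF f(2) c(2)] by simp
qed

lemma C1_nth: "C1 (\<lambda>p. p $ k)"
  by (rule C1_linear) (simp add: bounded_linear.linear bounded_linear_vec_nth)

lemma Lagrange_sum_C1_pd:
  assumes f: "\<And>p. f differentiable (at p)" "C1 (pd a f)"
    and c: "\<And>p k. k \<in> K \<Longrightarrow> c k differentiable (at p)" "\<And>k. k \<in> K \<Longrightarrow> C1 (pd a (c k))"
    and a: "a \<notin> K"
  shows "C1 (pd a (Lagrange_sum c f K))"
proof -
  have "pd a (Lagrange_sum c f K) = (\<lambda>p. pd a f p + (\<Sum>k\<in>K. p $ k * pd a (c k) p))"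
    using Lagrange_sum_pd(1)[OF f(1) c(1)] a by auto
  moreover have "C1 (\<lambda>p. pd a f p + (\<Sum>k\<in>K. p $ k * pd a (c k) p))"
    by (intro C1_add C1_sum C1_mult C1_nth f c)
  ultimately show ?thesis by simp
qed

lemma Gs_Hs_sum:
  "(\<Sum>k\<in>Gs N \<inter> B. f k) + (\<Sum>k\<in>Hs N \<inter> B. f k) = (\<Sum>k\<in>cons N \<inter> B. f k)"
  using kind_partition(3)[of N] by (subst sum.union_disjoint[symmetric]) (auto simp: Int_Un_distrib2)

lemma local_Lagrangian_eq:
  "local_Lagrangian N i = Lagrange_sum (con N) (obj N i) (cons N \<inter> own N i)"
  by (auto simp: local_Lagrangian_def Lagrange_sum_def Gs_Hs_sum add.assoc)

lemma Lagrangian_eq: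
  "Lagrangian N = Lagrange_sum (con N) (\<lambda>p. \<Sum>i\<in>UNIV. obj N i p) (cons N)"
proof
  fix p
  have "(\<Sum>i\<in>UNIV. \<Sum>k\<in>cons N \<inter> own N i. p $ k * con N k p) = (\<Sum>k\<in>cons N. p $ k * con N k p)"
    using sum.group[of "cons N" UNIV "owner N" "\<lambda>k. p $ k * con N k p"]
    by (simp add: own_def Int_def)
  then show "Lagrangian N p = Lagrange_sum (con N) (\<lambda>p. \<Sum>i\<in>UNIV. obj N i p) (cons N) p"
    by (simp add: Lagrangian_def local_Lagrangian_eq Lagrange_sum_def sum.distrib)
qed

context
  fixes N :: "('v::finite, 'k::finite) nlp"
  assumes wf: "well_formed N"
begin

lemma obj_C_k: "C_k 3 (obj N i)" and con_C_k: "k \<in> cons N \<Longrightarrow> C_k 3 (con N k)"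
  using wf by (auto simp: well_formed_def)

lemmas obj_smooth = C_k_3[OF obj_C_k] and con_smooth = C_k_3[OF con_C_k]

lemma obj_depends: "depends_only_on (nbhd_vars N i) (obj N i)"
  and con_depends: "k \<in> cons N \<Longrightarrow> depends_only_on (nbhd_vars N (owner N k)) (con N k)"
  and decoupled_con_depends:
    "k \<in> cons N \<Longrightarrow> decoupled N k \<Longrightarrow> depends_only_on (vars N (owner N k)) (con N k)"
  using wf by (auto simp: well_formed_def)

lemma obj_pd_outside: "a \<notin> nbhd_vars N i \<Longrightarrow> pd a (obj N i) p = 0"
  by (rule pd_outside_support[OF obj_depends obj_smooth(1)])

lemma con_pd_outside: "k \<in> cons N \<Longrightarrow> a \<notin> nbhd_vars N (owner N k) \<Longrightarrow> pd a (con N k) p = 0"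
  by (rule pd_outside_support[OF con_depends con_smooth(1)])

lemma decoupled_con_pd_outside:
  "k \<in> cons N \<Longrightarrow> decoupled N k \<Longrightarrow> a \<notin> vars N (owner N k) \<Longrightarrow> pd a (con N k) p = 0"
  by (rule pd_outside_support[OF decoupled_con_depends con_smooth(1)])

lemma con_pd_multiplier: "k \<in> cons N \<Longrightarrow> a \<notin> Xs N \<Longrightarrow> pd a (con N k) p = 0"
  by (rule con_pd_outside) (auto simp: nbhd_vars_def)

lemma obj_pd_pd_multiplier: "b \<notin> Xs N \<Longrightarrow> pd b (pd a (obj N i)) p = 0"
proof (rule pd_outside_support)
  show "depends_only_on (nbhd_vars N i) (pd a (obj N i))"
    by (rule depends_only_on_pd[OF obj_depends obj_smooth(1)])
qed (auto simp: obj_smooth nbhd_vars_def)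

lemma con_pd_pd_multiplier: "k \<in> cons N \<Longrightarrow> b \<notin> Xs N \<Longrightarrow> pd b (pd a (con N k)) p = 0"
proof (rule pd_outside_support)
  assume k: "k \<in> cons N"
  show "depends_only_on (nbhd_vars N (owner N k)) (pd a (con N k))"
    by (rule depends_only_on_pd[OF con_depends[OF k] con_smooth(1)[OF k]])
qed (auto simp: con_smooth nbhd_vars_def)

lemma local_Lagrangian_pd:
  assumes "a \<in> Xs N"
  shows "pd a (local_Lagrangian N i) p
    = pd a (obj N i) p + (\<Sum>k\<in>cons N \<inter> own N i. p $ k * pd a (con N k) p)"
  using assms kind_partition[of N] obj_smooth(1) con_smooth(1) unfolding local_Lagrangian_eq
  by (subst Lagrange_sum_pd(1)) auto

lemma local_Lagrangian_C1_pd: "a \<in> Xs N \<Longrightarrow> C1 (pd a (local_Lagrangian N i))"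
  unfolding local_Lagrangian_eq
  using kind_partition[of N] obj_smooth con_smooth by (intro Lagrange_sum_C1_pd) auto

lemma local_Lagrangian_hessian:
  assumes "a \<in> Xs N" "b \<in> Xs N"
  shows "hessian (local_Lagrangian N i) p $ a $ b
    = pd b (pd a (obj N i)) p + (\<Sum>k\<in>cons N \<inter> own N i. p $ k * pd b (pd a (con N k)) p)"
proof -
  have "b \<notin> cons N" "a \<notin> cons N" using assms kind_partition[of N] by auto
  then show ?thesis
    unfolding local_Lagrangian_eq hessian_def vec_lambda_beta
    by (subst Lagrange_sum_hessian) (auto simp: obj_smooth con_smooth)
qed

lemma local_Lagrangian_differentiable: "local_Lagrangian N i differentiable (at p)"
  unfolding local_Lagrangian_eq
  using obj_smooth con_smooth by (intro Lagrange_sum_pd(2)) auto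

lemma Lagrangian_pd: "pd a (Lagrangian N) p = (\<Sum>i\<in>UNIV. pd a (local_Lagrangian N i) p)"
  unfolding Lagrangian_def[abs_def]
  by (rule differentiable_sum_pd(2)) (rule local_Lagrangian_differentiable)

lemma Lagrangian_pd_has_derivative:
  assumes "a \<in> Xs N"
  shows "(pd a (Lagrangian N) has_derivative (\<lambda>e. (hessian (Lagrangian N) p *v e) $ a)) (at p)"
proof -
  have "pd a (Lagrangian N) = (\<lambda>p. \<Sum>i\<in>UNIV. pd a (local_Lagrangian N i) p)"
    using Lagrangian_pd by auto
  moreover have "C1 (\<lambda>p. \<Sum>i\<in>UNIV. pd a (local_Lagrangian N i) p)"
    by (intro C1_sum local_Lagrangian_C1_pd assms)
  ultimately have "C1 (pd a (Lagrangian N))" by simp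
  then have "pd a (Lagrangian N) differentiable (at p)"
    using C1_has_derivative by (auto simp: differentiable_def)
  from has_derivative_pd[OF this] show ?thesis
    by (simp add: hessian_def matrix_vector_mult_def)
qed

lemma Lagrangian_hessian_multiplier:
  assumes "a \<in> Xs N" "k \<in> cons N"
  shows "hessian (Lagrangian N) p $ a $ k = pd a (con N k) p"
proof -
  have pd1: "pd a (\<lambda>p. \<Sum>i\<in>UNIV. obj N i p) = (\<lambda>p. \<Sum>i\<in>UNIV. pd a (obj N i) p)"
    by (rule ext) (rule differentiable_sum_pd(2)[OF obj_smooth(1)])
  have k: "k \<notin> Xs N" using assms(2) kind_partition[of N] by auto
  have a: "a \<notin> cons N" using assms(1) kind_partition[of N] by auto
  have "hessian (Lagrangian N) p $ a $ k = pd k (pd a (\<lambda>p. \<Sum>i\<in>UNIV. obj N i p)) p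
      + (\<Sum>j\<in>cons N. p $ j * pd k (pd a (con N j)) p) + (if k \<in> cons N then pd a (con N k) p else 0)"
    unfolding Lagrangian_eq hessian_def vec_lambda_beta
    by (rule Lagrange_sum_hessian)
      (use a obj_smooth con_smooth in \<open>auto simp: pd1 intro!: differentiable_sum_pd(1)\<close>)
  moreover have "pd k (pd a (\<lambda>p. \<Sum>i\<in>UNIV. obj N i p)) p = 0"
    unfolding pd1 by (simp add: differentiable_sum_pd(2) obj_smooth obj_pd_pd_multiplier[OF k])
  ultimately show ?thesis using assms(2) k by (simp add: con_pd_pd_multiplier)
qed

text \<open>
  The derivative of \<open>\<nabla>\<^sub>x L\<close> with respect to all of \<open>p\<close> consists of the Hessian in \<open>x\<close> and the transposed
  constraint Jacobian.
\<close>

lemma Lagrangian_hessian_apply: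
  assumes "a \<in> Xs N"
  shows "(hessian (Lagrangian N) p *v e) $ a
    = (hessian (Lagrangian N) p *v proj (Xs N) e) $ a + (\<Sum>k\<in>cons N. e $ k * pd a (con N k) p)"
proof -
  have "(hessian (Lagrangian N) p *v e) $ a
      = (\<Sum>b\<in>Xs N \<union> cons N. hessian (Lagrangian N) p $ a $ b * e $ b)"
    using kind_partition(4)[of N] by (simp add: matrix_vector_mult_def Un_assoc)
  also have "\<dots> = (\<Sum>b\<in>Xs N. hessian (Lagrangian N) p $ a $ b * e $ b)
      + (\<Sum>b\<in>cons N. hessian (Lagrangian N) p $ a $ b * e $ b)"
    using kind_partition[of N] by (intro sum.union_disjoint) auto
  also have "(\<Sum>b\<in>Xs N. hessian (Lagrangian N) p $ a $ b * e $ b)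
      = (hessian (Lagrangian N) p *v proj (Xs N) e) $ a"
    unfolding matrix_vector_mult_def by (auto intro!: sum.mono_neutral_cong_left)
  also have "(\<Sum>b\<in>cons N. hessian (Lagrangian N) p $ a $ b * e $ b)
      = (\<Sum>k\<in>cons N. e $ k * pd a (con N k) p)"
    by (rule sum.cong) (use Lagrangian_hessian_multiplier[OF assms] in \<open>auto simp: mult.commute\<close>)
  finally show ?thesis .
qed

section \<open>The residual of the local KKT systems\<close>

lemma linear_shift: "linear (\<lambda>z. shift N i (fst z) (snd z))"
  by (rule linearI) (simp_all add: shift_def vec_eq_iff algebra_simps)

lemma shift_has_derivative: "((\<lambda>y. shift N i p y) has_derivative proj (vars N i)) (at y)"
proof -
  have "shift N i p = (\<lambda>y. p + proj (vars N i) y)" by (auto simp: shift_def vec_eq_iff)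
  moreover have "((\<lambda>y. p + proj (vars N i) y) has_derivative (\<lambda>y. 0 + proj (vars N i) y)) (at y)"
    by (intro has_derivative_add has_derivative_const bounded_linear_imp_has_derivative)
      (simp add: linear_conv_bounded_linear[symmetric] linear_proj)
  ultimately show ?thesis by simp
qed

lemma comp_shift_has_derivative:
  assumes "F differentiable (at (shift N i p y))"
  shows "((\<lambda>y. F (shift N i p y)) has_derivative
    (\<lambda>w. \<Sum>b\<in>vars N i. pd b F (shift N i p y) * w $ b)) (at y)"
proof -
  have "(\<Sum>b\<in>UNIV. pd b F (shift N i p y) * proj (vars N i) w $ b)
      = (\<Sum>b\<in>vars N i. pd b F (shift N i p y) * w $ b)" for w
    by (rule sum.mono_neutral_cong_right) auto
  then show ?thesis
    using has_derivative_compose[OF shift_has_derivative has_derivative_pd[OF assms]] by simp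
qed

lemma local_con_pd:
  assumes "k \<in> cons N"
  shows "pd a (local_con N p k) y
    = (if a \<in> vars N (owner N k) then pd a (con N k) (shift N (owner N k) p y) else 0)"
  unfolding local_con_def[abs_def]
  by (subst pd_eq[OF comp_shift_has_derivative[OF con_smooth(1)[OF assms]]]) (simp add: sum_axis)

lemma local_NLP_Lagrangian_pd:
  assumes a: "a \<in> vars N i"
  shows "pd a (local_NLP_Lagrangian N \<rho> p i) y = pd a (obj N i) (shift N i p y) + \<rho> i * y $ a
    + (\<Sum>j\<in>nbrs N i. pd a (local_Lagrangian N j) p)
    + (\<Sum>k\<in>cons N \<inter> own N i. y $ k * pd a (con N k) (shift N i p y))"
proof -
  let ?u = "shift N i p y"
  have eq: "local_NLP_Lagrangian N \<rho> p i = (\<lambda>y. obj N i (shift N i p y)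
     + \<rho> i / 2 * (\<Sum>a\<in>vars N i. y $ a * y $ a)
     + (\<Sum>j\<in>nbrs N i. \<Sum>a\<in>vars N i. pd a (local_Lagrangian N j) p * y $ a)
     + (\<Sum>k\<in>cons N \<inter> own N i. y $ k * con N k (shift N i p y)))"
  proof
    fix y
    have "(\<Sum>k\<in>cons N \<inter> own N i. y $ k * local_con N p k y)
        = (\<Sum>k\<in>cons N \<inter> own N i. y $ k * con N k (shift N i p y))"
      by (rule sum.cong) (auto simp: local_con_def own_def)
    then show "local_NLP_Lagrangian N \<rho> p i y = obj N i (shift N i p y)
     + \<rho> i / 2 * (\<Sum>a\<in>vars N i. y $ a * y $ a)
     + (\<Sum>j\<in>nbrs N i. \<Sum>a\<in>vars N i. pd a (local_Lagrangian N j) p * y $ a)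
     + (\<Sum>k\<in>cons N \<inter> own N i. y $ k * con N k (shift N i p y))"
      unfolding local_NLP_Lagrangian_def local_obj_def
      by (simp add: add.assoc Gs_Hs_sum power2_eq_square)
  qed
  have nth: "((\<lambda>y. y $ k) has_derivative (\<lambda>w. w $ k)) (at y)" for k
    by (rule bounded_linear_imp_has_derivative[OF bounded_linear_vec_nth])
  have d: "(local_NLP_Lagrangian N \<rho> p i has_derivative (\<lambda>w. (\<Sum>b\<in>vars N i. pd b (obj N i) ?u * w $ b)
     + \<rho> i / 2 * (\<Sum>b\<in>vars N i. y $ b * w $ b + w $ b * y $ b)
     + (\<Sum>j\<in>nbrs N i. \<Sum>b\<in>vars N i. pd b (local_Lagrangian N j) p * w $ b)
     + (\<Sum>k\<in>cons N \<inter> own N i. y $ k * (\<Sum>b\<in>vars N i. pd b (con N k) ?u * w $ b)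
         + w $ k * con N k ?u))) (at y)"
    unfolding eq
    by (intro has_derivative_add has_derivative_sum has_derivative_mult has_derivative_mult_right nth
        comp_shift_has_derivative obj_smooth con_smooth) auto
  have aK: "a \<notin> cons N" using a kind_partition[of N] by auto
  have 1: "(\<Sum>b\<in>vars N i. y $ b * axis a 1 $ b + axis a 1 $ b * y $ b) = 2 * y $ a"
  proof -
    have "(\<Sum>b\<in>vars N i. y $ b * axis a 1 $ b + axis a 1 $ b * y $ b)
        = (\<Sum>b\<in>vars N i. (2 * y $ b) * axis a 1 $ b)"
      by (rule sum.cong) simp_all
    also have "\<dots> = 2 * y $ a" unfolding sum_axis using a by simp
    finally show ?thesis .
  qed
  have 2: "(\<Sum>k\<in>cons N \<inter> own N i. axis a 1 $ k * con N k ?u) = 0"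
    by (rule sum.neutral) (use aK in \<open>auto simp: axis_def\<close>)
  show ?thesis
    by (subst pd_eq[OF d]) (simp only: 1 sum_axis, simp only: sum.distrib 2, use a in simp)
qed

lemma local_NLP_Lagrangian_pd_has_derivative:
  assumes a: "a \<in> vars N i"
  shows "(pd a (local_NLP_Lagrangian N \<rho> p i) has_derivative
     (\<lambda>w. \<Sum>b\<in>UNIV. pd b (pd a (local_NLP_Lagrangian N \<rho> p i)) y * w $ b)) (at y)"
    (is ?der)
    and "pd b (pd a (local_NLP_Lagrangian N \<rho> p i)) y =
      (if b \<in> vars N i then pd b (pd a (obj N i)) (shift N i p y)
         + (\<Sum>k\<in>cons N \<inter> own N i. y $ k * pd b (pd a (con N k)) (shift N i p y)) else 0)
      + (if b = a then \<rho> i else 0)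
      + (if b \<in> cons N \<inter> own N i then pd a (con N b) (shift N i p y) else 0)"
    (is ?hess)
proof -
  let ?u = "shift N i p y"
  have eq: "pd a (local_NLP_Lagrangian N \<rho> p i) = (\<lambda>y. pd a (obj N i) (shift N i p y) + \<rho> i * y $ a
    + (\<Sum>j\<in>nbrs N i. pd a (local_Lagrangian N j) p)
    + (\<Sum>k\<in>cons N \<inter> own N i. y $ k * pd a (con N k) (shift N i p y)))"
    using local_NLP_Lagrangian_pd[OF a] by auto
  have nth: "((\<lambda>y. y $ k) has_derivative (\<lambda>w. w $ k)) (at y)" for k
    by (rule bounded_linear_imp_has_derivative[OF bounded_linear_vec_nth])
  have d: "(pd a (local_NLP_Lagrangian N \<rho> p i) has_derivative
     (\<lambda>w. (\<Sum>b\<in>vars N i. pd b (pd a (obj N i)) ?u * w $ b) + \<rho> i * w $ a + 0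
     + (\<Sum>k\<in>cons N \<inter> own N i. y $ k * (\<Sum>b\<in>vars N i. pd b (pd a (con N k)) ?u * w $ b)
         + w $ k * pd a (con N k) ?u))) (at y)"
    unfolding eq
    by (intro has_derivative_add has_derivative_sum has_derivative_mult has_derivative_mult_right nth
        has_derivative_const comp_shift_has_derivative obj_smooth con_smooth) auto
  then have "pd a (local_NLP_Lagrangian N \<rho> p i) differentiable (at y)"
    by (auto simp: differentiable_def)
  then show ?der by (rule has_derivative_pd)
  have 1: "(\<Sum>k\<in>cons N \<inter> own N i. axis b 1 $ k * pd a (con N k) ?u)
      = (if b \<in> cons N \<inter> own N i then pd a (con N b) ?u else 0)"
    using sum_axis[of "\<lambda>k. pd a (con N k) ?u" b "cons N \<inter> own N i"] by (simp add: mult.commute)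
  have 2: "\<rho> i * axis b 1 $ a = (if b = a then \<rho> i else 0)" by (auto simp: axis_def)
  show ?hess
    by (subst pd_eq[OF d]) (simp only: sum_axis sum.distrib 1 2, auto intro: sum.neutral)
qed

text \<open>
  Complementarity enters only through the products of multipliers and constraint values, which makes
  the residual differentiable; the inequalities are recovered near \<open>p\<^sup>*\<close> from strict complementarity.
\<close>

definition residual :: "('v \<Rightarrow> real) \<Rightarrow> (real^'k) \<times> (real^'k) \<Rightarrow> real^'k" where
  "residual \<rho> z = (\<chi> a. case kind N a of
       Primal \<Rightarrow> pd a (local_NLP_Lagrangian N \<rho> (fst z) (owner N a)) (snd z)
     | EqCon \<Rightarrow> local_con N (fst z) a (snd z)
     | IneqCon \<Rightarrow> snd z $ a * local_con N (fst z) a (snd z))"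

lemma residual_nth:
  "a \<in> Xs N \<Longrightarrow> residual \<rho> z $ a = pd a (local_NLP_Lagrangian N \<rho> (fst z) (owner N a)) (snd z)"
  "a \<in> Gs N \<Longrightarrow> residual \<rho> z $ a = local_con N (fst z) a (snd z)"
  "a \<in> Hs N \<Longrightarrow> residual \<rho> z $ a = snd z $ a * local_con N (fst z) a (snd z)"
  by (auto simp: residual_def Xs_def Gs_def Hs_def)

lemma own_vars: "a \<in> Xs N \<Longrightarrow> a \<in> vars N (owner N a)"
  by (simp add: own_def)

lemma kind_cases:
  obtains "a \<in> Xs N" | "a \<in> Gs N" | "a \<in> Hs N"
  using kind_partition(4)[of N] by blast

lemma C1_snd_nth: "C1 (\<lambda>z. snd z $ a)"
  by (rule C1_linear)
    (simp add: bounded_linear.linear bounded_linear_compose[OF bounded_linear_vec_nth bounded_linear_snd])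

lemma C1_comp_shift: "C1 F \<Longrightarrow> C1 (\<lambda>z. F (shift N i (fst z) (snd z)))"
  by (rule C1_compose[OF _ C1_linear[OF linear_shift]])

lemma C1_comp_fst: "C1 F \<Longrightarrow> C1 (\<lambda>z. F (fst z))"
  by (rule C1_compose[OF _ C1_linear]) (auto simp: bounded_linear.linear bounded_linear_fst)

lemma residual_C1: "C1 (residual \<rho>)"
proof (rule C1_vec)
  fix a
  show "C1 (\<lambda>z. residual \<rho> z $ a)"
  proof (cases rule: kind_cases[of a])
    case 1
    then show ?thesis
      by (simp only: residual_nth local_NLP_Lagrangian_pd[OF own_vars])
        (intro C1_add C1_sum C1_mult C1_const C1_snd_nth C1_comp_shift C1_comp_fst
            local_Lagrangian_C1_pd obj_smooth con_smooth; auto)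
  next
    case 2
    then show ?thesis
      by (simp only: residual_nth local_con_def) (intro C1_comp_shift con_smooth; auto)
  next
    case 3
    then show ?thesis
      by (simp only: residual_nth local_con_def) (intro C1_mult C1_snd_nth C1_comp_shift con_smooth; auto)
  qed
qed

lemma P_mat_entry:
  "P_mat N \<rho> \<beta> p y $ a $ b =
    (if a \<in> Xs N then pd b (pd a (local_NLP_Lagrangian N \<rho> p (owner N a))) y
     else if a \<in> Gs N then - \<beta> * pd b (local_con N p a) y
     else - \<beta> * (y $ a * pd b (local_con N p a) y) + (if b = a then - \<beta> * local_con N p a y else 0))"
proof -
  note Xs_def [simp] Gs_def [simp] Hs_def [simp] own_def [simp]
  consider "kind N a = Primal" | "kind N a = EqCon" | "kind N a = IneqCon"
    using component_kind.exhaust by blast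
  then show ?thesis
  proof cases
    case 1
    have b: "kind N b = Primal \<or> kind N b = EqCon \<or> kind N b = IneqCon"
      using component_kind.exhaust by blast
    show ?thesis
      using 1 b local_NLP_Lagrangian_pd_has_derivative(2)[where a=a and i="owner N a" and b=b]
      by (auto simp: P_mat_def hessian_def local_con_pd)
  next
    case 2
    have b: "kind N b = Primal \<or> kind N b = EqCon \<or> kind N b = IneqCon"
      using component_kind.exhaust by blast
    show ?thesis using 2 b by (auto simp: P_mat_def local_con_pd)
  next
    case 3
    have b: "kind N b = Primal \<or> kind N b = EqCon \<or> kind N b = IneqCon"
      using component_kind.exhaust by blast
    show ?thesis using 3 b by (auto simp: P_mat_def local_con_pd)
  qed
qed

text \<open>
  The matrix \<open>P\<close> is the Jacobian of the residual in \<open>y\<close>, with the rows of the multipliers multiplied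
  by \<open>- \<beta>\<close>. Hence the linearization of \<open>P (\<Phi>(p) - d(p))\<close> can be computed from
  \<open>K(p, \<Phi>(p)) = 0\<close>, where \<open>K\<close> is the residual.
\<close>

lemma P_mat_residual:
  "((\<lambda>y. (if a \<in> Xs N then 1 else - \<beta>) * residual \<rho> (p, y) $ a)
     has_derivative (\<lambda>w. (P_mat N \<rho> \<beta> p y *v w) $ a)) (at y)"
proof -
  have con: "((\<lambda>y. local_con N p a y) has_derivative (\<lambda>w. \<Sum>b\<in>UNIV. pd b (local_con N p a) y * w $ b)) (at y)"
    if "a \<in> cons N"
  proof (rule has_derivative_pd)
    show "local_con N p a differentiable (at y)"
      using comp_shift_has_derivative[OF con_smooth(1)[OF that]]
      unfolding local_con_def[abs_def] differentiable_def by blast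
  qed
  have nth: "((\<lambda>y. y $ a) has_derivative (\<lambda>w. w $ a)) (at y)"
    by (rule bounded_linear_imp_has_derivative[OF bounded_linear_vec_nth])
  show ?thesis
  proof (cases rule: kind_cases[of a])
    case 1
    have "(P_mat N \<rho> \<beta> p y *v w) $ a
        = (\<Sum>b\<in>UNIV. pd b (pd a (local_NLP_Lagrangian N \<rho> p (owner N a))) y * w $ b)" for w
      using 1 by (simp add: matrix_vector_mult_def P_mat_entry)
    then show ?thesis
      using 1 local_NLP_Lagrangian_pd_has_derivative(1)[OF own_vars[OF 1]] by (simp add: residual_nth)
  next
    case 2
    then have "a \<notin> Xs N" using kind_partition[of N] by auto
    then have P: "(P_mat N \<rho> \<beta> p y *v w) $ a
        = - \<beta> * (\<Sum>b\<in>UNIV. pd b (local_con N p a) y * w $ b)" for w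
      using 2 by (simp add: matrix_vector_mult_def P_mat_entry sum_distrib_left mult.assoc sum_negf)
    show ?thesis
      unfolding P using 2 \<open>a \<notin> Xs N\<close> con
      by (simp only: residual_nth if_False fst_conv snd_conv) (intro has_derivative_mult_right; simp)
  next
    case 3
    then have a: "a \<notin> Xs N" "a \<notin> Gs N" using kind_partition[of N] by auto
    have P: "(P_mat N \<rho> \<beta> p y *v w) $ a
        = - \<beta> * (y $ a * (\<Sum>b\<in>UNIV. pd b (local_con N p a) y * w $ b) + w $ a * local_con N p a y)" for w
    proof -
      have "(P_mat N \<rho> \<beta> p y *v w) $ a = (\<Sum>b\<in>UNIV. - \<beta> * (y $ a * (pd b (local_con N p a) y * w $ b))
          + (if b = a then - \<beta> * (w $ a * local_con N p a y) else 0))"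
        unfolding matrix_vector_mult_def vec_lambda_beta
        by (rule sum.cong) (auto simp: P_mat_entry a algebra_simps)
      then show ?thesis
        by (simp only: sum.distrib sum_distrib_left[symmetric] sum.delta' finite UNIV_I if_True)
          (simp add: algebra_simps)
    qed
    show ?thesis
      unfolding P using 3 a con
      by (simp only: residual_nth if_False fst_conv snd_conv)
        (intro has_derivative_mult_right has_derivative_mult nth; simp)
  qed
qed

lemma continuous_on_comp_shift:
  "continuous_on UNIV F \<Longrightarrow> continuous_on UNIV (\<lambda>z. F (shift N i (fst z) (snd z)))"
  by (rule continuous_on_compose2[OF _ C1_continuous[OF C1_linear[OF linear_shift]]]) auto

lemma pd_con_shift_continuous:
  "k \<in> cons N \<Longrightarrow> continuous_on UNIV (\<lambda>z. pd a (con N k) (shift N i (fst z) (snd z)))"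
  by (intro continuous_on_comp_shift C1_continuous con_smooth)

lemma P_mat_continuous: "continuous_on UNIV (\<lambda>z. P_mat N \<rho> \<beta> (fst z) (snd z) $ a $ b)"
proof -
  have nth: "continuous_on UNIV (\<lambda>z::(real^'k) \<times> (real^'k). snd z $ k)" for k
    by (rule C1_continuous[OF C1_snd_nth])
  have loc: "continuous_on UNIV (\<lambda>z. local_con N (fst z) a (snd z))" if "a \<in> cons N"
    unfolding local_con_def by (intro continuous_on_comp_shift C1_continuous con_smooth that)
  have pdloc: "continuous_on UNIV (\<lambda>z. pd b (local_con N (fst z) a) (snd z))" if "a \<in> cons N"
    unfolding local_con_pd[OF that]
    by (cases "b \<in> vars N (owner N a)")
      (simp_all only: if_True if_False continuous_on_const continuous_on_comp_shift
        C1_continuous con_smooth that)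
  show ?thesis
  proof (cases rule: kind_cases[of a])
    case 1
    have c1: "continuous_on UNIV (\<lambda>z. if b \<in> vars N i then pd b (pd a (obj N i)) (shift N i (fst z) (snd z))
         + (\<Sum>k\<in>cons N \<inter> own N i. snd z $ k * pd b (pd a (con N k)) (shift N i (fst z) (snd z))) else 0)" for i
      by (cases "b \<in> vars N i")
        (simp_all, intro continuous_on_add continuous_on_sum continuous_on_mult nth
          continuous_on_comp_shift obj_smooth con_smooth, auto)
    have c2: "continuous_on UNIV (\<lambda>z. if b \<in> cons N \<inter> own N i then pd a (con N b) (shift N i (fst z) (snd z)) else 0)" for i
      by (cases "b \<in> cons N \<inter> own N i")
        (simp_all only: if_True if_False continuous_on_const, auto intro!: pd_con_shift_continuous)
    show ?thesis
      unfolding P_mat_entry using 1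
      by (simp only: if_True local_NLP_Lagrangian_pd_has_derivative(2)[OF own_vars])
        (intro continuous_on_add c1 c2 continuous_on_const)
  next
    case 2
    then have "a \<notin> Xs N" using kind_partition[of N] by auto
    then show ?thesis
      unfolding P_mat_entry using 2 by (simp only: if_False if_True)
        (intro continuous_on_mult continuous_on_const pdloc; simp)
  next
    case 3
    then have a: "a \<notin> Xs N" "a \<notin> Gs N" using kind_partition[of N] by auto
    have "continuous_on UNIV (\<lambda>z. if b = a then - \<beta> * local_con N (fst z) a (snd z) else 0)"
      using 3 by (cases "b = a") (auto intro!: continuous_on_mult continuous_on_const continuous_on_minus loc)
    then show ?thesis
      unfolding P_mat_entry using a 3 by (simp only: if_False)
        (intro continuous_on_add continuous_on_mult continuous_on_const nth pdloc; simp)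
  qed
qed

lemma S_mat_continuous: "continuous_on UNIV (\<lambda>z. S_mat N (fst z) (snd z) $ a $ b)"
proof -
  have nth: "continuous_on UNIV (\<lambda>z::(real^'k) \<times> (real^'k). snd z $ k)" for k
    by (rule C1_continuous[OF C1_snd_nth])
  show ?thesis
  proof (cases "a \<in> Xs N \<and> b \<in> Xs N \<and> owner N a = owner N b")
    case True
    show ?thesis
      unfolding S_mat_def vec_lambda_beta Let_def if_P[OF True]
      by (intro continuous_on_add continuous_on_sum continuous_on_mult
        continuous_on_power nth pd_con_shift_continuous; auto)
  next
    case False
    show ?thesis
      unfolding S_mat_def vec_lambda_beta Let_def if_not_P[OF False] by (rule continuous_on_const)
  qed
qed

section \<open>Linearization at the KKT point\<close>

lemma shift_dvec [simp]: "shift N i p (dvec N p) = p"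
  by (simp add: shift_def dvec_def vec_eq_iff)

lemma dvec_cons [simp]: "k \<in> cons N \<Longrightarrow> dvec N p $ k = p $ k"
  using kind_partition[of N] by (auto simp: dvec_def)

lemma linear_dvec: "linear (dvec N)"
  by (rule linearI) (simp_all add: dvec_def vec_eq_iff)

text \<open>
  At \<open>y = d(p)\<close>, where \<open>s = 0\<close>, the local residuals assemble to the central KKT residual. The linear term
  of agent \<open>i\<close> supplies the gradients of the neighbouring Lagrangians, and since the graph is undirected
  no other agent's Lagrangian depends on \<open>x\<^sub>i\<close>.
\<close>

lemma residual_dvec:
  "a \<in> Xs N \<Longrightarrow> residual \<rho> (p, dvec N p) $ a = pd a (Lagrangian N) p"
  "a \<in> Gs N \<Longrightarrow> residual \<rho> (p, dvec N p) $ a = con N a p"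
  "a \<in> Hs N \<Longrightarrow> residual \<rho> (p, dvec N p) $ a = p $ a * con N a p"
proof -
  assume a: "a \<in> Xs N"
  let ?i = "owner N a"
  have other: "pd a (local_Lagrangian N j) p = 0" if "j \<notin> insert ?i (nbrs N ?i)" for j
  proof -
    have "sym (edges N)" using wf by (simp add: well_formed_def)
    then have "?i \<notin> insert j (nbrs N j)" using that by (auto simp: nbrs_def dest: symD)
    then have "a \<notin> nbhd_vars N j" by (auto simp: nbhd_vars_def own_def)
    then show ?thesis
      using a by (auto simp: local_Lagrangian_pd obj_pd_outside con_pd_outside own_def intro!: sum.neutral)
  qed
  have "dvec N p $ a = 0" using a by (simp add: dvec_def)
  moreover have "(\<Sum>k\<in>cons N \<inter> own N ?i. dvec N p $ k * pd a (con N k) p)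
      = (\<Sum>k\<in>cons N \<inter> own N ?i. p $ k * pd a (con N k) p)"
    by (rule sum.cong) auto
  ultimately have "residual \<rho> (p, dvec N p) $ a
      = pd a (local_Lagrangian N ?i) p + (\<Sum>j\<in>nbrs N ?i. pd a (local_Lagrangian N j) p)"
    using a by (simp add: residual_nth local_NLP_Lagrangian_pd[OF own_vars] local_Lagrangian_pd)
  also have "\<dots> = (\<Sum>j\<in>insert ?i (nbrs N ?i). pd a (local_Lagrangian N j) p)"
    by (subst sum.insert) (auto simp: nbrs_def)
  also have "\<dots> = pd a (Lagrangian N) p"
    unfolding Lagrangian_pd by (rule sum.mono_neutral_left) (use other in auto)
  finally show "residual \<rho> (p, dvec N p) $ a = pd a (Lagrangian N) p" .
qed (simp_all add: residual_nth local_con_def)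

lemma residual_dvec_has_derivative:
  "a \<in> Xs N \<Longrightarrow> ((\<lambda>p. residual \<rho> (p, dvec N p) $ a)
     has_derivative (\<lambda>e. (hessian (Lagrangian N) p *v e) $ a)) (at p)"
  "a \<in> Gs N \<Longrightarrow> ((\<lambda>p. residual \<rho> (p, dvec N p) $ a)
     has_derivative (\<lambda>e. \<Sum>b\<in>UNIV. pd b (con N a) p * e $ b)) (at p)"
  "a \<in> Hs N \<Longrightarrow> ((\<lambda>p. residual \<rho> (p, dvec N p) $ a)
     has_derivative (\<lambda>e. p $ a * (\<Sum>b\<in>UNIV. pd b (con N a) p * e $ b) + e $ a * con N a p)) (at p)"
proof -
  show "a \<in> Xs N \<Longrightarrow> ((\<lambda>p. residual \<rho> (p, dvec N p) $ a)
     has_derivative (\<lambda>e. (hessian (Lagrangian N) p *v e) $ a)) (at p)"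
    by (simp only: residual_dvec) (rule Lagrangian_pd_has_derivative)
  show "a \<in> Gs N \<Longrightarrow> ((\<lambda>p. residual \<rho> (p, dvec N p) $ a)
     has_derivative (\<lambda>e. \<Sum>b\<in>UNIV. pd b (con N a) p * e $ b)) (at p)"
    by (simp only: residual_dvec) (intro has_derivative_pd con_smooth; simp)
  show "a \<in> Hs N \<Longrightarrow> ((\<lambda>p. residual \<rho> (p, dvec N p) $ a)
     has_derivative (\<lambda>e. p $ a * (\<Sum>b\<in>UNIV. pd b (con N a) p * e $ b) + e $ a * con N a p)) (at p)"
    by (simp only: residual_dvec)
      (intro has_derivative_mult has_derivative_pd con_smooth
        bounded_linear_imp_has_derivative bounded_linear_vec_nth; simp)
qed

end



section \<open>The algorithm near the KKT point\<close>

context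
  fixes N :: "('v::finite, 'k::finite) nlp" and \<rho> :: "'v \<Rightarrow> real" and pstar :: "real^'k"
  assumes wf: "well_formed N"
    and kkt: "KKT_point N pstar"
    and sc: "strict_complementarity N pstar"
begin

abbreviation (input) ystar :: "real^'k" where "ystar \<equiv> dvec N pstar"

definition con_grad :: "'k \<Rightarrow> real^'k" where
  "con_grad k = (\<chi> a. pd a (con N k) pstar)"

definition residual_deriv :: "(real^'k) \<times> (real^'k) \<Rightarrow> real^'k" where
  "residual_deriv = frechet_derivative (residual N \<rho>) (at (pstar, ystar))"

lemma active_con: "k \<in> active N pstar \<Longrightarrow> k \<in> Hs N \<and> con N k pstar = 0 \<and> pstar $ k > 0"
  using sc by (auto simp: strict_complementarity_def active_def)

lemma inactive_con: "k \<in> Hs N - active N pstar \<Longrightarrow> con N k pstar < 0 \<and> pstar $ k = 0"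
  using kkt by (force simp: KKT_point_def active_def)

lemma inner_con_grad: "con_grad k \<bullet> v = (\<Sum>b\<in>UNIV. pd b (con N k) pstar * v $ b)"
  by (simp add: con_grad_def inner_vec_def)

lemma residual_has_derivative: "(residual N \<rho> has_derivative residual_deriv) (at (pstar, ystar))"
  unfolding residual_deriv_def by (rule C1_has_derivative[OF residual_C1[OF wf]])

lemma residual_nth_has_derivative:
  "((\<lambda>z. residual N \<rho> z $ a) has_derivative (\<lambda>v. residual_deriv v $ a)) (at (pstar, ystar))"
  by (rule bounded_linear.has_derivative[OF bounded_linear_vec_nth residual_has_derivative])

lemma residual_star: "residual N \<rho> (pstar, ystar) = 0"
proof -
  have "residual N \<rho> (pstar, ystar) $ a = 0" for a
    using kkt by (cases rule: kind_cases[OF wf, of a]) (auto simp: residual_dvec[OF wf] KKT_point_def)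
  then show ?thesis by (simp add: vec_eq_iff)
qed

lemma P_mat_residual_deriv:
  "(P_mat N \<rho> \<beta> pstar ystar *v w) $ a = (if a \<in> Xs N then 1 else - \<beta>) * residual_deriv (0, w) $ a"
proof -
  have "((\<lambda>y. (pstar, y)) has_derivative (\<lambda>w. (0, w))) (at ystar)"
    by (intro has_derivative_Pair has_derivative_const has_derivative_ident)
  from has_derivative_mult_right[OF has_derivative_compose[OF this residual_nth_has_derivative[of a]],
      of "if a \<in> Xs N then 1 else - \<beta>"]
  have "((\<lambda>y. (if a \<in> Xs N then 1 else - \<beta>) * residual N \<rho> (pstar, y) $ a)
      has_derivative (\<lambda>w. (if a \<in> Xs N then 1 else - \<beta>) * residual_deriv (0, w) $ a)) (at ystar)" .
  from has_derivative_unique[OF P_mat_residual[OF wf] this] show ?thesis by metis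
qed

lemma residual_deriv_dvec:
  "a \<in> Xs N \<Longrightarrow> residual_deriv (e, dvec N e) $ a = (hessian (Lagrangian N) pstar *v e) $ a"
  "a \<in> Gs N \<Longrightarrow> residual_deriv (e, dvec N e) $ a = con_grad a \<bullet> e"
  "a \<in> Hs N \<Longrightarrow> residual_deriv (e, dvec N e) $ a
     = pstar $ a * (con_grad a \<bullet> e) + e $ a * con N a pstar"
proof -
  have "((\<lambda>p. (p, dvec N p)) has_derivative (\<lambda>e. (e, dvec N e))) (at pstar)"
    by (intro has_derivative_Pair has_derivative_ident bounded_linear_imp_has_derivative)
      (simp add: linear_conv_bounded_linear[symmetric] linear_dvec[OF wf])
  from has_derivative_compose[OF this residual_nth_has_derivative]
  have d: "((\<lambda>p. residual N \<rho> (p, dvec N p) $ a) has_derivative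
    (\<lambda>e. residual_deriv (e, dvec N e) $ a)) (at pstar)" for a .
  show "a \<in> Xs N \<Longrightarrow> residual_deriv (e, dvec N e) $ a = (hessian (Lagrangian N) pstar *v e) $ a"
    using has_derivative_unique[OF residual_dvec_has_derivative(1)[OF wf] d] by metis
  show "a \<in> Gs N \<Longrightarrow> residual_deriv (e, dvec N e) $ a = con_grad a \<bullet> e"
    using has_derivative_unique[OF residual_dvec_has_derivative(2)[OF wf] d] inner_con_grad by metis
  show "a \<in> Hs N \<Longrightarrow> residual_deriv (e, dvec N e) $ a
     = pstar $ a * (con_grad a \<bullet> e) + e $ a * con N a pstar"
    using has_derivative_unique[OF residual_dvec_has_derivative(3)[OF wf] d] inner_con_grad by metis
qed

lemma residual_deriv_con:
  "k \<in> Gs N \<Longrightarrow> residual_deriv (e, w) $ k = con_grad k \<bullet> shift N (owner N k) e w"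
  "k \<in> Hs N \<Longrightarrow> residual_deriv (e, w) $ k
     = pstar $ k * (con_grad k \<bullet> shift N (owner N k) e w) + w $ k * con N k pstar"
proof -
  have sh: "((\<lambda>z. shift N i (fst z) (snd z)) has_derivative (\<lambda>z. shift N i (fst z) (snd z))) (at z)" for i z
    by (intro bounded_linear_imp_has_derivative)
      (simp add: linear_conv_bounded_linear[symmetric] linear_shift[OF wf])
  have d: "((\<lambda>z. local_con N (fst z) k (snd z)) has_derivative
      (\<lambda>v. con_grad k \<bullet> shift N (owner N k) (fst v) (snd v))) (at (pstar, ystar))" if "k \<in> cons N" for k
    unfolding local_con_def inner_con_grad
    using has_derivative_compose[OF sh[of "owner N k" "(pstar, ystar)"], of "con N k"]
      has_derivative_pd[OF con_smooth(1)[OF wf that, of pstar]]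
    by (simp add: shift_dvec[OF wf])
  show "residual_deriv (e, w) $ k = con_grad k \<bullet> shift N (owner N k) e w" if k: "k \<in> Gs N"
  proof -
    have eq: "(\<lambda>z. residual N \<rho> z $ k) = (\<lambda>z. local_con N (fst z) k (snd z))"
      using residual_nth(2)[OF wf k] by auto
    have "((\<lambda>z. residual N \<rho> z $ k) has_derivative
        (\<lambda>v. con_grad k \<bullet> shift N (owner N k) (fst v) (snd v))) (at (pstar, ystar))"
      unfolding eq by (rule d) (use k in simp)
    from fun_cong[OF has_derivative_unique[OF residual_nth_has_derivative this], of "(e, w)"]
    show ?thesis by simp
  qed
  show "residual_deriv (e, w) $ k
     = pstar $ k * (con_grad k \<bullet> shift N (owner N k) e w) + w $ k * con N k pstar" if k: "k \<in> Hs N"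
  proof -
    have eq: "(\<lambda>z. residual N \<rho> z $ k) = (\<lambda>z. snd z $ k * local_con N (fst z) k (snd z))"
      using residual_nth(3)[OF wf k] by auto
    have snd: "((\<lambda>z. snd z $ k) has_derivative (\<lambda>v. snd v $ k)) (at (pstar, ystar))"
      by (intro bounded_linear_imp_has_derivative bounded_linear_compose[OF bounded_linear_vec_nth]
          bounded_linear_snd)
    have "((\<lambda>z. residual N \<rho> z $ k) has_derivative (\<lambda>v. ystar $ k * (con_grad k \<bullet> shift N (owner N k) (fst v) (snd v))
        + snd v $ k * con N k pstar)) (at (pstar, ystar))"
      unfolding eq using has_derivative_mult[OF snd d[of k]] k
      by (simp add: local_con_def shift_dvec[OF wf])
    from fun_cong[OF has_derivative_unique[OF residual_nth_has_derivative this], of "(e, w)"]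
    show ?thesis using k by (simp add: dvec_cons[OF wf])
  qed
qed

lemma residual_deriv_primal_row:
  assumes a: "a \<in> vars N i"
  shows "residual_deriv (0, w) $ a
    = ((hessian (local_Lagrangian N i) pstar + \<rho> i *\<^sub>R mat 1) *v proj (vars N i) w) $ a
      + (\<Sum>k\<in>cons N \<inter> own N i. w $ k * con_grad k $ a)"
proof -
  have i: "owner N a = i" using a by (auto simp: own_def)
  have aX: "a \<in> Xs N" using a by simp
  let ?h = "hessian (local_Lagrangian N i) pstar + \<rho> i *\<^sub>R mat 1"
  have entry: "P_mat N \<rho> 1 pstar ystar $ a $ b = (if b \<in> vars N i then ?h $ a $ b else 0)
      + (if b \<in> cons N \<inter> own N i then con_grad b $ a else 0)" for b
  proof -
    have s: "(\<Sum>k\<in>cons N \<inter> own N i. ystar $ k * X k) = (\<Sum>k\<in>cons N \<inter> own N i. pstar $ k * X k)" for X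
      by (rule sum.cong) (auto simp: dvec_cons[OF wf])
    show ?thesis
      using a i aX
      by (auto simp: P_mat_entry[OF wf] local_NLP_Lagrangian_pd_has_derivative(2)[OF wf]
          local_Lagrangian_hessian[OF wf] shift_dvec[OF wf] s mat_def con_grad_def)
  qed
  have "residual_deriv (0, w) $ a = (P_mat N \<rho> 1 pstar ystar *v w) $ a"
    using aX by (simp add: P_mat_residual_deriv)
  also have "\<dots> = (\<Sum>b\<in>UNIV. (if b \<in> vars N i then ?h $ a $ b * w $ b else 0))
      + (\<Sum>b\<in>UNIV. (if b \<in> cons N \<inter> own N i then w $ b * con_grad b $ a else 0))"
    unfolding matrix_vector_mult_def vec_lambda_beta entry sum.distrib[symmetric]
    by (rule sum.cong) (auto simp: algebra_simps)
  also have "(\<Sum>b\<in>UNIV. (if b \<in> vars N i then ?h $ a $ b * w $ b else 0)) = (?h *v proj (vars N i) w) $ a"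
    unfolding matrix_vector_mult_def vec_lambda_beta by (rule sum.cong) auto
  also have "(\<Sum>b\<in>UNIV. (if b \<in> cons N \<inter> own N i then w $ b * con_grad b $ a else 0))
      = (\<Sum>k\<in>cons N \<inter> own N i. w $ k * con_grad k $ a)"
    by (rule sum.mono_neutral_cong_right) auto
  finally show ?thesis .
qed

text \<open>
  The classical argument for nonsingular KKT matrices, agent by agent: inactive multipliers vanish
  by complementarity, testing the primal rows with the primal part gives a zero value of the positive
  definite local Hessian, and the remaining multipliers vanish by the rank condition.
\<close>

lemma residual_deriv_injective:
  assumes lc: "local_convexity N \<rho> pstar" and cc: "constraint_compatible N pstar"
    and w: "residual_deriv (0, w) = 0"
  shows "w = 0"
proof -
  have row: "residual_deriv (0, w) $ a = 0" for a using w by simp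
  have sh: "shift N i 0 w = proj (vars N i) w" for i by (simp add: shift_def vec_eq_iff)
  have inact: "w $ k = 0" if "k \<in> Hs N - active N pstar" for k
    using row[of k] residual_deriv_con(2)[of k 0 w] inactive_con[OF that] that by simp
  have act: "con_grad k \<bullet> proj (vars N (owner N k)) w = 0" if "k \<in> Gs N \<union> active N pstar" for k
    using row[of k] residual_deriv_con[of k 0 w] active_con[of k] that by (auto simp: sh)
  have own: "w $ a = 0" if "owner N a = i" for a i
  proof -
    let ?z = "proj (vars N i) w"
    let ?h = "hessian (local_Lagrangian N i) pstar + \<rho> i *\<^sub>R mat 1"
    let ?C = "cons N \<inter> own N i"
    have zero: "w $ k * (con_grad k \<bullet> ?z) = 0" if "k \<in> ?C" for k
      using inact[of k] act[of k] that by (auto simp: own_def)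
    have hz: "(?h *v ?z) $ a = - (\<Sum>k\<in>?C. w $ k * con_grad k $ a)" if "a \<in> vars N i" for a
      using row[of a] residual_deriv_primal_row[OF that, of w] by simp
    have "?z \<bullet> (?h *v ?z) = (\<Sum>a\<in>vars N i. w $ a * (?h *v ?z) $ a)"
      unfolding inner_vec_def by (rule sum.mono_neutral_cong_right) auto
    also have "\<dots> = (\<Sum>a\<in>vars N i. - (\<Sum>k\<in>?C. w $ k * (con_grad k $ a * w $ a)))"
      by (rule sum.cong) (simp_all add: hz sum_distrib_left ac_simps)
    also have "\<dots> = - (\<Sum>k\<in>?C. \<Sum>a\<in>vars N i. w $ k * (con_grad k $ a * w $ a))"
      by (simp only: sum_negf sum.swap[of _ "vars N i"])
    also have "\<dots> = - (\<Sum>k\<in>?C. w $ k * (con_grad k \<bullet> ?z))"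
    proof -
      have "(\<Sum>a\<in>vars N i. con_grad k $ a * w $ a) = con_grad k \<bullet> ?z" for k
        unfolding inner_vec_def by (rule sum.mono_neutral_cong_left) auto
      then show ?thesis by (simp add: sum_distrib_left[symmetric])
    qed
    also have "\<dots> = 0" unfolding neg_equal_0_iff_equal by (rule sum.neutral) (use zero in blast)
    finally have "\<not> ?z \<bullet> (?h *v ?z) > 0" by simp
    then have z0: "?z = 0"
      using lc supported_on_proj[of "vars N i" w] unfolding local_convexity_def pos_def_block_def by blast
    let ?A = "(Gs N \<union> active N pstar) \<inter> own N i"
    have "proj ?A w = 0"
    proof (rule full_column_rank_independent)
      show "full_column_rank (vars N i) ?A (con_gradients N pstar)"
        using cc by (simp add: constraint_compatible_def)
      show "supported_on ?A (proj ?A w)" by (rule supported_on_proj)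
      fix a assume a: "a \<in> vars N i"
      have "(\<Sum>k\<in>?A. con_gradients N pstar $ a $ k * proj ?A w $ k) = (\<Sum>k\<in>?C. w $ k * con_grad k $ a)"
        by (rule sum.mono_neutral_cong_left)
          (use inact in \<open>auto simp: con_gradients_def con_grad_def active_def mult.commute\<close>)
      also have "\<dots> = 0" using hz[OF a] by (simp add: z0)
      finally show "(\<Sum>k\<in>?A. con_gradients N pstar $ a $ k * proj ?A w $ k) = 0" .
    qed
    then have A0: "w $ k = 0" if "k \<in> ?A" for k using that by (metis proj_nth zero_index)
    have X0: "w $ k = 0" if "k \<in> vars N i" for k using that z0 by (metis proj_nth zero_index)
    show ?thesis
      using that A0[of a] X0[of a] inact[of a]
      by (cases rule: kind_cases[OF wf, of a]) (auto simp: own_def)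
  qed
  then show ?thesis by (simp add: vec_eq_iff)
qed

text \<open>
  In a neighbourhood the active multipliers stay positive and the inactive constraints stay
  negative, so a vanishing product \<open>\<kappa>\<^sub>k h\<^sub>k\<close> determines which factor is zero.
\<close>

lemma local_KKT_iff_residual:
  obtains e0 where "e0 > 0"
    "\<And>p y. p \<in> ball pstar e0 \<Longrightarrow> y \<in> ball ystar e0 \<Longrightarrow>
      (\<forall>i. local_KKT N \<rho> p i y) \<longleftrightarrow> residual N \<rho> (p, y) = 0"
proof -
  define Z where "Z = (\<Inter>k\<in>active N pstar. {z::(real^'k) \<times> (real^'k). 0 < snd z $ k})
    \<inter> (\<Inter>k\<in>Hs N - active N pstar. {z. local_con N (fst z) k (snd z) < 0})"
  have "open Z" unfolding Z_def
  proof (intro open_Int open_INT ballI)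
    show "open {z::(real^'k) \<times> (real^'k). 0 < snd z $ k}" for k
      by (intro open_Collect_less continuous_intros)
    show "open {z. local_con N (fst z) k (snd z) < 0}" if "k \<in> Hs N - active N pstar" for k
    proof (intro open_Collect_less continuous_on_const)
      show "continuous_on UNIV (\<lambda>z. local_con N (fst z) k (snd z))"
        unfolding local_con_def
        by (intro continuous_on_comp_shift[OF wf] C1_continuous con_smooth[OF wf]) (use that in auto)
    qed
  qed auto
  moreover have "(pstar, ystar) \<in> Z"
    using active_con inactive_con
    by (auto simp: Z_def local_con_def shift_dvec[OF wf] dvec_cons[OF wf])
  ultimately obtain A B where AB: "open A" "open B" "pstar \<in> A" "ystar \<in> B" "A \<times> B \<subseteq> Z"
    using open_prod_elim[of Z "(pstar, ystar)"] by (metis mem_Sigma_iff)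
  obtain e1 e2 where e12: "e1 > 0" "ball pstar e1 \<subseteq> A" "e2 > 0" "ball ystar e2 \<subseteq> B"
    using AB by (meson open_contains_ball)
  show ?thesis
  proof (rule that[of "min e1 e2"])
    show "min e1 e2 > 0" using e12 by simp
    fix p y assume "p \<in> ball pstar (min e1 e2)" "y \<in> ball ystar (min e1 e2)"
    then have "p \<in> A" "y \<in> B" using e12 by auto
    then have Z: "(p, y) \<in> Z" using AB by auto
    have iff: "local_con N p k y \<le> 0 \<and> y $ k \<ge> 0 \<and> y $ k * local_con N p k y = 0
        \<longleftrightarrow> y $ k * local_con N p k y = 0" if "k \<in> Hs N" for k
      using Z that by (cases "k \<in> active N pstar") (force simp: Z_def)+
    have "(\<forall>i. local_KKT N \<rho> p i y) \<longleftrightarrow>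
       (\<forall>a\<in>Xs N. pd a (local_NLP_Lagrangian N \<rho> p (owner N a)) y = 0) \<and>
       (\<forall>k\<in>Gs N. local_con N p k y = 0) \<and>
       (\<forall>k\<in>Hs N. local_con N p k y \<le> 0 \<and> y $ k \<ge> 0 \<and> y $ k * local_con N p k y = 0)"
      unfolding local_KKT_def own_def by blast
    also have "\<dots> \<longleftrightarrow> (\<forall>a\<in>Xs N. residual N \<rho> (p, y) $ a = 0) \<and>
       (\<forall>k\<in>Gs N. residual N \<rho> (p, y) $ k = 0) \<and> (\<forall>k\<in>Hs N. residual N \<rho> (p, y) $ k = 0)"
      using iff by (simp only: residual_nth[OF wf] fst_conv snd_conv cong: ball_cong)
    also have "\<dots> \<longleftrightarrow> residual N \<rho> (p, y) = 0"
      unfolding vec_eq_iff zero_index using kind_cases[OF wf] by metis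
    finally show "(\<forall>i. local_KKT N \<rho> p i y) \<longleftrightarrow> residual N \<rho> (p, y) = 0" .
  qed
qed

lemma local_solution:
  assumes lc: "local_convexity N \<rho> pstar" and cc: "constraint_compatible N pstar" and e: "e > 0"
  obtains \<phi> \<phi>' \<delta> \<epsilon> where "0 < \<delta>" "\<delta> \<le> \<epsilon>" "\<epsilon> \<le> e" "\<phi> pstar = ystar" "(\<phi> has_derivative \<phi>') (at pstar)"
    "\<And>p. p \<in> ball pstar \<delta> \<Longrightarrow> \<phi> p \<in> ball ystar \<epsilon> \<and> residual N \<rho> (p, \<phi> p) = 0"
    "\<And>p y. p \<in> ball pstar \<delta> \<Longrightarrow> y \<in> ball ystar \<epsilon> \<Longrightarrow> (\<forall>i. local_KKT N \<rho> p i y) \<longleftrightarrow> y = \<phi> p"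
proof -
  obtain e0 where e0: "e0 > 0" "\<And>p y. p \<in> ball pstar e0 \<Longrightarrow> y \<in> ball ystar e0 \<Longrightarrow>
      (\<forall>i. local_KKT N \<rho> p i y) \<longleftrightarrow> residual N \<rho> (p, y) = 0"
    by (rule local_KKT_iff_residual) blast
  have "min e e0 > 0" using e e0 by simp
  obtain \<phi> \<phi>' \<delta> \<epsilon> where \<phi>: "0 < \<delta>" "\<delta> \<le> \<epsilon>" "\<epsilon> \<le> min e e0" "\<phi> pstar = ystar"
    "(\<phi> has_derivative \<phi>') (at pstar)" "\<And>p. p \<in> ball pstar \<delta> \<Longrightarrow> \<phi> p \<in> ball ystar \<epsilon>"
    "\<And>p y. p \<in> ball pstar \<delta> \<Longrightarrow> y \<in> ball ystar \<epsilon> \<Longrightarrow> residual N \<rho> (p, y) = 0 \<longleftrightarrow> y = \<phi> p"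
    by (rule implicit_function[OF residual_C1[OF wf] residual_star residual_has_derivative
        residual_deriv_injective[OF lc cc] \<open>min e e0 > 0\<close>]; (assumption | (rule that; assumption)))
  show ?thesis
  proof (rule that[OF \<phi>(1,2) _ \<phi>(4,5)])
    show "\<epsilon> \<le> e" using \<phi>(3) by simp
    show "\<phi> p \<in> ball ystar \<epsilon> \<and> residual N \<rho> (p, \<phi> p) = 0" if "p \<in> ball pstar \<delta>" for p
      using \<phi>(6,7)[OF that] by simp
    show "(\<forall>i. local_KKT N \<rho> p i y) \<longleftrightarrow> y = \<phi> p" if "p \<in> ball pstar \<delta>" "y \<in> ball ystar \<epsilon>" for p y
    proof -
      have "p \<in> ball pstar e0" "y \<in> ball ystar e0" using that \<phi>(2,3) by auto
      then show ?thesis using e0(2) \<phi>(7)[OF that] by blast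
    qed
  qed
qed

lemma solution_map_exists:
  assumes "local_convexity N \<rho> pstar" "constraint_compatible N pstar"
  shows "\<exists>\<Phi>. solution_map N \<rho> pstar \<Phi>"
proof -
  obtain \<phi> \<phi>' \<delta> \<epsilon> where \<phi>: "0 < \<delta>" "\<delta> \<le> \<epsilon>" "\<phi> pstar = ystar"
    "\<And>p. p \<in> ball pstar \<delta> \<Longrightarrow> \<phi> p \<in> ball ystar \<epsilon> \<and> residual N \<rho> (p, \<phi> p) = 0"
    "\<And>p y. p \<in> ball pstar \<delta> \<Longrightarrow> y \<in> ball ystar \<epsilon> \<Longrightarrow> (\<forall>i. local_KKT N \<rho> p i y) \<longleftrightarrow> y = \<phi> p"
    by (rule local_solution[OF assms zero_less_one]) blast
  then have "solution_map N \<rho> pstar \<phi>"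
    unfolding solution_map_def by (intro conjI exI[of _ \<delta>] exI[of _ \<epsilon>] ballI) auto
  then show ?thesis by blast
qed

text \<open>
  Any solution map agrees near \<open>p\<^sup>*\<close> with the implicit function, by the uniqueness in both of their
  neighbourhoods.
\<close>

lemma solution_map_has_derivative:
  assumes "local_convexity N \<rho> pstar" "constraint_compatible N pstar" "solution_map N \<rho> pstar \<Phi>"
  obtains \<Phi>' where "(\<Phi> has_derivative \<Phi>') (at pstar)" "\<And>e. residual_deriv (e, \<Phi>' e) = 0"
proof -
  obtain \<delta>1 \<epsilon>1 where 1: "\<Phi> pstar = ystar" "\<delta>1 > 0" "\<epsilon>1 > 0"
    "\<And>p y. p \<in> ball pstar \<delta>1 \<Longrightarrow> y \<in> ball ystar \<epsilon>1 \<Longrightarrow> (\<forall>i. local_KKT N \<rho> p i y) \<longleftrightarrow> y = \<Phi> p"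
    using assms(3) unfolding solution_map_def by blast
  obtain \<phi> \<phi>' \<delta> \<epsilon> where \<phi>: "0 < \<delta>" "\<delta> \<le> \<epsilon>" "\<epsilon> \<le> \<epsilon>1" "\<phi> pstar = ystar" "(\<phi> has_derivative \<phi>') (at pstar)"
    "\<And>p. p \<in> ball pstar \<delta> \<Longrightarrow> \<phi> p \<in> ball ystar \<epsilon> \<and> residual N \<rho> (p, \<phi> p) = 0"
    "\<And>p y. p \<in> ball pstar \<delta> \<Longrightarrow> y \<in> ball ystar \<epsilon> \<Longrightarrow> (\<forall>i. local_KKT N \<rho> p i y) \<longleftrightarrow> y = \<phi> p"
    by (rule local_solution[OF assms(1,2) 1(3)]) blast
  define d where "d = min \<delta> \<delta>1"
  have d: "d > 0" using \<phi>(1) 1(2) by (simp add: d_def)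
  have eq: "\<phi> p = \<Phi> p" if "p \<in> ball pstar d" for p
  proof -
    have p: "p \<in> ball pstar \<delta>" "p \<in> ball pstar \<delta>1" using that by (auto simp: d_def)
    have y: "\<phi> p \<in> ball ystar \<epsilon>" "\<phi> p \<in> ball ystar \<epsilon>1" using \<phi>(6)[OF p(1)] \<phi>(3) by auto
    then show ?thesis using \<phi>(7)[OF p(1) y(1)] 1(4)[OF p(2) y(2)] by blast
  qed
  have der: "(\<Phi> has_derivative \<phi>') (at pstar)"
    by (rule has_derivative_transform_within_open[OF \<phi>(5) open_ball _ eq]) (use d in auto)
  have "((\<lambda>p. (p, \<phi> p)) has_derivative (\<lambda>e. (e, \<phi>' e))) (at pstar)"
    by (intro has_derivative_Pair has_derivative_ident \<phi>(5))
  from has_derivative_compose[OF this, of "residual N \<rho>" residual_deriv, unfolded \<phi>(4),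
      OF residual_has_derivative]
  have "((\<lambda>p. residual N \<rho> (p, \<phi> p)) has_derivative (\<lambda>e. residual_deriv (e, \<phi>' e))) (at pstar)" .
  then have "((\<lambda>p. 0) has_derivative (\<lambda>e. residual_deriv (e, \<phi>' e))) (at pstar)"
    by (rule has_derivative_transform_within_open[OF _ open_ball[of pstar \<delta>]]) (use \<phi>(1,6) in auto)
  from has_derivative_unique[OF this has_derivative_const]
  have "residual_deriv (e, \<phi>' e) = 0" for e by metis
  with der show ?thesis by (rule that)
qed

lemma con_grad_supported: "k \<in> cons N \<Longrightarrow> supported_on (Xs N) (con_grad k)"
  using con_pd_multiplier[OF wf] by (auto simp: supported_on_def con_grad_def)

lemma inner_con_grad_proj: "k \<in> cons N \<Longrightarrow> con_grad k \<bullet> proj (Xs N) e = con_grad k \<bullet> e"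
  using con_grad_supported[of k] unfolding inner_vec_def
  by (intro sum.cong) (auto simp: supported_on_def)

text \<open>
  The weight with which a decoupled constraint enters \<open>S\<close> at \<open>p\<^sup>*\<close>. It is zero exactly for the
  inactive inequality constraints.
\<close>

definition penalty_weight :: "'k \<Rightarrow> real" where
  "penalty_weight k = (if k \<in> Gs N then 1 else (pstar $ k)\<^sup>2)"

text \<open>
  The sum over the constraints of one agent may be extended to all agents, because the gradient of a
  decoupled constraint lives on the variables of its owner.
\<close>

lemma S_mat_star:
  "S_mat N pstar ystar $ a $ b
    = (\<Sum>k\<in>{k\<in>cons N. decoupled N k}. penalty_weight k * con_grad k $ a * con_grad k $ b)"
proof (cases "a \<in> Xs N \<and> b \<in> Xs N \<and> owner N a = owner N b")
  case True
  let ?i = "owner N a"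
  have "S_mat N pstar ystar $ a $ b
      = (\<Sum>k\<in>Gs N \<inter> {k\<in>own N ?i. decoupled N k}. penalty_weight k * con_grad k $ a * con_grad k $ b)
      + (\<Sum>k\<in>Hs N \<inter> {k\<in>own N ?i. decoupled N k}. penalty_weight k * con_grad k $ a * con_grad k $ b)"
    unfolding S_mat_def vec_lambda_beta Let_def if_P[OF True] shift_dvec[OF wf]
    by (intro arg_cong2[where f="(+)"] sum.cong)
      (use kind_partition(3)[of N] in
        \<open>auto simp: penalty_weight_def con_grad_def dvec_cons[OF wf]\<close>)
  also have "\<dots> = (\<Sum>k\<in>cons N \<inter> {k\<in>own N ?i. decoupled N k}.
      penalty_weight k * con_grad k $ a * con_grad k $ b)"
    by (rule Gs_Hs_sum)
  also have "\<dots> = (\<Sum>k\<in>{k\<in>cons N. decoupled N k}. penalty_weight k * con_grad k $ a * con_grad k $ b)"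
  proof (rule sum.mono_neutral_left)
    show "\<forall>k\<in>{k\<in>cons N. decoupled N k} - cons N \<inter> {k\<in>own N ?i. decoupled N k}.
        penalty_weight k * con_grad k $ a * con_grad k $ b = 0"
    proof
      fix k assume k: "k \<in> {k\<in>cons N. decoupled N k} - cons N \<inter> {k\<in>own N ?i. decoupled N k}"
      then have "con_grad k $ a = 0"
        unfolding con_grad_def vec_lambda_beta
        by (intro decoupled_con_pd_outside[OF wf]) (auto simp: own_def)
      then show "penalty_weight k * con_grad k $ a * con_grad k $ b = 0" by simp
    qed
  qed auto
  finally show ?thesis .
next
  case False
  have "con_grad k $ a = 0 \<or> con_grad k $ b = 0" if "k \<in> cons N" "decoupled N k" for k
  proof -
    have "a \<notin> vars N (owner N k) \<or> b \<notin> vars N (owner N k)" using False by (auto simp: own_def)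
    then show ?thesis
      unfolding con_grad_def vec_lambda_beta using decoupled_con_pd_outside[OF wf that] by blast
  qed
  then have "(\<Sum>k\<in>{k\<in>cons N. decoupled N k}. penalty_weight k * con_grad k $ a * con_grad k $ b) = 0"
    by (intro sum.neutral) auto
  moreover have "S_mat N pstar ystar $ a $ b = 0" using False by (auto simp: S_mat_def)
  ultimately show ?thesis by simp
qed

lemma S_mat_star_apply:
  "(S_mat N pstar ystar *v v) $ a
    = (\<Sum>k\<in>{k\<in>cons N. decoupled N k}. penalty_weight k * con_grad k $ a * (con_grad k \<bullet> v))"
proof -
  have "(S_mat N pstar ystar *v v) $ a
    = (\<Sum>b\<in>UNIV. \<Sum>k\<in>{k\<in>cons N. decoupled N k}. penalty_weight k * con_grad k $ a * (con_grad k $ b * v $ b))"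
    by (simp add: matrix_vector_mult_def S_mat_star sum_distrib_right mult.assoc)
  also have "\<dots> = (\<Sum>k\<in>{k\<in>cons N. decoupled N k}. \<Sum>b\<in>UNIV. penalty_weight k * con_grad k $ a * (con_grad k $ b * v $ b))"
    by (rule sum.swap)
  also have "\<dots> = (\<Sum>k\<in>{k\<in>cons N. decoupled N k}. penalty_weight k * con_grad k $ a * (con_grad k \<bullet> v))"
    by (simp add: inner_vec_def sum_distrib_left)
  finally show ?thesis .
qed

text \<open>
  For a decoupled constraint of nonzero weight, linearizing \<open>g\<^sub>i\<^sub>i(x\<^sub>i + s\<^sub>i) = 0\<close> gives
  \<open>\<nabla>g\<^sub>i\<^sub>i (e\<^sub>i + f\<^sub>i) = 0\<close>, where \<open>f\<close> is the derivative of the solution in direction \<open>e\<close>. A coupled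
  constraint would also see the neighbours' components of \<open>e\<close>, which is why \<open>S\<close> contains only
  decoupled ones.
\<close>

lemma S_mat_solution_derivative:
  assumes "residual_deriv (e, f) = 0"
  shows "S_mat N pstar ystar *v proj (Xs N) f = - (S_mat N pstar ystar *v proj (Xs N) e)"
proof -
  have "penalty_weight k * c * (con_grad k \<bullet> f) = - (penalty_weight k * c * (con_grad k \<bullet> e))"
    if k: "k \<in> cons N" "decoupled N k" for k c
  proof (cases "penalty_weight k = 0")
    case False
    have "con_grad k \<bullet> shift N (owner N k) e f = (\<Sum>b\<in>UNIV. con_grad k $ b * e $ b + con_grad k $ b * f $ b)"
      unfolding inner_vec_def
      by (rule sum.cong)
        (auto simp: shift_def con_grad_def decoupled_con_pd_outside[OF wf k] distrib_left)
    then have sh: "con_grad k \<bullet> shift N (owner N k) e f = con_grad k \<bullet> e + con_grad k \<bullet> f"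
      by (simp add: inner_vec_def sum.distrib)
    have row: "residual_deriv (e, f) $ k = 0" using assms by simp
    have "con_grad k \<bullet> shift N (owner N k) e f = 0"
    proof (cases "k \<in> Gs N")
      case True
      then show ?thesis using row residual_deriv_con(1) by simp
    next
      case kG: False
      then have "k \<in> Hs N" "pstar $ k \<noteq> 0" using k False by (auto simp: penalty_weight_def)
      moreover have "con N k pstar = 0"
        using calculation active_con[of k] inactive_con[of k] by auto
      ultimately show ?thesis using row residual_deriv_con(2)[of k e f] by simp
    qed
    then have "con_grad k \<bullet> f = - (con_grad k \<bullet> e)" using sh by simp
    then show ?thesis by simp
  qed simp
  then show ?thesis
    unfolding vec_eq_iff uminus_vec_def vec_lambda_beta S_mat_star_apply sum_negf[symmetric]
    by (intro allI sum.cong refl) (simp add: inner_con_grad_proj)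
qed

definition algorithm_field :: "(real^'k \<Rightarrow> real^'k) \<Rightarrow> real \<Rightarrow> real \<Rightarrow> real^'k \<Rightarrow> real^'k" where
  "algorithm_field \<Phi> \<beta> \<gamma> p = P_mat N \<rho> \<beta> p (\<Phi> p) *v (\<Phi> p - dvec N p)
     + \<gamma> *\<^sub>R (S_mat N p (\<Phi> p) *v \<Phi> p)"

text \<open>
  Both matrices are multiplied by vectors that vanish at \<open>p\<^sup>*\<close>, so their own derivatives do not
  enter. In the first term, \<open>(0, \<Phi>'e - d e)\<close> is the difference of \<open>(e, \<Phi>'e)\<close>, which the derivative of
  the residual annihilates, and \<open>(e, d e)\<close>.
\<close>

lemma algorithm_field_has_derivative:
  assumes \<Phi>: "(\<Phi> has_derivative \<Phi>') (at pstar)" "\<Phi> pstar = ystar"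
    and \<Phi>': "\<And>e. residual_deriv (e, \<Phi>' e) = 0"
  obtains A where "(algorithm_field \<Phi> \<beta> \<gamma> has_derivative A) (at pstar)"
    "\<And>e a. a \<in> Xs N \<Longrightarrow> A e $ a = - (hessian (Lagrangian N) pstar *v e) $ a
        - \<gamma> * (S_mat N pstar ystar *v proj (Xs N) e) $ a"
    "\<And>e k. k \<in> Gs N \<Longrightarrow> A e $ k = \<beta> * (con_grad k \<bullet> e)"
    "\<And>e k. k \<in> Hs N \<Longrightarrow> A e $ k = \<beta> * (pstar $ k * (con_grad k \<bullet> e) + e $ k * con N k pstar)"
proof -
  define A where "A e = P_mat N \<rho> \<beta> pstar ystar *v (\<Phi>' e - dvec N e)
    + \<gamma> *\<^sub>R (S_mat N pstar ystar *v proj (Xs N) (\<Phi>' e))" for e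
  have graph: "isCont (\<lambda>p. (p, \<Phi> p)) pstar"
    using has_derivative_continuous[OF \<Phi>(1)] by (intro continuous_Pair continuous_ident)
  have contP: "isCont (\<lambda>p. P_mat N \<rho> \<beta> p (\<Phi> p) $ a $ b) pstar" for a b
    using isCont_o2[OF graph, of "\<lambda>z. P_mat N \<rho> \<beta> (fst z) (snd z) $ a $ b"] P_mat_continuous[OF wf]
    by (simp add: continuous_on_eq_continuous_at)
  have contS: "isCont (\<lambda>p. S_mat N p (\<Phi> p) $ a $ b) pstar" for a b
    using isCont_o2[OF graph, of "\<lambda>z. S_mat N (fst z) (snd z) $ a $ b"] S_mat_continuous[OF wf]
    by (simp add: continuous_on_eq_continuous_at)
  have dd: "(dvec N has_derivative dvec N) (at pstar)"
    by (intro bounded_linear_imp_has_derivative)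
      (simp add: linear_conv_bounded_linear[symmetric] linear_dvec[OF wf])
  have d1: "((\<lambda>p. P_mat N \<rho> \<beta> p (\<Phi> p) *v (\<Phi> p - dvec N p)) has_derivative
      (\<lambda>e. P_mat N \<rho> \<beta> pstar (\<Phi> pstar) *v (\<Phi>' e - dvec N e))) (at pstar)"
    by (rule has_derivative_matrix_vector_vanishing[OF contP])
      (intro has_derivative_diff \<Phi>(1) dd, simp add: \<Phi>(2))
  have dp: "((\<lambda>p. proj (Xs N) (\<Phi> p)) has_derivative (\<lambda>e. proj (Xs N) (\<Phi>' e))) (at pstar)"
    by (rule bounded_linear.has_derivative[OF _ \<Phi>(1)])
      (simp add: linear_conv_bounded_linear[symmetric] linear_proj)
  have d2: "((\<lambda>p. S_mat N p (\<Phi> p) *v proj (Xs N) (\<Phi> p)) has_derivative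
      (\<lambda>e. S_mat N pstar (\<Phi> pstar) *v proj (Xs N) (\<Phi>' e))) (at pstar)"
    by (rule has_derivative_matrix_vector_vanishing[OF contS dp]) (simp add: \<Phi>(2) vec_eq_iff dvec_def)
  \<comment> \<open>\<open>\<Phi>(p)\<close> itself does not vanish at \<open>p\<^sup>*\<close>, but \<open>S\<close> reads only its primal part, which does.\<close>
  have S: "S_mat N p y *v proj (Xs N) v = S_mat N p y *v v" for p y v
    unfolding matrix_vector_mult_def vec_eq_iff vec_lambda_beta
    by (intro allI sum.cong refl) (auto simp: S_mat_def)
  have der: "(algorithm_field \<Phi> \<beta> \<gamma> has_derivative A) (at pstar)"
    using has_derivative_add[OF d1 has_derivative_scaleR_right[OF d2, of \<gamma>]]
    unfolding algorithm_field_def[abs_def] A_def[abs_def] \<Phi>(2) S .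
  have P: "(P_mat N \<rho> \<beta> pstar ystar *v (\<Phi>' e - dvec N e)) $ a
      = - ((if a \<in> Xs N then 1 else - \<beta>) * residual_deriv (e, dvec N e) $ a)" for e a
  proof -
    have "linear residual_deriv" by (rule has_derivative_linear[OF residual_has_derivative])
    then have "residual_deriv (0, \<Phi>' e - dvec N e) = residual_deriv (e, \<Phi>' e) - residual_deriv (e, dvec N e)"
      using linear_diff[of residual_deriv "(e, \<Phi>' e)" "(e, dvec N e)"] by simp
    then show ?thesis by (simp add: P_mat_residual_deriv \<Phi>')
  qed
  have Scons: "(S_mat N pstar ystar *v v) $ k = 0" if "k \<in> cons N" for v k
    unfolding matrix_vector_mult_def vec_lambda_beta
    by (rule sum.neutral) (use that kind_partition[of N] in \<open>auto simp: S_mat_def\<close>)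
  show ?thesis
  proof (rule that[OF der])
    show "A e $ a = - (hessian (Lagrangian N) pstar *v e) $ a
        - \<gamma> * (S_mat N pstar ystar *v proj (Xs N) e) $ a" if "a \<in> Xs N" for e a
      using that by (simp add: A_def P residual_deriv_dvec S_mat_solution_derivative[OF \<Phi>'])
    show "A e $ k = \<beta> * (con_grad k \<bullet> e)" if k: "k \<in> Gs N" for e k
    proof -
      have "k \<notin> Xs N" using k kind_partition[of N] by auto
      then show ?thesis using k Scons[of k] by (simp add: A_def P residual_deriv_dvec)
    qed
    show "A e $ k = \<beta> * (pstar $ k * (con_grad k \<bullet> e) + e $ k * con N k pstar)" if k: "k \<in> Hs N" for e k
    proof -
      have "k \<notin> Xs N" using k kind_partition[of N] by auto
      then show ?thesis using k Scons[of k] by (simp add: A_def P residual_deriv_dvec)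
    qed
  qed
qed

lemma penalized_hessian_pos_def:
  assumes sosc: "partial_SOSC N pstar"
  obtains \<gamma>bar where "\<And>\<gamma>. \<gamma> > \<gamma>bar \<Longrightarrow>
    pos_def_block (Xs N) (hessian (Lagrangian N) pstar + \<gamma> *\<^sub>R S_mat N pstar ystar)"
proof -
  let ?H = "hessian (Lagrangian N) pstar"
  let ?S = "S_mat N pstar ystar"
  let ?D = "{k\<in>cons N. decoupled N k}"
  have S_form: "z \<bullet> (?S *v z) = (\<Sum>k\<in>?D. penalty_weight k * (con_grad k \<bullet> z)\<^sup>2)" for z
  proof -
    have "z \<bullet> (?S *v z) = (\<Sum>a\<in>UNIV. \<Sum>k\<in>?D. penalty_weight k * (con_grad k \<bullet> z) * (con_grad k $ a * z $ a))"
      by (simp add: inner_vec_def[of z] S_mat_star_apply sum_distrib_left ac_simps)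
    also have "\<dots> = (\<Sum>k\<in>?D. \<Sum>a\<in>UNIV. penalty_weight k * (con_grad k \<bullet> z) * (con_grad k $ a * z $ a))"
      by (rule sum.swap)
    also have "\<dots> = (\<Sum>k\<in>?D. penalty_weight k * (con_grad k \<bullet> z)\<^sup>2)"
      by (simp add: sum_distrib_left[symmetric] inner_vec_def power2_eq_square mult.assoc)
    finally show ?thesis .
  qed
  have nonneg: "penalty_weight k * (con_grad k \<bullet> z)\<^sup>2 \<ge> 0" for k z
    by (simp add: penalty_weight_def)
  obtain t0 where t0: "t0 \<ge> 0" "\<And>t z. t > t0 \<Longrightarrow> z \<in> {z. supported_on (Xs N) z} \<Longrightarrow> z \<noteq> 0 \<Longrightarrow>
      t * (z \<bullet> (?S *v z)) + z \<bullet> (?H *v z) > 0"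
  proof (rule finsler[OF subspace_supported_on])
    show "continuous_on UNIV (\<lambda>z. z \<bullet> (?S *v z))" "continuous_on UNIV (\<lambda>z. z \<bullet> (?H *v z))"
      by (intro continuous_intros continuous_on_linear_UNIV matrix_vector_mul_linear)+
    show "homogeneous2 (\<lambda>z. z \<bullet> (?S *v z))" "homogeneous2 (\<lambda>z. z \<bullet> (?H *v z))"
      by (rule homogeneous2_form[OF matrix_vector_mul_linear linear_id[unfolded id_def]])+
    show "0 \<le> z \<bullet> (?S *v z)" for z unfolding S_form by (intro sum_nonneg nonneg)
    fix z assume z: "z \<in> {z. supported_on (Xs N) z}" "z \<noteq> 0" "z \<bullet> (?S *v z) = 0"
    have 0: "penalty_weight k * (con_grad k \<bullet> z)\<^sup>2 = 0" if "k \<in> ?D" for k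
      using z(3) that unfolding S_form by (subst (asm) sum_nonneg_eq_0_iff) (use nonneg in auto)
    have "(\<Sum>a\<in>Xs N. pd a (con N k) pstar * z $ a) = 0"
      if k: "k \<in> Gs N \<union> active N pstar" "decoupled N k" for k
    proof -
      have kD: "k \<in> ?D" using k active_con by auto
      have "penalty_weight k \<noteq> 0" using k(1) active_con[of k] by (auto simp: penalty_weight_def)
      then have "con_grad k \<bullet> z = 0" using 0[OF kD] by simp
      moreover have "con_grad k \<bullet> z = (\<Sum>a\<in>Xs N. pd a (con N k) pstar * z $ a)"
        unfolding inner_con_grad
        by (rule sum.mono_neutral_right) (use z(1) in \<open>auto simp: supported_on_def\<close>)
      ultimately show ?thesis by simp
    qed
    then show "0 < z \<bullet> (?H *v z)"
      using sosc z(1,2) unfolding partial_SOSC_def by blast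
  qed auto
  show ?thesis
  proof (rule that[of t0])
    fix \<gamma> assume "\<gamma> > t0"
    from t0(2)[OF this] show "pos_def_block (Xs N) (?H + \<gamma> *\<^sub>R ?S)"
      by (simp add: pos_def_block_def matrix_vector_mult_add_rdistrib inner_add_right
          scaleR_matrix_vector_assoc[symmetric] add.commute)
  qed
qed

lemma algorithm_field_lyapunov_form:
  assumes licq: "LICQ N pstar" and \<beta>: "\<beta> > 0"
    and pd: "pos_def_block (Xs N) (hessian (Lagrangian N) pstar + \<gamma> *\<^sub>R S_mat N pstar ystar)"
    and linA: "linear A"
    and AX: "\<And>e a. a \<in> Xs N \<Longrightarrow> A e $ a = - (hessian (Lagrangian N) pstar *v e) $ a
        - \<gamma> * (S_mat N pstar ystar *v proj (Xs N) e) $ a"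
    and AG: "\<And>e k. k \<in> Gs N \<Longrightarrow> A e $ k = \<beta> * (con_grad k \<bullet> e)"
    and AH: "\<And>e k. k \<in> Hs N \<Longrightarrow> A e $ k = \<beta> * (pstar $ k * (con_grad k \<bullet> e) + e $ k * con N k pstar)"
  obtains B where "symmetric_form B" "\<And>e. e \<noteq> 0 \<Longrightarrow> e \<bullet> B e > 0" "\<And>e. e \<noteq> 0 \<Longrightarrow> A e \<bullet> B e < 0"
proof (rule saddle_point_lyapunov_form)
  let ?E = "Gs N \<union> active N pstar" and ?I = "Hs N - active N pstar"
  have active_sub: "active N pstar \<subseteq> Hs N" by (auto simp: active_def)
  have EI: "?E \<union> ?I = cons N" using active_sub by auto
  show "Xs N \<union> ?E \<union> ?I = UNIV" "Xs N \<inter> ?E = {}" "Xs N \<inter> ?I = {}" "?E \<inter> ?I = {}"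
    using kind_partition[of N] active_sub by auto
  show "A e $ a = - ((hessian (Lagrangian N) pstar + \<gamma> *\<^sub>R S_mat N pstar ystar) *v proj (Xs N) e) $ a
      - (\<Sum>k\<in>?E \<union> ?I. e $ k * con_grad k $ a)" if "a \<in> Xs N" for e a
    unfolding AX[OF that] Lagrangian_hessian_apply[OF wf that, of pstar e] EI
    by (simp add: matrix_vector_mult_add_rdistrib scaleR_matrix_vector_assoc[symmetric] con_grad_def)
  show "A e $ k = (if k \<in> Gs N then \<beta> else \<beta> * pstar $ k) * (con_grad k \<bullet> e)" if "k \<in> ?E" for e k
    using that AG[of k e] AH[of k e] active_con[of k] by auto
  show "A e $ k = - (- \<beta> * con N k pstar) * e $ k" if "k \<in> ?I" for e k
    using that AH[of k e] inactive_con[OF that] by simp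
  show "(if k \<in> Gs N then \<beta> else \<beta> * pstar $ k) > 0" if "k \<in> ?E" for k
    using that \<beta> active_con[of k] by auto
  show "- \<beta> * con N k pstar > 0" if "k \<in> ?I" for k
    using inactive_con[OF that] \<beta> by (simp add: mult_pos_neg)
  show "supported_on (Xs N) (con_grad k)" if "k \<in> ?E \<union> ?I" for k
    using that unfolding EI by (rule con_grad_supported)
  show "e = 0" if e: "supported_on ?E e" "(\<Sum>k\<in>?E. e $ k *\<^sub>R con_grad k) = 0" for e
  proof (rule full_column_rank_independent)
    show "full_column_rank (Xs N) ?E (con_gradients N pstar)" using licq by (simp add: LICQ_def)
    show "(\<Sum>k\<in>?E. con_gradients N pstar $ a $ k * e $ k) = 0" if "a \<in> Xs N" for a
      using arg_cong[OF e(2), of "\<lambda>v. v $ a"]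
      by (simp add: con_gradients_def con_grad_def mult.commute)
  qed (rule e(1))
qed (use linA pd that in auto)

end

theorem corollary2:
  fixes N :: "('v::finite, 'k::finite) nlp"
    and \<rho> :: "'v \<Rightarrow> real" and \<beta> :: real and pstar :: "real^'k"
  assumes "well_formed N"
    and "KKT_point N pstar"
    and "strict_complementarity N pstar" and "LICQ N pstar"
    and "partial_SOSC N pstar"
    and "local_convexity N \<rho> pstar"
    and "constraint_compatible N pstar"
    and "\<beta> > 0"
  shows "(\<exists>\<Phi>. solution_map N \<rho> pstar \<Phi>) \<and>
    (\<forall>\<Phi>. solution_map N \<rho> pstar \<Phi> \<longrightarrow>
      (\<exists>\<gamma>bar. \<forall>\<gamma>. \<gamma> \<ge> 0 \<and> \<gamma> > \<gamma>bar \<longrightarrow>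
        (\<exists>\<alpha>bar>0. \<exists>r>0. \<forall>\<alpha>. 0 < \<alpha> \<and> \<alpha> < 1 \<and> \<alpha> < \<alpha>bar \<longrightarrow>
          (let T = alg_map N \<rho> \<Phi> \<alpha> \<beta> \<gamma> in
             T differentiable (at pstar) \<and>
             (\<forall>p0 \<in> ball pstar r. bounded (range (\<lambda>q. (T ^^ q) p0)) \<and>
                (\<lambda>q. (T ^^ q) p0) \<longlonglongrightarrow> pstar) \<and>
             asymptotic_linear_conv_weighted T pstar r \<and>
             (linear_conv_weighted T pstar r \<or> linear_conv_euclidean T pstar r)))))"
proof (intro conjI allI impI)
  note ctx = assms(1-3)
  show "\<exists>\<Phi>. solution_map N \<rho> pstar \<Phi>"
    by (rule solution_map_exists[OF ctx assms(6,7)])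
  fix \<Phi> assume \<Phi>: "solution_map N \<rho> pstar \<Phi>"
  obtain \<Phi>' where \<Phi>': "(\<Phi> has_derivative \<Phi>') (at pstar)"
      "\<And>e. residual_deriv N \<rho> pstar (e, \<Phi>' e) = 0"
    by (rule solution_map_has_derivative[OF ctx assms(6,7) \<Phi>]) blast
  have \<Phi>star: "\<Phi> pstar = dvec N pstar" using \<Phi> by (simp add: solution_map_def)
  obtain \<gamma>bar where \<gamma>bar: "\<And>\<gamma>. \<gamma> > \<gamma>bar \<Longrightarrow>
      pos_def_block (Xs N) (hessian (Lagrangian N) pstar + \<gamma> *\<^sub>R S_mat N pstar (dvec N pstar))"
    by (rule penalized_hessian_pos_def[OF ctx assms(5)]) blast
  show "\<exists>\<gamma>bar. \<forall>\<gamma>. \<gamma> \<ge> 0 \<and> \<gamma> > \<gamma>bar \<longrightarrow>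
        (\<exists>\<alpha>bar>0. \<exists>r>0. \<forall>\<alpha>. 0 < \<alpha> \<and> \<alpha> < 1 \<and> \<alpha> < \<alpha>bar \<longrightarrow>
          (let T = alg_map N \<rho> \<Phi> \<alpha> \<beta> \<gamma> in
             T differentiable (at pstar) \<and>
             (\<forall>p0 \<in> ball pstar r. bounded (range (\<lambda>q. (T ^^ q) p0)) \<and>
                (\<lambda>q. (T ^^ q) p0) \<longlonglongrightarrow> pstar) \<and>
             asymptotic_linear_conv_weighted T pstar r \<and>
             (linear_conv_weighted T pstar r \<or> linear_conv_euclidean T pstar r)))"
  proof (rule exI[of _ \<gamma>bar], intro allI impI)
    fix \<gamma> assume \<gamma>: "\<gamma> \<ge> 0 \<and> \<gamma> > \<gamma>bar"
    let ?F = "algorithm_field N \<rho> \<Phi> \<beta> \<gamma>"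
    obtain A where A: "(?F has_derivative A) (at pstar)"
      "\<And>e a. a \<in> Xs N \<Longrightarrow> A e $ a = - (hessian (Lagrangian N) pstar *v e) $ a
          - \<gamma> * (S_mat N pstar (dvec N pstar) *v proj (Xs N) e) $ a"
      "\<And>e k. k \<in> Gs N \<Longrightarrow> A e $ k = \<beta> * (con_grad N pstar k \<bullet> e)"
      "\<And>e k. k \<in> Hs N \<Longrightarrow> A e $ k
          = \<beta> * (pstar $ k * (con_grad N pstar k \<bullet> e) + e $ k * con N k pstar)"
      by (rule algorithm_field_has_derivative[OF ctx \<Phi>'(1) \<Phi>star \<Phi>'(2), of \<beta> \<gamma>]) blast
    obtain B where B: "symmetric_form B" "\<And>e. e \<noteq> 0 \<Longrightarrow> e \<bullet> B e > 0" "\<And>e. e \<noteq> 0 \<Longrightarrow> A e \<bullet> B e < 0"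
      by (rule algorithm_field_lyapunov_form[OF ctx assms(4,8) \<gamma>bar has_derivative_linear[OF A(1)] A(2-4)])
        (use \<gamma> in auto)
    have F0: "?F pstar = 0"
    proof -
      have "S_mat N pstar (dvec N pstar) *v dvec N pstar = 0"
        unfolding matrix_vector_mult_def vec_eq_iff vec_lambda_beta zero_index
        by (intro allI sum.neutral) (auto simp: S_mat_def dvec_def)
      then show ?thesis by (simp add: algorithm_field_def[OF ctx] \<Phi>star)
    qed
    have T: "alg_map N \<rho> \<Phi> \<alpha> \<beta> \<gamma> = (\<lambda>p. p + \<alpha> *\<^sub>R ?F p)" for \<alpha>
      by (auto simp: alg_map_def algorithm_field_def[OF ctx] Let_def)
    show "\<exists>\<alpha>bar>0. \<exists>r>0. \<forall>\<alpha>. 0 < \<alpha> \<and> \<alpha> < 1 \<and> \<alpha> < \<alpha>bar \<longrightarrow>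
          (let T = alg_map N \<rho> \<Phi> \<alpha> \<beta> \<gamma> in
             T differentiable (at pstar) \<and>
             (\<forall>p0 \<in> ball pstar r. bounded (range (\<lambda>q. (T ^^ q) p0)) \<and>
                (\<lambda>q. (T ^^ q) p0) \<longlonglongrightarrow> pstar) \<and>
             asymptotic_linear_conv_weighted T pstar r \<and>
             (linear_conv_weighted T pstar r \<or> linear_conv_euclidean T pstar r))"
      using damped_iteration_linear_convergence[OF B(1,2) A(1) F0 B(3)]
      unfolding T Let_def by blast
  qed
qed

end
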